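(* Let $\mathscr{C}$ be an additive category equipped with an auto-equivalence $[1]$, and put $\mathbf{E}^1=\mathscr{C}(-,-[1])\colon\mathscr{C}^{\mathrm{op}}\times\mathscr{C}\to\mathit{Ab}$. Then the following hold. (1) Suppose $\mathscr{C}$ is a triangulated category with shift functor $[1]$. For any $\delta\in\mathbf{E}^1(C,A)=\mathscr{C}(C,A[1])$, take a distinguished triangle $A\xrightarrow{x}B\xrightarrow{y}C\xrightarrow{\delta}A[1]$ and define $\mathfrak{s}(\delta)=[A\xrightarrow{x}B\xrightarrow{y}C]$ (which does not depend on the choice of the distinguished triangle). With this definition, $(\mathscr{C},\mathbf{E}^1,\mathfrak{s})$ becomes an extriangulated category. (2) Suppose we are given $\mathfrak{s}$ such that $(\mathscr{C},\mathbf{E}^1,\mathfrak{s})$ is an extriangulated category. Define $A\xrightarrow{x}B\xrightarrow{y}C\xrightarrow{\delta}A[1]$ to be a distinguished triangle if and only if $\mathfrak{s}(\delta)=[A\xrightarrow{x}B\xrightarrow{y}C]$. With this class of distinguished triangles, $\mathscr{C}$ becomes a triangulated category. By construction, distinguished triangles correspond to $\mathbf{E}^1$-triangles by (1) and (2).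
   Context: Extriangulated categories. Let $\mathscr{C}$ be an additive category and $\mathbb{E}\colon\mathscr{C}^{\mathrm{op}}\times\mathscr{C}\to\mathit{Ab}$ a functor. Elements $\delta\in\mathbb{E}(C,A)$ are called $\mathbb{E}$-extensions; for $a\colon A\to A'$ and $c\colon C'\to C$ put $a_*\delta=\mathbb{E}(C,a)(\delta)$ and $c^*\delta=\mathbb{E}(c,A)(\delta)$. A morphism $(a,c)\colon\delta\to\delta'$ from $\delta\in\mathbb{E}(C,A)$ to $\delta'\in\mathbb{E}(C',A')$ is a pair $a\colon A\to A'$, $c\colon C\to C'$ with $a_*\delta=c^*\delta'$. Sequences $A\xrightarrow{x}B\xrightarrow{y}C$ and $A\xrightarrow{x'}B'\xrightarrow{y'}C$ are equivalent if there is an isomorphism $b\colon B\to B'$ with $bx=x'$, $y'b=y$; the class is written $[A\xrightarrow{x}B\xrightarrow{y}C]$. A realization $\mathfrak{s}$ assigns to each $\delta\in\mathbb{E}(C,A)$ such a class $\mathfrak{s}(\delta)=[A\xrightarrow{x}B\xrightarrow{y}C]$ so that for every morphism $(a,c)\colon\delta\to\delta'$, with $\mathfrak{s}(\delta')=[A'\xrightarrow{x'}B'\xrightarrow{y'}C']$, there is $b\colon B\to B'$ with $bx=x'a$, $y'b=cy$ (then $(a,b,c)$ is said to realize $(a,c)$). It is additive if $\mathfrak{s}(0)=[A\to A\oplus C\to C]$ (canonical inclusion and projection) and $\mathfrak{s}(\delta\oplus\delta')=[A\oplus A'\xrightarrow{x\oplus x'}B\oplus B'\xrightarrow{y\oplus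 y'}C\oplus C']$, where $\delta\oplus\delta'\in\mathbb{E}(C\oplus C',A\oplus A')$ corresponds to $(\delta,0,0,\delta')$. If $\mathfrak{s}(\delta)=[A\xrightarrow{x}B\xrightarrow{y}C]$, the sequence is called a conflation, $x$ an inflation, $y$ a deflation, and one speaks of the $\mathbb{E}$-triangle $A\xrightarrow{x}B\xrightarrow{y}C\overset{\delta}{\dashrightarrow}$. The triple $(\mathscr{C},\mathbb{E},\mathfrak{s})$ is an extriangulated category if: (ET1) $\mathbb{E}$ is biadditive; (ET2) $\mathfrak{s}$ is an additive realization; (ET3) for $\mathbb{E}$-triangles $A\xrightarrow{x}B\xrightarrow{y}C\overset{\delta}{\dashrightarrow}$, $A'\xrightarrow{x'}B'\xrightarrow{y'}C'\overset{\delta'}{\dashrightarrow}$ and $a,b$ with $bx=x'a$ there is $c$ such that $(a,c)\colon\delta\to\delta'$ is a morphism realized by $(a,b,c)$; (ET3)$^{\mathrm{op}}$ for $b,c$ with $y'b=cy$ there is $a$ such that $(a,c)\colon\delta\to\delta'$ is a morphism realized by $(a,b,c)$; (ET4) for $\mathbb{E}$-triangles $A\xrightarrow{f}B\xrightarrow{f'}D\overset{\delta}{\dashrightarrow}$ and $B\xrightarrow{g}C\xrightarrow{g'}F\overset{\delta'}{\dashrightarrow}$ there are an $\mathbb{E}$-triangle $A\xrightarrow{h}C\xrightarrow{h'}E\overset{\delta''}{\dashrightarrow}$ with $h=gf$ and $d\colon D\to E$, $e\colon E\to F$ with $df'=h'g$, $eh'=g'$, such that $D\xrightarrow{d}E\xrightarrow{e}F$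 realizes $f'_*\delta'$, $d^*\delta''=\delta$ and $f_*\delta''=e^*\delta'$; (ET4)$^{\mathrm{op}}$ for $\mathbb{E}$-triangles $D\xrightarrow{f'}A\xrightarrow{f}B\overset{\delta}{\dashrightarrow}$ and $F\xrightarrow{g'}B\xrightarrow{g}C\overset{\delta'}{\dashrightarrow}$ there are an $\mathbb{E}$-triangle $E\xrightarrow{h'}A\xrightarrow{h}C\overset{\delta''}{\dashrightarrow}$ with $h=gf$ and $d\colon D\to E$, $e\colon E\to F$ with $h'd=f'$, $fh'=g'e$, such that $D\xrightarrow{d}E\xrightarrow{e}F$ realizes $g'^*\delta$, $\delta'=e_*\delta''$ and $d_*\delta=g^*\delta''$. *)

theory Defs
  imports "HOL-Algebra.Group"
begin

section \<open>Categories\<close>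

text \<open>
  Categories have an explicit set of objects and an explicit set of arrows.  Each arrow knows its
  domain and codomain, so distinct hom-sets are disjoint.  Composition \<open>g \<cdot> f\<close> is constrained
  only when \<open>Cod f = Dom g\<close>.
\<close>

record ('o, 'm) cat =
  Obj :: "'o set"
  Arr :: "'m set"
  Dom :: "'m \<Rightarrow> 'o"
  Cod :: "'m \<Rightarrow> 'o"
  Id :: "'o \<Rightarrow> 'm"
  Comp :: "'m \<Rightarrow> 'm \<Rightarrow> 'm"  (infixr \<open>\<cdot>\<index>\<close> 70)

definition Hom :: "('o, 'm, 'x) cat_scheme \<Rightarrow> 'o \<Rightarrow> 'o \<Rightarrow> 'm set"  (\<open>Hom\<index>\<close>)
  where "Hom\<^bsub>C\<^esub> A B = {f \<in> Arr C. Dom C f = A \<and> Cod C f = B}"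

locale category =
  fixes \<C> :: "('o, 'm, 'x) cat_scheme" (structure)
  assumes Dom_Obj: "f \<in> Arr \<C> \<Longrightarrow> Dom \<C> f \<in> Obj \<C>"
    and Cod_Obj: "f \<in> Arr \<C> \<Longrightarrow> Cod \<C> f \<in> Obj \<C>"
    and Id_Hom: "A \<in> Obj \<C> \<Longrightarrow> Id \<C> A \<in> Hom A A"
    and Comp_Hom: "\<lbrakk>f \<in> Hom A B; g \<in> Hom B D\<rbrakk> \<Longrightarrow> g \<cdot> f \<in> Hom A D"
    and Comp_Id: "f \<in> Hom A B \<Longrightarrow> f \<cdot> Id \<C> A = f"
    and Id_Comp: "f \<in> Hom A B \<Longrightarrow> Id \<C> B \<cdot> f = f"
    and Comp_assoc: "\<lbrakk>f \<in> Hom A B; g \<in> Hom B D; h \<in> Hom D F\<rbrakk> \<Longrightarrow> (h \<cdot> g) \<cdot> f = h \<cdot> (g \<cdot> f)"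

definition is_iso :: "('o, 'm, 'x) cat_scheme \<Rightarrow> 'o \<Rightarrow> 'o \<Rightarrow> 'm \<Rightarrow> bool"
  where "is_iso C A B f \<longleftrightarrow> f \<in> Hom\<^bsub>C\<^esub> A B \<and>
    (\<exists>g \<in> Hom\<^bsub>C\<^esub> B A. g \<cdot>\<^bsub>C\<^esub> f = Id C A \<and> f \<cdot>\<^bsub>C\<^esub> g = Id C B)"

definition zero_object :: "('o, 'm, 'x) cat_scheme \<Rightarrow> 'o \<Rightarrow> bool"
  where "zero_object C Z \<longleftrightarrow> Z \<in> Obj C \<and>
    (\<forall>A \<in> Obj C. (\<exists>!f. f \<in> Hom\<^bsub>C\<^esub> A Z) \<and> (\<exists>!f. f \<in> Hom\<^bsub>C\<^esub> Z A))"

subsection \<open>Functors and auto-equivalences\<close>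

record ('o, 'm, 'p, 'n) ftor =
  objm :: "'o \<Rightarrow> 'p"
  arrm :: "'m \<Rightarrow> 'n"

type_synonym ('o, 'm) endoftor = "('o, 'm, 'o, 'm) ftor"

definition is_functor ::
    "('o, 'm, 'x) cat_scheme \<Rightarrow> ('p, 'n, 'y) cat_scheme \<Rightarrow> ('o, 'm, 'p, 'n) ftor \<Rightarrow> bool"
  where "is_functor C D F \<longleftrightarrow>
    (\<forall>A \<in> Obj C. objm F A \<in> Obj D) \<and>
    (\<forall>A \<in> Obj C. \<forall>B \<in> Obj C. \<forall>f \<in> Hom\<^bsub>C\<^esub> A B. arrm F f \<in> Hom\<^bsub>D\<^esub> (objm F A) (objm F B)) \<and>
    (\<forall>A \<in> Obj C. arrm F (Id C A) = Id D (objm F A)) \<and>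
    (\<forall>f \<in> Arr C. \<forall>g \<in> Arr C. Cod C f = Dom C g \<longrightarrow>
        arrm F (g \<cdot>\<^bsub>C\<^esub> f) = arrm F g \<cdot>\<^bsub>D\<^esub> arrm F f)"

definition id_ftor :: "('o, 'm) endoftor"
  where "id_ftor = \<lparr>objm = (\<lambda>A. A), arrm = (\<lambda>f. f)\<rparr>"

definition comp_ftor ::
    "('p, 'n, 'q, 'k) ftor \<Rightarrow> ('o, 'm, 'p, 'n) ftor \<Rightarrow> ('o, 'm, 'q, 'k) ftor"
  where "comp_ftor G F = \<lparr>objm = objm G \<circ> objm F, arrm = arrm G \<circ> arrm F\<rparr>"

definition natural_iso ::
    "('o, 'm, 'x) cat_scheme \<Rightarrow> ('p, 'n, 'y) cat_scheme \<Rightarrow>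
     ('o, 'm, 'p, 'n) ftor \<Rightarrow> ('o, 'm, 'p, 'n) ftor \<Rightarrow> ('o \<Rightarrow> 'n) \<Rightarrow> bool"
  where "natural_iso C D F G \<eta> \<longleftrightarrow>
    (\<forall>A \<in> Obj C. is_iso D (objm F A) (objm G A) (\<eta> A)) \<and>
    (\<forall>A \<in> Obj C. \<forall>B \<in> Obj C. \<forall>f \<in> Hom\<^bsub>C\<^esub> A B.
        \<eta> B \<cdot>\<^bsub>D\<^esub> arrm F f = arrm G f \<cdot>\<^bsub>D\<^esub> \<eta> A)"

definition auto_equivalence :: "('o, 'm, 'x) cat_scheme \<Rightarrow> ('o, 'm) endoftor \<Rightarrow> bool"
  where "auto_equivalence C S \<longleftrightarrow> is_functor C C S \<and>
    (\<exists>G. is_functor C C G \<and>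
      (\<exists>\<eta>. natural_iso C C id_ftor (comp_ftor G S) \<eta>) \<and>
      (\<exists>\<epsilon>. natural_iso C C (comp_ftor S G) id_ftor \<epsilon>))"

subsection \<open>Additive categories\<close>

record ('o, 'm) addcat = "('o, 'm) cat" +
  Add :: "'m \<Rightarrow> 'm \<Rightarrow> 'm"  (infixl \<open>\<boxplus>\<index>\<close> 65)
  Zero :: "'o \<Rightarrow> 'o \<Rightarrow> 'm"

definition Hom_group :: "('o, 'm, 'x) addcat_scheme \<Rightarrow> 'o \<Rightarrow> 'o \<Rightarrow> 'm monoid"
  where "Hom_group C A B = \<lparr>carrier = Hom\<^bsub>C\<^esub> A B, mult = Add C, one = Zero C A B\<rparr>"

definition Neg :: "('o, 'm, 'x) addcat_scheme \<Rightarrow> 'm \<Rightarrow> 'm"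
  where "Neg C f = inv\<^bsub>Hom_group C (Dom C f) (Cod C f)\<^esub> f"

locale preadditive_category = category \<C>
  for \<C> :: "('o, 'm, 'x) addcat_scheme" (structure) +
  assumes Hom_comm_group: "\<lbrakk>A \<in> Obj \<C>; B \<in> Obj \<C>\<rbrakk> \<Longrightarrow> comm_group (Hom_group \<C> A B)"
    and Comp_Add: "\<lbrakk>f \<in> Hom A B; f' \<in> Hom A B; g \<in> Hom B D\<rbrakk>
      \<Longrightarrow> g \<cdot> (f \<boxplus> f') = (g \<cdot> f) \<boxplus> (g \<cdot> f')"
    and Add_Comp: "\<lbrakk>f \<in> Hom A B; g \<in> Hom B D; g' \<in> Hom B D\<rbrakk>
      \<Longrightarrow> (g \<boxplus> g') \<cdot> f = (g \<cdot> f) \<boxplus> (g' \<cdot> f)"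

record ('o, 'm) biprod =
  vertex :: 'o
  inl :: 'm
  inr :: 'm
  prl :: 'm
  prr :: 'm

definition is_biproduct :: "('o, 'm, 'x) addcat_scheme \<Rightarrow> 'o \<Rightarrow> 'o \<Rightarrow> ('o, 'm) biprod \<Rightarrow> bool"
  where "is_biproduct C A B P \<longleftrightarrow>
    A \<in> Obj C \<and> B \<in> Obj C \<and> vertex P \<in> Obj C \<and>
    inl P \<in> Hom\<^bsub>C\<^esub> A (vertex P) \<and> inr P \<in> Hom\<^bsub>C\<^esub> B (vertex P) \<and>
    prl P \<in> Hom\<^bsub>C\<^esub> (vertex P) A \<and> prr P \<in> Hom\<^bsub>C\<^esub> (vertex P) B \<and>
    prl P \<cdot>\<^bsub>C\<^esub> inl P = Id C A \<and> prr P \<cdot>\<^bsub>C\<^esub> inr P = Id C B \<and>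
    prr P \<cdot>\<^bsub>C\<^esub> inl P = Zero C A B \<and> prl P \<cdot>\<^bsub>C\<^esub> inr P = Zero C B A \<and>
    (inl P \<cdot>\<^bsub>C\<^esub> prl P) \<boxplus>\<^bsub>C\<^esub> (inr P \<cdot>\<^bsub>C\<^esub> prr P) = Id C (vertex P)"

locale additive_category = preadditive_category \<C>
  for \<C> :: "('o, 'm, 'x) addcat_scheme" (structure) +
  assumes ex_zero_object: "\<exists>Z. zero_object \<C> Z"
    and ex_biproduct: "\<lbrakk>A \<in> Obj \<C>; B \<in> Obj \<C>\<rbrakk> \<Longrightarrow> \<exists>P. is_biproduct \<C> A B P"

text \<open>The morphism \<open>x \<oplus> x'\<close> from the biproduct \<open>P\<close> to the biproduct \<open>Q\<close>.\<close>

definition dsum ::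
    "('o, 'm, 'x) addcat_scheme \<Rightarrow> ('o, 'm) biprod \<Rightarrow> ('o, 'm) biprod \<Rightarrow> 'm \<Rightarrow> 'm \<Rightarrow> 'm"
  where "dsum C P Q x x' =
    (inl Q \<cdot>\<^bsub>C\<^esub> x \<cdot>\<^bsub>C\<^esub> prl P) \<boxplus>\<^bsub>C\<^esub> (inr Q \<cdot>\<^bsub>C\<^esub> x' \<cdot>\<^bsub>C\<^esub> prr P)"

definition additive_functor ::
    "('o, 'm, 'x) addcat_scheme \<Rightarrow> ('p, 'n, 'y) addcat_scheme \<Rightarrow> ('o, 'm, 'p, 'n) ftor \<Rightarrow> bool"
  where "additive_functor C D F \<longleftrightarrow> is_functor C D F \<and>
    (\<forall>A \<in> Obj C. \<forall>B \<in> Obj C. \<forall>f \<in> Hom\<^bsub>C\<^esub> A B. \<forall>g \<in> Hom\<^bsub>C\<^esub> A B.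
        arrm F (f \<boxplus>\<^bsub>C\<^esub> g) = arrm F f \<boxplus>\<^bsub>D\<^esub> arrm F g)"


section \<open>Extriangulated categories\<close>

text \<open>
  Data of a functor \<open>C\<^sup>o\<^sup>p \<times> C \<rightarrow> Ab\<close>.  The first argument is the contravariant one: for
  \<open>c : C' \<rightarrow> C\<close> and \<open>a : A \<rightarrow> A'\<close>, \<open>earr E c a\<close> maps \<open>eobj E C A\<close> to \<open>eobj E C' A'\<close>.
  The groups \<open>eobj E C A\<close> need not be disjoint, so an extension does not determine its end terms;
  these are therefore passed explicitly below.
\<close>

record ('o, 'm, 'e) extftor =
  eobj :: "'o \<Rightarrow> 'o \<Rightarrow> 'e monoid"
  earr :: "'m \<Rightarrow> 'm \<Rightarrow> 'e \<Rightarrow> 'e"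

abbreviation Ext :: "('o, 'm, 'e) extftor \<Rightarrow> 'o \<Rightarrow> 'o \<Rightarrow> 'e set"
  where "Ext E C A \<equiv> carrier (eobj E C A)"

definition is_Ab_bifunctor :: "('o, 'm, 'x) addcat_scheme \<Rightarrow> ('o, 'm, 'e) extftor \<Rightarrow> bool"
  where "is_Ab_bifunctor \<C> E \<longleftrightarrow>
    (\<forall>C \<in> Obj \<C>. \<forall>A \<in> Obj \<C>. comm_group (eobj E C A)) \<and>
    (\<forall>C \<in> Obj \<C>. \<forall>C' \<in> Obj \<C>. \<forall>A \<in> Obj \<C>. \<forall>A' \<in> Obj \<C>.
      \<forall>c \<in> Hom\<^bsub>\<C>\<^esub> C' C. \<forall>a \<in> Hom\<^bsub>\<C>\<^esub> A A'. earr E c a \<in> hom (eobj E C A) (eobj E C' A')) \<and>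
    (\<forall>C \<in> Obj \<C>. \<forall>A \<in> Obj \<C>. \<forall>\<delta> \<in> Ext E C A. earr E (Id \<C> C) (Id \<C> A) \<delta> = \<delta>) \<and>
    (\<forall>C \<in> Obj \<C>. \<forall>C' \<in> Obj \<C>. \<forall>C'' \<in> Obj \<C>. \<forall>A \<in> Obj \<C>. \<forall>A' \<in> Obj \<C>. \<forall>A'' \<in> Obj \<C>.
      \<forall>c \<in> Hom\<^bsub>\<C>\<^esub> C' C. \<forall>c' \<in> Hom\<^bsub>\<C>\<^esub> C'' C'. \<forall>a \<in> Hom\<^bsub>\<C>\<^esub> A A'. \<forall>a' \<in> Hom\<^bsub>\<C>\<^esub> A' A''.
      \<forall>\<delta> \<in> Ext E C A. earr E (c \<cdot>\<^bsub>\<C>\<^esub> c') (a' \<cdot>\<^bsub>\<C>\<^esub> a) \<delta> = earr E c' a' (earr E c a \<delta>))"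

definition biadditive :: "('o, 'm, 'x) addcat_scheme \<Rightarrow> ('o, 'm, 'e) extftor \<Rightarrow> bool"
  where "biadditive \<C> E \<longleftrightarrow>
    (\<forall>C \<in> Obj \<C>. \<forall>A \<in> Obj \<C>. \<forall>A' \<in> Obj \<C>. \<forall>a \<in> Hom\<^bsub>\<C>\<^esub> A A'. \<forall>b \<in> Hom\<^bsub>\<C>\<^esub> A A'. \<forall>\<delta> \<in> Ext E C A.
      earr E (Id \<C> C) (a \<boxplus>\<^bsub>\<C>\<^esub> b) \<delta>
        = earr E (Id \<C> C) a \<delta> \<otimes>\<^bsub>eobj E C A'\<^esub> earr E (Id \<C> C) b \<delta>) \<and>
    (\<forall>C \<in> Obj \<C>. \<forall>C' \<in> Obj \<C>. \<forall>A \<in> Obj \<C>. \<forall>c \<in> Hom\<^bsub>\<C>\<^esub> C' C. \<forall>d \<in> Hom\<^bsub>\<C>\<^esub> C' C. \<forall>\<delta> \<in> Ext E C A.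
      earr E (c \<boxplus>\<^bsub>\<C>\<^esub> d) (Id \<C> A) \<delta>
        = earr E c (Id \<C> A) \<delta> \<otimes>\<^bsub>eobj E C' A\<^esub> earr E d (Id \<C> A) \<delta>)"

text \<open>
  For \<open>\<delta> \<in> Ext E C A\<close>: \<open>push \<C> E C a \<delta>\<close> is \<open>a\<^sub>* \<delta>\<close>, and \<open>pull \<C> E A c \<delta>\<close> is the
  pullback of \<open>\<delta>\<close> along \<open>c\<close>.
\<close>

definition push :: "('o, 'm, 'x) addcat_scheme \<Rightarrow> ('o, 'm, 'e) extftor \<Rightarrow> 'o \<Rightarrow> 'm \<Rightarrow> 'e \<Rightarrow> 'e"
  where "push \<C> E C a \<delta> = earr E (Id \<C> C) a \<delta>"

definition pull :: "('o, 'm, 'x) addcat_scheme \<Rightarrow> ('o, 'm, 'e) extftor \<Rightarrow> 'o \<Rightarrow> 'm \<Rightarrow> 'e \<Rightarrow> 'e"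
  where "pull \<C> E A c \<delta> = earr E c (Id \<C> A) \<delta>"

text \<open>
  The equivalence class of the sequence \<open>A \<rightarrow> B \<rightarrow> C\<close> given by \<open>x\<close> and \<open>y\<close>, where \<open>A\<close>, \<open>B\<close>
  and \<open>C\<close> are read off from \<open>x\<close> and \<open>y\<close>.
\<close>

definition seq_class :: "('o, 'm, 'x) cat_scheme \<Rightarrow> 'm \<Rightarrow> 'm \<Rightarrow> ('m \<times> 'm) set"
  where "seq_class \<C> x y = {(x', y'). \<exists>B'.
    x' \<in> Hom\<^bsub>\<C>\<^esub> (Dom \<C> x) B' \<and> y' \<in> Hom\<^bsub>\<C>\<^esub> B' (Cod \<C> y) \<and>
    (\<exists>b. is_iso \<C> (Cod \<C> x) B' b \<and> b \<cdot>\<^bsub>\<C>\<^esub> x = x' \<and> y' \<cdot>\<^bsub>\<C>\<^esub> b = y)}"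

text \<open>
  The assignment \<open>s\<close> takes the end terms \<open>C\<close>, \<open>A\<close> and an extension in \<open>Ext E C A\<close>.  Its
  values for other arguments are irrelevant.
\<close>

type_synonym ('o, 'm, 'e) rlz = "'o \<Rightarrow> 'o \<Rightarrow> 'e \<Rightarrow> ('m \<times> 'm) set"

definition E_triangle ::
    "('o, 'm, 'x) addcat_scheme \<Rightarrow> ('o, 'm, 'e) extftor \<Rightarrow> ('o, 'm, 'e) rlz \<Rightarrow>
     'o \<Rightarrow> 'o \<Rightarrow> 'o \<Rightarrow> 'm \<Rightarrow> 'm \<Rightarrow> 'e \<Rightarrow> bool"
  where "E_triangle \<C> E s A B C x y \<delta> \<longleftrightarrow>
    A \<in> Obj \<C> \<and> B \<in> Obj \<C> \<and> C \<in> Obj \<C> \<and>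
    x \<in> Hom\<^bsub>\<C>\<^esub> A B \<and> y \<in> Hom\<^bsub>\<C>\<^esub> B C \<and> \<delta> \<in> Ext E C A \<and> s C A \<delta> = seq_class \<C> x y"

definition is_realization ::
    "('o, 'm, 'x) addcat_scheme \<Rightarrow> ('o, 'm, 'e) extftor \<Rightarrow> ('o, 'm, 'e) rlz \<Rightarrow> bool"
  where "is_realization \<C> E s \<longleftrightarrow>
    (\<forall>C \<in> Obj \<C>. \<forall>A \<in> Obj \<C>. \<forall>\<delta> \<in> Ext E C A. \<exists>B x y. E_triangle \<C> E s A B C x y \<delta>) \<and>
    (\<forall>A B C x y \<delta> A' B' C' x' y' \<delta>'.
      E_triangle \<C> E s A B C x y \<delta> \<longrightarrow> E_triangle \<C> E s A' B' C' x' y' \<delta>' \<longrightarrow>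
      (\<forall>a \<in> Hom\<^bsub>\<C>\<^esub> A A'. \<forall>c \<in> Hom\<^bsub>\<C>\<^esub> C C'. push \<C> E C a \<delta> = pull \<C> E A' c \<delta>' \<longrightarrow>
        (\<exists>b \<in> Hom\<^bsub>\<C>\<^esub> B B'. b \<cdot>\<^bsub>\<C>\<^esub> x = x' \<cdot>\<^bsub>\<C>\<^esub> a \<and> y' \<cdot>\<^bsub>\<C>\<^esub> b = c \<cdot>\<^bsub>\<C>\<^esub> y)))"

text \<open>
  \<open>\<theta> \<in> Ext E (C \<oplus> C') (A \<oplus> A')\<close> has components \<open>(\<delta>, 0, 0, \<delta>')\<close>, where \<open>Q\<close> is the
  biproduct \<open>C \<oplus> C'\<close> and \<open>P\<close> is the biproduct \<open>A \<oplus> A'\<close>.  If \<open>E\<close> is biadditive, exactly one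
  \<open>\<theta>\<close> has this property, namely \<open>\<delta> \<oplus> \<delta>'\<close>.
\<close>

definition is_ext_dsum ::
    "('o, 'm, 'e) extftor \<Rightarrow> 'o \<Rightarrow> 'o \<Rightarrow> 'o \<Rightarrow> 'o \<Rightarrow> ('o, 'm) biprod \<Rightarrow> ('o, 'm) biprod \<Rightarrow>
     'e \<Rightarrow> 'e \<Rightarrow> 'e \<Rightarrow> bool"
  where "is_ext_dsum E C C' A A' Q P \<delta> \<delta>' \<theta> \<longleftrightarrow>
    \<theta> \<in> Ext E (vertex Q) (vertex P) \<and>
    earr E (inl Q) (prl P) \<theta> = \<delta> \<and>
    earr E (inl Q) (prr P) \<theta> = \<one>\<^bsub>eobj E C A'\<^esub> \<and>
    earr E (inr Q) (prl P) \<theta> = \<one>\<^bsub>eobj E C' A\<^esub> \<and>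
    earr E (inr Q) (prr P) \<theta> = \<delta>'"

definition additive_realization ::
    "('o, 'm, 'x) addcat_scheme \<Rightarrow> ('o, 'm, 'e) extftor \<Rightarrow> ('o, 'm, 'e) rlz \<Rightarrow> bool"
  where "additive_realization \<C> E s \<longleftrightarrow> is_realization \<C> E s \<and>
    (\<forall>A C P. is_biproduct \<C> A C P \<longrightarrow>
      s C A \<one>\<^bsub>eobj E C A\<^esub> = seq_class \<C> (inl P) (prr P)) \<and>
    (\<forall>A B C x y \<delta> A' B' C' x' y' \<delta>' P\<^sub>A P\<^sub>B P\<^sub>C \<theta>.
      E_triangle \<C> E s A B C x y \<delta> \<longrightarrow> E_triangle \<C> E s A' B' C' x' y' \<delta>' \<longrightarrow>
      is_biproduct \<C> A A' P\<^sub>A \<longrightarrow> is_biproduct \<C> B B' P\<^sub>B \<longrightarrow> is_biproduct \<C> C C' P\<^sub>C \<longrightarrow>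
      is_ext_dsum E C C' A A' P\<^sub>C P\<^sub>A \<delta> \<delta>' \<theta> \<longrightarrow>
      s (vertex P\<^sub>C) (vertex P\<^sub>A) \<theta>
        = seq_class \<C> (dsum \<C> P\<^sub>A P\<^sub>B x x') (dsum \<C> P\<^sub>B P\<^sub>C y y'))"

locale extriangulated_category = additive_category \<C>
  for \<C> :: "('o, 'm, 'x) addcat_scheme" (structure)
    and E :: "('o, 'm, 'e) extftor"
    and s :: "('o, 'm, 'e) rlz" +
  assumes E_bifunctor: "is_Ab_bifunctor \<C> E"
    and ET1: "biadditive \<C> E"
    and ET2: "additive_realization \<C> E s"
    and ET3:
      "\<lbrakk>E_triangle \<C> E s A B C x y \<delta>; E_triangle \<C> E s A' B' C' x' y' \<delta>';
        a \<in> Hom A A'; b \<in> Hom B B'; b \<cdot> x = x' \<cdot> a\<rbrakk>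
       \<Longrightarrow> \<exists>c \<in> Hom C C'. push \<C> E C a \<delta> = pull \<C> E A' c \<delta>' \<and> y' \<cdot> b = c \<cdot> y"
    and ET3op:
      "\<lbrakk>E_triangle \<C> E s A B C x y \<delta>; E_triangle \<C> E s A' B' C' x' y' \<delta>';
        b \<in> Hom B B'; c \<in> Hom C C'; y' \<cdot> b = c \<cdot> y\<rbrakk>
       \<Longrightarrow> \<exists>a \<in> Hom A A'. push \<C> E C a \<delta> = pull \<C> E A' c \<delta>' \<and> b \<cdot> x = x' \<cdot> a"
    and ET4:
      "\<lbrakk>E_triangle \<C> E s A B D f f' \<delta>; E_triangle \<C> E s B C F g g' \<delta>'\<rbrakk>
       \<Longrightarrow> \<exists>G h h' \<delta>'' d e.
             E_triangle \<C> E s A C G h h' \<delta>'' \<and> h = g \<cdot> f \<and>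
             d \<in> Hom D G \<and> e \<in> Hom G F \<and> d \<cdot> f' = h' \<cdot> g \<and> e \<cdot> h' = g' \<and>
             E_triangle \<C> E s D G F d e (push \<C> E F f' \<delta>') \<and>
             pull \<C> E A d \<delta>'' = \<delta> \<and>
             push \<C> E G f \<delta>'' = pull \<C> E B e \<delta>'"
    and ET4op:
      "\<lbrakk>E_triangle \<C> E s D A B f' f \<delta>; E_triangle \<C> E s F B C g' g \<delta>'\<rbrakk>
       \<Longrightarrow> \<exists>G h h' \<delta>'' d e.
             E_triangle \<C> E s G A C h' h \<delta>'' \<and> h = g \<cdot> f \<and>
             d \<in> Hom D G \<and> e \<in> Hom G F \<and> h' \<cdot> d = f' \<and> f \<cdot> h' = g' \<cdot> e \<and>
             E_triangle \<C> E s D G F d e (pull \<C> E D g' \<delta>) \<and>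
             \<delta>' = push \<C> E C e \<delta>'' \<and>
             push \<C> E B d \<delta> = pull \<C> E G g \<delta>''"


section \<open>Triangulated categories\<close>

text \<open>
  \<open>\<Delta>\<close> is the class of distinguished triangles, each recorded by its three morphisms
  \<open>A \<rightarrow> B \<rightarrow> C \<rightarrow> A[1]\<close>; \<open>S\<close> is the shift.
\<close>

definition is_triangle ::
    "('o, 'm, 'x) addcat_scheme \<Rightarrow> ('o, 'm) endoftor \<Rightarrow>
     'o \<Rightarrow> 'o \<Rightarrow> 'o \<Rightarrow> 'm \<Rightarrow> 'm \<Rightarrow> 'm \<Rightarrow> bool"
  where "is_triangle \<C> S A B C x y z \<longleftrightarrow>
    A \<in> Obj \<C> \<and> B \<in> Obj \<C> \<and> C \<in> Obj \<C> \<and>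
    x \<in> Hom\<^bsub>\<C>\<^esub> A B \<and> y \<in> Hom\<^bsub>\<C>\<^esub> B C \<and> z \<in> Hom\<^bsub>\<C>\<^esub> C (objm S A)"

definition is_dist ::
    "('o, 'm, 'x) addcat_scheme \<Rightarrow> ('o, 'm) endoftor \<Rightarrow> ('m \<times> 'm \<times> 'm) set \<Rightarrow>
     'o \<Rightarrow> 'o \<Rightarrow> 'o \<Rightarrow> 'm \<Rightarrow> 'm \<Rightarrow> 'm \<Rightarrow> bool"
  where "is_dist \<C> S \<Delta> A B C x y z \<longleftrightarrow> is_triangle \<C> S A B C x y z \<and> (x, y, z) \<in> \<Delta>"

locale triangulated_category = additive_category \<C>
  for \<C> :: "('o, 'm, 'x) addcat_scheme" (structure)
    and S :: "('o, 'm) endoftor"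
    and \<Delta> :: "('m \<times> 'm \<times> 'm) set" +
  assumes shift_auto_equivalence: "auto_equivalence \<C> S"
    and shift_additive: "additive_functor \<C> \<C> S"
    and dist_triangle: "(x, y, z) \<in> \<Delta> \<Longrightarrow> \<exists>A B C. is_triangle \<C> S A B C x y z"
    and TR1_iso:
      "\<lbrakk>is_dist \<C> S \<Delta> A B C x y z; is_triangle \<C> S A' B' C' x' y' z';
        is_iso \<C> A A' a; is_iso \<C> B B' b; is_iso \<C> C C' c;
        b \<cdot> x = x' \<cdot> a; c \<cdot> y = y' \<cdot> b; arrm S a \<cdot> z = z' \<cdot> c\<rbrakk>
       \<Longrightarrow> is_dist \<C> S \<Delta> A' B' C' x' y' z'"
    and TR1_id:
      "\<lbrakk>A \<in> Obj \<C>; zero_object \<C> Z\<rbrakk>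
       \<Longrightarrow> is_dist \<C> S \<Delta> A A Z (Id \<C> A) (Zero \<C> A Z) (Zero \<C> Z (objm S A))"
    and TR1_cone:
      "\<lbrakk>A \<in> Obj \<C>; B \<in> Obj \<C>; x \<in> Hom A B\<rbrakk> \<Longrightarrow> \<exists>C y z. is_dist \<C> S \<Delta> A B C x y z"
    and TR2:
      "is_triangle \<C> S A B C x y z \<Longrightarrow>
       is_dist \<C> S \<Delta> A B C x y z \<longleftrightarrow> is_dist \<C> S \<Delta> B C (objm S A) y z (Neg \<C> (arrm S x))"
    and TR3:
      "\<lbrakk>is_dist \<C> S \<Delta> A B C x y z; is_dist \<C> S \<Delta> A' B' C' x' y' z';
        a \<in> Hom A A'; b \<in> Hom B B'; b \<cdot> x = x' \<cdot> a\<rbrakk>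
       \<Longrightarrow> \<exists>c \<in> Hom C C'. c \<cdot> y = y' \<cdot> b \<and> arrm S a \<cdot> z = z' \<cdot> c"
    and TR4:
      "\<lbrakk>is_dist \<C> S \<Delta> A B D f f' \<delta>; is_dist \<C> S \<Delta> B C F g g' \<delta>';
        is_dist \<C> S \<Delta> A C G (g \<cdot> f) h' \<delta>''\<rbrakk>
       \<Longrightarrow> \<exists>d e. is_dist \<C> S \<Delta> D G F d e (arrm S f' \<cdot> \<delta>') \<and>
             d \<cdot> f' = h' \<cdot> g \<and> e \<cdot> h' = g' \<and>
             \<delta>'' \<cdot> d = \<delta> \<and> \<delta>' \<cdot> e = arrm S f \<cdot> \<delta>''"


section \<open>Passing between the two structures\<close>

text \<open>The functor \<open>\<C>(-, -[1])\<close>.\<close>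

definition E1 :: "('o, 'm, 'x) addcat_scheme \<Rightarrow> ('o, 'm) endoftor \<Rightarrow> ('o, 'm, 'm) extftor"
  where "E1 \<C> S =
    \<lparr>eobj = (\<lambda>C A. Hom_group \<C> C (objm S A)), earr = (\<lambda>c a \<delta>. arrm S a \<cdot>\<^bsub>\<C>\<^esub> \<delta> \<cdot>\<^bsub>\<C>\<^esub> c)\<rparr>"

lemma E1_bifunctor:
  assumes "preadditive_category \<C>" and F: "is_functor \<C> \<C> S"
  shows "is_Ab_bifunctor \<C> (E1 \<C> S)"
proof -
  interpret preadditive_category \<C> by fact
  have So: "A \<in> Obj \<C> \<Longrightarrow> objm S A \<in> Obj \<C>" for A using F by (auto simp: is_functor_def)
  have Sa: "\<lbrakk>A \<in> Obj \<C>; B \<in> Obj \<C>; f \<in> Hom\<^bsub>\<C>\<^esub> A B\<rbrakk> \<Longrightarrow> arrm S f \<in> Hom\<^bsub>\<C>\<^esub> (objm S A) (objm S B)" for A B f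
    using F by (auto simp: is_functor_def)
  have Si: "A \<in> Obj \<C> \<Longrightarrow> arrm S (Id \<C> A) = Id \<C> (objm S A)" for A using F by (auto simp: is_functor_def)
  have Sc: "\<lbrakk>f \<in> Hom\<^bsub>\<C>\<^esub> A B; g \<in> Hom\<^bsub>\<C>\<^esub> B D\<rbrakk> \<Longrightarrow> arrm S (g \<cdot>\<^bsub>\<C>\<^esub> f) = arrm S g \<cdot>\<^bsub>\<C>\<^esub> arrm S f" for A B D f g
    using F by (auto simp: is_functor_def Hom_def)
  show ?thesis
    unfolding is_Ab_bifunctor_def
  proof (intro conjI ballI)
    fix C A assume "C \<in> Obj \<C>" "A \<in> Obj \<C>"
    then show "comm_group (eobj (E1 \<C> S) C A)" by (simp add: E1_def Hom_comm_group So)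
  next
    fix C C' A A' c a
    assume "C \<in> Obj \<C>" "C' \<in> Obj \<C>" "A \<in> Obj \<C>" "A' \<in> Obj \<C>" and c: "c \<in> Hom\<^bsub>\<C>\<^esub> C' C" and a: "a \<in> Hom\<^bsub>\<C>\<^esub> A A'"
    then have "arrm S a \<in> Hom\<^bsub>\<C>\<^esub> (objm S A) (objm S A')" using Sa by blast
    then show "earr (E1 \<C> S) c a \<in> hom (eobj (E1 \<C> S) C A) (eobj (E1 \<C> S) C' A')"
      using c by (auto simp: E1_def hom_def Hom_group_def Add_Comp[of c C' C] intro!: Comp_Add Comp_Hom)
  next
    fix C A \<delta> assume "C \<in> Obj \<C>" "A \<in> Obj \<C>" "\<delta> \<in> Ext (E1 \<C> S) C A"
    then show "earr (E1 \<C> S) (Id \<C> C) (Id \<C> A) \<delta> = \<delta>"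
      by (auto simp: E1_def Hom_group_def Si Comp_Id Id_Comp)
  next
    fix C C' C'' A A' A'' c c' a a' \<delta>
    assume o: "C \<in> Obj \<C>" "C' \<in> Obj \<C>" "C'' \<in> Obj \<C>" "A \<in> Obj \<C>" "A' \<in> Obj \<C>" "A'' \<in> Obj \<C>"
      and c: "c \<in> Hom\<^bsub>\<C>\<^esub> C' C" "c' \<in> Hom\<^bsub>\<C>\<^esub> C'' C'" and a: "a \<in> Hom\<^bsub>\<C>\<^esub> A A'" "a' \<in> Hom\<^bsub>\<C>\<^esub> A' A''"
      and d: "\<delta> \<in> Ext (E1 \<C> S) C A"
    have d': "\<delta> \<in> Hom\<^bsub>\<C>\<^esub> C (objm S A)" using d by (simp add: E1_def Hom_group_def)
    have a': "arrm S a \<in> Hom\<^bsub>\<C>\<^esub> (objm S A) (objm S A')" "arrm S a' \<in> Hom\<^bsub>\<C>\<^esub> (objm S A') (objm S A'')"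
      using Sa o a by blast+
    show "earr (E1 \<C> S) (c \<cdot>\<^bsub>\<C>\<^esub> c') (a' \<cdot>\<^bsub>\<C>\<^esub> a) \<delta> = earr (E1 \<C> S) c' a' (earr (E1 \<C> S) c a \<delta>)"
    proof -
      have "(arrm S a' \<cdot>\<^bsub>\<C>\<^esub> arrm S a) \<cdot>\<^bsub>\<C>\<^esub> (\<delta> \<cdot>\<^bsub>\<C>\<^esub> (c \<cdot>\<^bsub>\<C>\<^esub> c'))
          = arrm S a' \<cdot>\<^bsub>\<C>\<^esub> (arrm S a \<cdot>\<^bsub>\<C>\<^esub> (\<delta> \<cdot>\<^bsub>\<C>\<^esub> (c \<cdot>\<^bsub>\<C>\<^esub> c')))"
        by (rule Comp_assoc[OF Comp_Hom[OF Comp_Hom[OF c(2) c(1)] d'] a'])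
      also have "\<delta> \<cdot>\<^bsub>\<C>\<^esub> (c \<cdot>\<^bsub>\<C>\<^esub> c') = (\<delta> \<cdot>\<^bsub>\<C>\<^esub> c) \<cdot>\<^bsub>\<C>\<^esub> c'"
        by (rule Comp_assoc[OF c(2) c(1) d', symmetric])
      also have "arrm S a \<cdot>\<^bsub>\<C>\<^esub> ((\<delta> \<cdot>\<^bsub>\<C>\<^esub> c) \<cdot>\<^bsub>\<C>\<^esub> c') = (arrm S a \<cdot>\<^bsub>\<C>\<^esub> (\<delta> \<cdot>\<^bsub>\<C>\<^esub> c)) \<cdot>\<^bsub>\<C>\<^esub> c'"
        by (rule Comp_assoc[OF c(2) Comp_Hom[OF c(1) d'] a'(1), symmetric])
      finally show ?thesis by (simp add: E1_def Sc[OF a] Comp_assoc[OF c(2) c(1) d'])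
    qed
  qed
qed

definition realization_of ::
    "('o, 'm, 'x) addcat_scheme \<Rightarrow> ('o, 'm) endoftor \<Rightarrow> ('m \<times> 'm \<times> 'm) set \<Rightarrow> ('o, 'm, 'm) rlz"
  where "realization_of \<C> S \<Delta> C A \<delta> =
    (let (x, y) = SOME (x, y). \<exists>B. is_dist \<C> S \<Delta> A B C x y \<delta> in seq_class \<C> x y)"

definition triangles_of ::
    "('o, 'm, 'x) addcat_scheme \<Rightarrow> ('o, 'm) endoftor \<Rightarrow> ('o, 'm, 'm) rlz \<Rightarrow> ('m \<times> 'm \<times> 'm) set"
  where "triangles_of \<C> S s =
    {(x, y, \<delta>). \<exists>A B C. is_triangle \<C> S A B C x y \<delta> \<and> s C A \<delta> = seq_class \<C> x y}"

end

theory Submission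
  imports Defs
begin

text \<open>
  The key observation: if every \<open>n\<close> with \<open>n x = 0\<close> factors through \<open>y\<close>, then an endomorphism
  \<open>b\<close> of the middle term with \<open>b x = x\<close> and \<open>y b = y\<close> is an isomorphism, since \<open>b - 1\<close> squares to zero.
  Hence two realizations of the same extension are compared by fill-ins in both directions, without
  long exact sequences.  The passage from triangulated to extriangulated categories then only
  rotates triangles and uses that \<open>[1]\<close> is fully faithful and essentially surjective.  Conversely, the rotation axiom
  for an extension \<open>\<delta>\<close> of \<open>C\<close> by \<open>A\<close> is obtained by realizing \<open>(\<delta>, 1) : C \<oplus> A[1] \<rightarrow> A[1]\<close> by
  \<open>(1, -\<delta>) : C \<rightarrow> C \<oplus> A[1]\<close> and applying (ET4)\<open>\<^sup>o\<^sup>p\<close> to the projection \<open>C \<oplus> A[1] \<rightarrow> A[1]\<close>; this is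
  where the sign in the rotated triangle comes from.
\<close>

section \<open>Preadditive categories\<close>

text \<open>Both structures provide fill-ins for the left, middle and right map and contain the
  trivial triangles \<open>A = A \<rightarrow> 0\<close> and \<open>0 \<rightarrow> A = A\<close>.
  Testing against these two yields all vanishing and factorization statements that are used, so the
  common part is done once, for an abstract class of triangles. On the extriangulated side the
  obstacle is that an arbitrary morphism is not visibly an inflation and that E-triangles are not
  visibly closed under rotation. The way out is that the identity of \<open>A[1]\<close> is itself
  an extension of \<open>A[1]\<close> by \<open>A\<close>. It forces the shift to be additive, and
  it is the second component of \<open>(\<delta>, 1)\<close>. The map \<open>(0, 1)\<close> on
  \<open>C \<oplus> A[1]\<close> should be realized by the inclusion of \<open>C\<close>; the
  automorphism of \<open>C \<oplus> A[1]\<close> that turns \<open>(0, 1)\<close> into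
  \<open>(\<delta>, 1)\<close> turns this inclusion into \<open>(1, -\<delta>)\<close>. Rotating
  backwards is not given by any axiom either. Three forward rotations reach the shifted triangle up
  to sign, and full faithfulness of the shift leads back from there.\<close>

context category
begin

lemma Hom_iff: "f \<in> Hom A B \<longleftrightarrow> f \<in> Arr \<C> \<and> Dom \<C> f = A \<and> Cod \<C> f = B"
  by (simp add: Hom_def)

lemma Id_arr [simp]:
  "A \<in> Obj \<C> \<Longrightarrow> Id \<C> A \<in> Arr \<C>"
  "A \<in> Obj \<C> \<Longrightarrow> Dom \<C> (Id \<C> A) = A"
  "A \<in> Obj \<C> \<Longrightarrow> Cod \<C> (Id \<C> A) = A"
  using Id_Hom by (auto simp: Hom_iff)

lemma comp_arr [simp]:
  assumes "f \<in> Arr \<C>" "g \<in> Arr \<C>" "Cod \<C> f = Dom \<C> g"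
  shows "g \<cdot> f \<in> Arr \<C>" "Dom \<C> (g \<cdot> f) = Dom \<C> f" "Cod \<C> (g \<cdot> f) = Cod \<C> g"
  using Comp_Hom[of f "Dom \<C> f" "Cod \<C> f" g "Cod \<C> g"] assms by (auto simp: Hom_iff)

lemma comp_id [simp]: "\<lbrakk>f \<in> Arr \<C>; Dom \<C> f = A\<rbrakk> \<Longrightarrow> f \<cdot> Id \<C> A = f"
  using Comp_Id by (auto simp: Hom_iff)

lemma id_comp [simp]: "\<lbrakk>f \<in> Arr \<C>; Cod \<C> f = A\<rbrakk> \<Longrightarrow> Id \<C> A \<cdot> f = f"
  using Id_Comp by (auto simp: Hom_iff)

lemma comp_assoc [simp]:
  "\<lbrakk>f \<in> Arr \<C>; g \<in> Arr \<C>; h \<in> Arr \<C>; Cod \<C> f = Dom \<C> g; Cod \<C> g = Dom \<C> h\<rbrakk>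
    \<Longrightarrow> (h \<cdot> g) \<cdot> f = h \<cdot> (g \<cdot> f)"
  using Comp_assoc[of f "Dom \<C> f" "Dom \<C> g" g "Dom \<C> h" h "Cod \<C> h"] by (auto simp: Hom_iff)

text \<open>With composites nested to the right, \<open>g \<cdot> f\<close> is no longer a subterm
  of \<open>g \<cdot> (f \<cdot> k)\<close>; in this form an equation for \<open>g \<cdot> f\<close>
  still applies there.\<close>

lemma comp_subst:
  "\<lbrakk>g \<cdot> f = h; f \<in> Arr \<C>; g \<in> Arr \<C>; Cod \<C> f = Dom \<C> g; k \<in> Arr \<C>; Cod \<C> k = Dom \<C> f\<rbrakk>
    \<Longrightarrow> g \<cdot> (f \<cdot> k) = h \<cdot> k"
  by (metis comp_assoc)

lemma is_isoI:
  "\<lbrakk>f \<in> Hom A B; g \<in> Hom B A; g \<cdot> f = Id \<C> A; f \<cdot> g = Id \<C> B\<rbrakk> \<Longrightarrow> is_iso \<C> A B f"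
  by (auto simp: is_iso_def)

lemma is_isoE:
  assumes "is_iso \<C> A B f"
  obtains g where "f \<in> Hom A B" "g \<in> Hom B A" "g \<cdot> f = Id \<C> A" "f \<cdot> g = Id \<C> B" "is_iso \<C> B A g"
  using assms by (auto simp: is_iso_def)

lemma is_iso_Id: "A \<in> Obj \<C> \<Longrightarrow> is_iso \<C> A A (Id \<C> A)"
  by (rule is_isoI[where g = "Id \<C> A"]) (auto simp: Hom_iff)

lemma is_iso_comp:
  assumes "is_iso \<C> A B f" "is_iso \<C> B D g"
  shows "is_iso \<C> A D (g \<cdot> f)"
proof -
  obtain f' where f: "f \<in> Hom A B" "f' \<in> Hom B A" "f' \<cdot> f = Id \<C> A" "f \<cdot> f' = Id \<C> B"
    using assms(1) by (rule is_isoE)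
  obtain g' where g: "g \<in> Hom B D" "g' \<in> Hom D B" "g' \<cdot> g = Id \<C> B" "g \<cdot> g' = Id \<C> D"
    using assms(2) by (rule is_isoE)
  show ?thesis
    using f g comp_subst[OF f(4)] comp_subst[OF g(3)]
    by (intro is_isoI[where g = "f' \<cdot> g'"]) (auto simp: Hom_iff)
qed

text \<open>Inverting the composites gives a left inverse \<open>u \<cdot> b'\<close> and a right
  inverse \<open>b' \<cdot> v\<close> of \<open>b\<close>, and these must coincide.\<close>

lemma is_iso_if_both_composites_iso:
  assumes b: "b \<in> Hom A B" "b' \<in> Hom B A" and "is_iso \<C> A A (b' \<cdot> b)" "is_iso \<C> B B (b \<cdot> b')"
  shows "is_iso \<C> A B b"
proof -
  obtain u where u: "u \<in> Hom A A" "u \<cdot> (b' \<cdot> b) = Id \<C> A" using assms(3) by (rule is_isoE)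
  obtain v where v: "v \<in> Hom B B" "(b \<cdot> b') \<cdot> v = Id \<C> B" using assms(4) by (rule is_isoE)
  have "u \<cdot> b' = (u \<cdot> b') \<cdot> ((b \<cdot> b') \<cdot> v)" using b u v(1) unfolding v(2) by (simp add: Hom_iff)
  also have "\<dots> = (u \<cdot> (b' \<cdot> b)) \<cdot> (b' \<cdot> v)" using b u(1) v(1) by (simp add: Hom_iff)
  also have "\<dots> = b' \<cdot> v" unfolding u(2) using b v(1) Cod_Obj by (simp add: Hom_iff)
  finally have eq: "u \<cdot> b' = b' \<cdot> v" .
  have "(u \<cdot> b') \<cdot> b = Id \<C> A" using b u by (simp add: Hom_iff)
  moreover have "b \<cdot> (u \<cdot> b') = Id \<C> B" unfolding eq using b v by (simp add: Hom_iff)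
  ultimately show ?thesis using b u(1) by (intro is_isoI[where g = "u \<cdot> b'"]) (auto simp: Hom_iff)
qed

text \<open>A class contains its own representative, which gives the isomorphism. Conversely, the
  inclusion \<open>sub\<close> is applied once to the isomorphism and once to its inverse.\<close>

lemma seq_class_eq_iff:
  assumes x: "x \<in> Hom A B" and y: "y \<in> Hom B C" and x': "x' \<in> Hom A B'" and y': "y' \<in> Hom B' C"
  shows "seq_class \<C> x y = seq_class \<C> x' y' \<longleftrightarrow> (\<exists>b. is_iso \<C> B B' b \<and> b \<cdot> x = x' \<and> y' \<cdot> b = y)"
proof
  have "(x', y') \<in> seq_class \<C> x' y'"
    using x' y' Cod_Obj[of x'] is_iso_Id[of B'] unfolding seq_class_def by (fastforce simp: Hom_iff)
  moreover assume "seq_class \<C> x y = seq_class \<C> x' y'"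
  ultimately have "(x', y') \<in> seq_class \<C> x y" by simp
  then show "\<exists>b. is_iso \<C> B B' b \<and> b \<cdot> x = x' \<and> y' \<cdot> b = y"
    using x y x' y' unfolding seq_class_def by (auto simp: Hom_iff)
next
  have sub: "seq_class \<C> u' v' \<subseteq> seq_class \<C> u v"
    if uv: "u \<in> Hom A D" "v \<in> Hom D C" "u' \<in> Hom A D'" "v' \<in> Hom D' C"
      and k: "is_iso \<C> D D' k" "k \<cdot> u = u'" "v' \<cdot> k = v" for u v u' v' D D' k
  proof
    fix p assume "p \<in> seq_class \<C> u' v'"
    then obtain p1 p2 F j where p: "p = (p1, p2)" "p1 \<in> Hom A F" "p2 \<in> Hom F C" "is_iso \<C> D' F j"
        "j \<cdot> u' = p1" "p2 \<cdot> j = v'"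
      using uv by (auto simp: seq_class_def Hom_iff)
    have "k \<in> Hom D D'" "j \<in> Hom D' F" using k p by (auto simp: is_iso_def)
    then have "(j \<cdot> k) \<cdot> u = p1" "p2 \<cdot> (j \<cdot> k) = v"
      using uv p comp_subst[OF p(6), of k] by (simp_all add: Hom_iff k(2,3))
    moreover have "is_iso \<C> D F (j \<cdot> k)" using k(1) p(4) by (rule is_iso_comp)
    ultimately show "p \<in> seq_class \<C> u v"
      unfolding seq_class_def using p(1-3) uv by (auto simp: Hom_iff)
  qed
  assume "\<exists>b. is_iso \<C> B B' b \<and> b \<cdot> x = x' \<and> y' \<cdot> b = y"
  then obtain b where b: "is_iso \<C> B B' b" "b \<cdot> x = x'" "y' \<cdot> b = y" by blast
  obtain c where c: "b \<in> Hom B B'" "c \<in> Hom B' B" "c \<cdot> b = Id \<C> B" "b \<cdot> c = Id \<C> B'" "is_iso \<C> B' B c"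
    using b(1) by (rule is_isoE)
  have "c \<cdot> x' = x" using b(2) c x comp_subst[OF c(3)] by (auto simp: Hom_iff)
  moreover have "y \<cdot> c = y'" using b(3) c y' by (auto simp: Hom_iff)
  ultimately show "seq_class \<C> x y = seq_class \<C> x' y'"
    using sub[OF x y x' y' b] sub[OF x' y' x y c(5)] by auto
qed

text \<open>By naturality \<open>\<eta> B \<cdot> f\<close> depends on \<open>f\<close> only through
  \<open>arrm F f\<close>, and \<open>\<eta> B\<close> cancels on the left.\<close>

lemma faithful_if_unit:
  assumes eta: "natural_iso \<C> \<C> id_ftor (comp_ftor G F) \<eta>"
    and f: "f \<in> Hom A B" "g \<in> Hom A B" and eq: "arrm F f = arrm F g"
  shows "f = g"
proof -
  have AB: "A \<in> Obj \<C>" "B \<in> Obj \<C>" using f Dom_Obj[of f] Cod_Obj[of f] by (auto simp: Hom_iff)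
  then have nat: "\<eta> B \<cdot> f = arrm G (arrm F f) \<cdot> \<eta> A" "\<eta> B \<cdot> g = arrm G (arrm F g) \<cdot> \<eta> A"
    using eta f by (auto simp: natural_iso_def id_ftor_def comp_ftor_def)
  have "is_iso \<C> B (objm G (objm F B)) (\<eta> B)"
    using eta AB by (auto simp: natural_iso_def id_ftor_def comp_ftor_def)
  then obtain k where k: "\<eta> B \<in> Hom B (objm G (objm F B))" "k \<in> Hom (objm G (objm F B)) B" "k \<cdot> \<eta> B = Id \<C> B"
    by (rule is_isoE)
  have "f = k \<cdot> (\<eta> B \<cdot> f)" using comp_subst[OF k(3), of f] k f by (simp add: Hom_iff)
  also have "\<dots> = k \<cdot> (\<eta> B \<cdot> g)" using nat eq by simp
  also have "\<dots> = g" using comp_subst[OF k(3), of g] k f by (simp add: Hom_iff)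
  finally show ?thesis .
qed

text \<open>Dually, \<open>f \<cdot> \<epsilon> A\<close> depends on \<open>f\<close> only through
  \<open>arrm G f\<close>. With the shift as \<open>F\<close>, this is faithfulness of its
  quasi-inverse, from which fullness of the shift follows.\<close>

lemma faithful_if_counit:
  assumes eps: "natural_iso \<C> \<C> (comp_ftor F G) id_ftor \<epsilon>"
    and f: "f \<in> Hom A B" "g \<in> Hom A B" and eq: "arrm G f = arrm G g"
  shows "f = g"
proof -
  have AB: "A \<in> Obj \<C>" "B \<in> Obj \<C>" using f Dom_Obj[of f] Cod_Obj[of f] by (auto simp: Hom_iff)
  then have nat: "\<epsilon> B \<cdot> arrm F (arrm G f) = f \<cdot> \<epsilon> A" "\<epsilon> B \<cdot> arrm F (arrm G g) = g \<cdot> \<epsilon> A"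
    using eps f by (auto simp: natural_iso_def id_ftor_def comp_ftor_def)
  have "is_iso \<C> (objm F (objm G A)) A (\<epsilon> A)"
    using eps AB by (auto simp: natural_iso_def id_ftor_def comp_ftor_def)
  then obtain k where k: "\<epsilon> A \<in> Hom (objm F (objm G A)) A" "k \<in> Hom A (objm F (objm G A))" "\<epsilon> A \<cdot> k = Id \<C> A"
    by (rule is_isoE)
  have "f = (f \<cdot> \<epsilon> A) \<cdot> k" using k f by (simp add: Hom_iff)
  also have "\<dots> = (g \<cdot> \<epsilon> A) \<cdot> k" using nat eq by simp
  also have "\<dots> = g" using k f by (simp add: Hom_iff)
  finally show ?thesis .
qed

end

context preadditive_category
begin

section \<open>Sums, zeros and negatives in the hom-groups; zero objects; weak cokernels\<close>

lemma Hom_group_simps [simp]: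
  "carrier (Hom_group \<C> A B) = Hom A B" "mult (Hom_group \<C> A B) = (\<boxplus>)"
  "one (Hom_group \<C> A B) = Zero \<C> A B"
  by (simp_all add: Hom_group_def)

lemma zero_arr [simp]:
  assumes "A \<in> Obj \<C>" "B \<in> Obj \<C>"
  shows "Zero \<C> A B \<in> Arr \<C>" "Dom \<C> (Zero \<C> A B) = A" "Cod \<C> (Zero \<C> A B) = B"
proof -
  interpret comm_group "Hom_group \<C> A B" using assms by (rule Hom_comm_group)
  show "Zero \<C> A B \<in> Arr \<C>" "Dom \<C> (Zero \<C> A B) = A" "Cod \<C> (Zero \<C> A B) = B"
    using one_closed by (auto simp: Hom_iff)
qed

lemma add_arr [simp]:
  assumes "f \<in> Arr \<C>" "g \<in> Arr \<C>" "Dom \<C> f = Dom \<C> g" "Cod \<C> f = Cod \<C> g"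
  shows "f \<boxplus> g \<in> Arr \<C>" "Dom \<C> (f \<boxplus> g) = Dom \<C> g" "Cod \<C> (f \<boxplus> g) = Cod \<C> g"
proof -
  interpret comm_group "Hom_group \<C> (Dom \<C> g) (Cod \<C> g)"
    using assms by (intro Hom_comm_group Dom_Obj Cod_Obj)
  show "f \<boxplus> g \<in> Arr \<C>" "Dom \<C> (f \<boxplus> g) = Dom \<C> g" "Cod \<C> (f \<boxplus> g) = Cod \<C> g"
    using m_closed[of f g] assms by (auto simp: Hom_iff)
qed

lemma neg_arr [simp]:
  assumes "f \<in> Arr \<C>"
  shows "Neg \<C> f \<in> Arr \<C>" "Dom \<C> (Neg \<C> f) = Dom \<C> f" "Cod \<C> (Neg \<C> f) = Cod \<C> f"
proof -
  interpret comm_group "Hom_group \<C> (Dom \<C> f) (Cod \<C> f)"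
    using assms by (intro Hom_comm_group Dom_Obj Cod_Obj)
  show "Neg \<C> f \<in> Arr \<C>" "Dom \<C> (Neg \<C> f) = Dom \<C> f" "Cod \<C> (Neg \<C> f) = Cod \<C> f"
    using inv_closed[of f] assms by (auto simp: Hom_iff Neg_def)
qed

lemma add_assoc:
  assumes "f \<in> Arr \<C>" "g \<in> Arr \<C>" "h \<in> Arr \<C>" "Dom \<C> f = Dom \<C> h" "Dom \<C> g = Dom \<C> h"
    "Cod \<C> f = Cod \<C> h" "Cod \<C> g = Cod \<C> h"
  shows "f \<boxplus> g \<boxplus> h = f \<boxplus> (g \<boxplus> h)"
proof -
  interpret comm_group "Hom_group \<C> (Dom \<C> h) (Cod \<C> h)"
    using assms by (intro Hom_comm_group Dom_Obj Cod_Obj)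
  show ?thesis using m_assoc[of f g h] assms by (auto simp: Hom_iff)
qed

lemma add_comm:
  assumes "f \<in> Arr \<C>" "g \<in> Arr \<C>" "Dom \<C> f = Dom \<C> g" "Cod \<C> f = Cod \<C> g"
  shows "f \<boxplus> g = g \<boxplus> f"
proof -
  interpret comm_group "Hom_group \<C> (Dom \<C> g) (Cod \<C> g)"
    using assms by (intro Hom_comm_group Dom_Obj Cod_Obj)
  show ?thesis using m_comm[of f g] assms by (auto simp: Hom_iff)
qed

lemma add_zero [simp]:
  assumes "f \<in> Arr \<C>" "Dom \<C> f = A" "Cod \<C> f = B"
  shows "f \<boxplus> Zero \<C> A B = f" "Zero \<C> A B \<boxplus> f = f"
proof -
  interpret comm_group "Hom_group \<C> A B"
    using assms by (auto intro!: Hom_comm_group Dom_Obj Cod_Obj)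
  show "f \<boxplus> Zero \<C> A B = f" "Zero \<C> A B \<boxplus> f = f"
    using r_one[of f] l_one[of f] assms by (auto simp: Hom_iff)
qed

lemma add_neg [simp]:
  assumes "f \<in> Arr \<C>"
  shows "f \<boxplus> Neg \<C> f = Zero \<C> (Dom \<C> f) (Cod \<C> f)" "Neg \<C> f \<boxplus> f = Zero \<C> (Dom \<C> f) (Cod \<C> f)"
proof -
  interpret comm_group "Hom_group \<C> (Dom \<C> f) (Cod \<C> f)"
    using assms by (auto intro!: Hom_comm_group Dom_Obj Cod_Obj)
  show "f \<boxplus> Neg \<C> f = Zero \<C> (Dom \<C> f) (Cod \<C> f)" "Neg \<C> f \<boxplus> f = Zero \<C> (Dom \<C> f) (Cod \<C> f)"
    using r_inv[of f] l_inv[of f] assms by (auto simp: Hom_iff Neg_def)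
qed

lemma neg_unique:
  assumes "f \<in> Arr \<C>" "g \<in> Arr \<C>" "Dom \<C> f = Dom \<C> g" "Cod \<C> f = Cod \<C> g"
    "f \<boxplus> g = Zero \<C> (Dom \<C> g) (Cod \<C> g)"
  shows "f = Neg \<C> g"
proof -
  have "f = f \<boxplus> (g \<boxplus> Neg \<C> g)" using assms by simp
  also have "\<dots> = Neg \<C> g" using assms by (simp add: add_assoc[symmetric] del: add_neg)
  finally show ?thesis .
qed

lemma neg_neg [simp]: "f \<in> Arr \<C> \<Longrightarrow> Neg \<C> (Neg \<C> f) = f"
  by (rule neg_unique[symmetric]) auto

lemma add_cancel:
  assumes "f \<in> Arr \<C>" "f' \<in> Arr \<C>" "g \<in> Arr \<C>" "Dom \<C> f = Dom \<C> g" "Dom \<C> f' = Dom \<C> g"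
    "Cod \<C> f = Cod \<C> g" "Cod \<C> f' = Cod \<C> g" "f \<boxplus> g = f' \<boxplus> g"
  shows "f = f'"
proof -
  have "f = (f \<boxplus> g) \<boxplus> Neg \<C> g" using assms(1-7) by (simp add: add_assoc)
  also have "\<dots> = f'" using assms(1-7) unfolding assms(8) by (simp add: add_assoc)
  finally show ?thesis .
qed

lemma comp_add [simp]:
  assumes "f \<in> Arr \<C>" "f' \<in> Arr \<C>" "g \<in> Arr \<C>" "Dom \<C> f = Dom \<C> f'" "Cod \<C> f = Dom \<C> g" "Cod \<C> f' = Dom \<C> g"
  shows "g \<cdot> (f \<boxplus> f') = (g \<cdot> f) \<boxplus> (g \<cdot> f')"
  using assms by (intro Comp_Add[of f "Dom \<C> f" "Dom \<C> g"]) (auto simp: Hom_iff)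

lemma add_comp [simp]:
  assumes "f \<in> Arr \<C>" "g \<in> Arr \<C>" "g' \<in> Arr \<C>" "Cod \<C> f = Dom \<C> g" "Dom \<C> g' = Dom \<C> g" "Cod \<C> g = Cod \<C> g'"
  shows "(g \<boxplus> g') \<cdot> f = (g \<cdot> f) \<boxplus> (g' \<cdot> f)"
  using assms by (intro Add_Comp[of f "Dom \<C> f" "Dom \<C> g"]) (auto simp: Hom_iff)

lemma comp_zero [simp]:
  assumes "f \<in> Arr \<C>" "A \<in> Obj \<C>" "Dom \<C> f = B"
  shows "f \<cdot> Zero \<C> A B = Zero \<C> A (Cod \<C> f)"
proof -
  let ?z = "f \<cdot> Zero \<C> A B"
  have B: "B \<in> Obj \<C>" "Cod \<C> f \<in> Obj \<C>" using assms Dom_Obj Cod_Obj by auto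
  have z: "?z \<in> Arr \<C>" "Dom \<C> ?z = A" "Cod \<C> ?z = Cod \<C> f" using assms B by auto
  have "?z \<boxplus> ?z = f \<cdot> (Zero \<C> A B \<boxplus> Zero \<C> A B)" using assms B by (simp del: add_zero)
  also have "\<dots> = Zero \<C> A (Cod \<C> f) \<boxplus> ?z" using assms B by simp
  finally show ?thesis by (rule add_cancel[of ?z _ ?z, rotated -1]) (use z B assms in simp_all)
qed

lemma zero_comp [simp]:
  assumes "f \<in> Arr \<C>" "B \<in> Obj \<C>" "Cod \<C> f = A"
  shows "Zero \<C> A B \<cdot> f = Zero \<C> (Dom \<C> f) B"
proof -
  let ?z = "Zero \<C> A B \<cdot> f"
  have B: "A \<in> Obj \<C>" "Dom \<C> f \<in> Obj \<C>" using assms Dom_Obj Cod_Obj by auto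
  have z: "?z \<in> Arr \<C>" "Dom \<C> ?z = Dom \<C> f" "Cod \<C> ?z = B" using assms B by auto
  have "?z \<boxplus> ?z = (Zero \<C> A B \<boxplus> Zero \<C> A B) \<cdot> f" using assms B by (simp del: add_zero)
  also have "\<dots> = Zero \<C> (Dom \<C> f) B \<boxplus> ?z" using assms B by simp
  finally show ?thesis by (rule add_cancel[of ?z _ ?z, rotated -1]) (use z B assms in simp_all)
qed

lemma comp_neg [simp]:
  assumes "f \<in> Arr \<C>" "g \<in> Arr \<C>" "Cod \<C> f = Dom \<C> g"
  shows "g \<cdot> Neg \<C> f = Neg \<C> (g \<cdot> f)"
proof (rule neg_unique)
  have "g \<cdot> Neg \<C> f \<boxplus> g \<cdot> f = g \<cdot> (Neg \<C> f \<boxplus> f)" using assms by (simp del: add_neg)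
  also have "\<dots> = Zero \<C> (Dom \<C> (g \<cdot> f)) (Cod \<C> (g \<cdot> f))" using assms Dom_Obj by simp
  finally show "g \<cdot> Neg \<C> f \<boxplus> g \<cdot> f = Zero \<C> (Dom \<C> (g \<cdot> f)) (Cod \<C> (g \<cdot> f))" .
qed (use assms in auto)

lemma neg_comp [simp]:
  assumes "f \<in> Arr \<C>" "g \<in> Arr \<C>" "Cod \<C> f = Dom \<C> g"
  shows "Neg \<C> g \<cdot> f = Neg \<C> (g \<cdot> f)"
proof (rule neg_unique)
  have "Neg \<C> g \<cdot> f \<boxplus> g \<cdot> f = (Neg \<C> g \<boxplus> g) \<cdot> f" using assms by (simp del: add_neg)
  also have "\<dots> = Zero \<C> (Dom \<C> (g \<cdot> f)) (Cod \<C> (g \<cdot> f))" using assms Cod_Obj by simp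
  finally show "Neg \<C> g \<cdot> f \<boxplus> g \<cdot> f = Zero \<C> (Dom \<C> (g \<cdot> f)) (Cod \<C> (g \<cdot> f))" .
qed (use assms in auto)

lemma neg_zero [simp]: "\<lbrakk>A \<in> Obj \<C>; B \<in> Obj \<C>\<rbrakk> \<Longrightarrow> Neg \<C> (Zero \<C> A B) = Zero \<C> A B"
  by (rule neg_unique[symmetric]) auto

lemma neg_inject: "\<lbrakk>f \<in> Arr \<C>; g \<in> Arr \<C>; Neg \<C> f = Neg \<C> g\<rbrakk> \<Longrightarrow> f = g"
  by (metis neg_neg)

lemma is_iso_neg_Id: "A \<in> Obj \<C> \<Longrightarrow> is_iso \<C> A A (Neg \<C> (Id \<C> A))"
  by (rule is_isoI[where g = "Neg \<C> (Id \<C> A)"]) (auto simp: Hom_iff)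

lemma zero_object_Obj: "zero_object \<C> Z \<Longrightarrow> Z \<in> Obj \<C>"
  by (simp add: zero_object_def)

text \<open>Unlike the universal property, the equation is visibly preserved by the shift, and it is
  what the trivial biproducts \<open>A \<oplus> 0\<close> and \<open>0 \<oplus> A\<close>
  require.\<close>

lemma zero_object_iff:
  "zero_object \<C> Z \<longleftrightarrow> Z \<in> Obj \<C> \<and> Id \<C> Z = Zero \<C> Z Z"
proof safe
  assume Z: "zero_object \<C> Z"
  show "Z \<in> Obj \<C>" using Z by (rule zero_object_Obj)
  then have "Id \<C> Z \<in> Hom Z Z" "Zero \<C> Z Z \<in> Hom Z Z" by (simp_all add: Hom_iff)
  then show "Id \<C> Z = Zero \<C> Z Z" using Z unfolding zero_object_def by blast
next
  assume Z: "Z \<in> Obj \<C>" "Id \<C> Z = Zero \<C> Z Z"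
  show "zero_object \<C> Z"
    unfolding zero_object_def
  proof (intro conjI ballI Z)
    fix A assume A: "A \<in> Obj \<C>"
    have "f = Zero \<C> A Z" if "f \<in> Hom A Z" for f
      using that id_comp[of f Z] Z A by (simp add: Hom_iff)
    then show "\<exists>!f. f \<in> Hom A Z" using Z A by (intro ex1I[of _ "Zero \<C> A Z"]) (auto simp: Hom_iff)
    have "f = Zero \<C> Z A" if "f \<in> Hom Z A" for f
      using that comp_id[of f Z] Z A by (simp add: Hom_iff)
    then show "\<exists>!f. f \<in> Hom Z A" using Z A by (intro ex1I[of _ "Zero \<C> Z A"]) (auto simp: Hom_iff)
  qed
qed

text \<open>The lifting half of a weak cokernel: maps that kill \<open>x\<close> factor through
  \<open>y\<close>, with no uniqueness. That \<open>y\<close> kills \<open>x\<close> is a separate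
  fact about triangles.\<close>

definition cokernel_covering :: "'o \<Rightarrow> 'o \<Rightarrow> 'o \<Rightarrow> 'm \<Rightarrow> 'm \<Rightarrow> bool"
  where "cokernel_covering A B C x y \<longleftrightarrow> x \<in> Hom A B \<and> y \<in> Hom B C \<and>
    (\<forall>D \<in> Obj \<C>. \<forall>n \<in> Hom B D. n \<cdot> x = Zero \<C> A D \<longrightarrow> (\<exists>m \<in> Hom C D. n = m \<cdot> y))"

lemma cokernel_covering_factor:
  assumes "cokernel_covering A B C x y" "n \<in> Hom B D" "n \<cdot> x = Zero \<C> A D"
  obtains m where "m \<in> Hom C D" "n = m \<cdot> y"
proof -
  have "D \<in> Obj \<C>" using assms(2) Cod_Obj[of n] by (simp add: Hom_iff)
  then show ?thesis using assms that unfolding cokernel_covering_def by blast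
qed

text \<open>The difference \<open>n = k - 1\<close> satisfies \<open>n x = 0\<close>, so \<open>n = m y\<close> and \<open>n n = m (y n) = 0\<close>;
  hence \<open>1 - n\<close> is the inverse of \<open>k\<close>.\<close>

lemma cokernel_covering_endo_iso:
  assumes cov: "cokernel_covering A B C x y" and k: "k \<in> Hom B B" "k \<cdot> x = x" "y \<cdot> k = y"
  shows "is_iso \<C> B B k"
proof -
  have x: "x \<in> Arr \<C>" "Dom \<C> x = A" "Cod \<C> x = B" and y: "y \<in> Arr \<C>" "Dom \<C> y = B" "Cod \<C> y = C"
    using cov by (auto simp: cokernel_covering_def Hom_iff)
  have k': "k \<in> Arr \<C>" "Dom \<C> k = B" "Cod \<C> k = B" using k by (auto simp: Hom_iff)
  have B: "B \<in> Obj \<C>" using x Cod_Obj by auto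
  define n where "n = k \<boxplus> Neg \<C> (Id \<C> B)"
  have n: "n \<in> Arr \<C>" "Dom \<C> n = B" "Cod \<C> n = B" using k' B by (auto simp: n_def)
  have "n \<cdot> x = Zero \<C> A B" using k' x B k by (simp add: n_def)
  then obtain m where m: "m \<in> Hom C B" "n = m \<cdot> y"
    using cov B n unfolding cokernel_covering_def by (metis Hom_iff)
  have "y \<cdot> n = Zero \<C> B C" using k' y B k by (simp add: n_def)
  then have "m \<cdot> (y \<cdot> n) = Zero \<C> B B" using m B by (simp add: Hom_iff)
  then have nn: "n \<cdot> n = Zero \<C> B B" using m y n by (simp add: Hom_iff)
  have kn: "k = Id \<C> B \<boxplus> n"
    using k' B by (simp add: n_def add_comm[of k] add_assoc[symmetric])
  have nn': "n \<cdot> Neg \<C> n = Zero \<C> B B" using n nn B by simp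
  show ?thesis
  proof (rule is_isoI[where g = "Id \<C> B \<boxplus> Neg \<C> n"])
    show "(Id \<C> B \<boxplus> Neg \<C> n) \<cdot> k = Id \<C> B"
      unfolding kn using n B nn by (simp add: add_assoc)
    show "k \<cdot> (Id \<C> B \<boxplus> Neg \<C> n) = Id \<C> B"
      unfolding kn using n B nn' nn by (simp add: add_assoc del: comp_neg neg_comp)
  qed (use k n B in \<open>auto simp: Hom_iff\<close>)
qed

text \<open>The two fill-ins need not be inverse to each other. Their composites, however, fix the
  outer maps, hence are automorphisms, and this makes \<open>b\<close> invertible.\<close>

lemma cokernel_covering_iso:
  assumes "cokernel_covering A B C x y" "cokernel_covering A B' C x' y'"
    and b: "b \<in> Hom B B'" "b \<cdot> x = x'" "y' \<cdot> b = y"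
    and b': "b' \<in> Hom B' B" "b' \<cdot> x' = x" "y \<cdot> b' = y'"
  shows "is_iso \<C> B B' b"
proof (rule is_iso_if_both_composites_iso[OF b(1) b'(1)])
  have h: "x \<in> Hom A B" "y \<in> Hom B C" "x' \<in> Hom A B'" "y' \<in> Hom B' C"
    using assms(1,2) by (auto simp: cokernel_covering_def)
  note hom = h[unfolded Hom_iff] b(1)[unfolded Hom_iff] b'(1)[unfolded Hom_iff]
  have "b' \<cdot> b \<in> Hom B B" "b \<cdot> b' \<in> Hom B' B'" using hom by (simp_all add: Hom_iff)
  moreover have "(b' \<cdot> b) \<cdot> x = x" "(b \<cdot> b') \<cdot> x' = x'" using hom by (simp_all add: b(2) b'(2))
  moreover have "y \<cdot> (b' \<cdot> b) = y" "y' \<cdot> (b \<cdot> b') = y'"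
    using hom comp_subst[OF b(3), of b'] comp_subst[OF b'(3), of b] by (simp_all add: b(3) b'(3))
  ultimately show "is_iso \<C> B B (b' \<cdot> b)" "is_iso \<C> B' B' (b \<cdot> b')"
    using cokernel_covering_endo_iso[OF assms(1)] cokernel_covering_endo_iso[OF assms(2)] by simp_all
qed

lemma cokernel_covering_seq_class:
  assumes "cokernel_covering A B C x y" "cokernel_covering A B' C x' y'"
    and "b \<in> Hom B B'" "b \<cdot> x = x'" "y' \<cdot> b = y"
    and "b' \<in> Hom B' B" "b' \<cdot> x' = x" "y \<cdot> b' = y'"
  shows "seq_class \<C> x y = seq_class \<C> x' y'"
  using cokernel_covering_iso[OF assms] assms
  by (subst seq_class_eq_iff[of x A B y C x' B' y']) (auto simp: cokernel_covering_def)

text \<open>Serves a sequence that is isomorphic to an E-triangle but not yet known to be one: a map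
  killing \<open>x'\<close> becomes, after composition with \<open>b\<close>, a map killing
  \<open>x\<close>, and its factor is carried back along the inverse of \<open>c\<close>.\<close>

lemma cokernel_covering_iso_transfer:
  assumes cov: "cokernel_covering A B C x y" and x': "x' \<in> Hom A' B'" and y': "y' \<in> Hom B' C'"
    and a: "a \<in> Hom A A'" and b: "is_iso \<C> B B' b" and c: "is_iso \<C> C C' c"
    and eq: "b \<cdot> x = x' \<cdot> a" "c \<cdot> y = y' \<cdot> b"
  shows "cokernel_covering A' B' C' x' y'"
  unfolding cokernel_covering_def
proof (intro conjI ballI impI x' y')
  fix D n assume D: "D \<in> Obj \<C>" and n: "n \<in> Hom B' D" and n0: "n \<cdot> x' = Zero \<C> A' D"
  obtain bi where bi: "b \<in> Hom B B'" "bi \<in> Hom B' B" "b \<cdot> bi = Id \<C> B'" using b by (rule is_isoE)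
  obtain ci where ci: "c \<in> Hom C C'" "ci \<in> Hom C' C" "ci \<cdot> c = Id \<C> C" using c by (rule is_isoE)
  have xy: "x \<in> Hom A B" "y \<in> Hom B C" using cov by (simp_all add: cokernel_covering_def)
  note h = x'[unfolded Hom_iff] y'[unfolded Hom_iff] a[unfolded Hom_iff] n[unfolded Hom_iff]
    bi(1,2)[unfolded Hom_iff] ci(1,2)[unfolded Hom_iff] xy[unfolded Hom_iff]
  have "(n \<cdot> b) \<cdot> x = n \<cdot> (x' \<cdot> a)" using h by (simp add: eq(1))
  also have "\<dots> = (n \<cdot> x') \<cdot> a" using h by simp
  also have "\<dots> = Zero \<C> A D" unfolding n0 using h D by simp
  finally have nbx: "(n \<cdot> b) \<cdot> x = Zero \<C> A D" .
  have nb: "n \<cdot> b \<in> Hom B D" using h by (simp add: Hom_iff)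
  obtain m where m: "m \<in> Hom C D" "n \<cdot> b = m \<cdot> y" by (rule cokernel_covering_factor[OF cov nb nbx])
  note m' = m(1)[unfolded Hom_iff]
  have "n = (n \<cdot> b) \<cdot> bi" using h by (simp add: bi(3))
  also have "\<dots> = m \<cdot> (((ci \<cdot> c) \<cdot> y) \<cdot> bi)" unfolding m(2) ci(3) using h m' by simp
  also have "\<dots> = m \<cdot> (ci \<cdot> ((c \<cdot> y) \<cdot> bi))" using h m' by simp
  also have "(c \<cdot> y) \<cdot> bi = y'" unfolding eq(2) using h by (simp add: bi(3))
  finally show "\<exists>m \<in> Hom C' D. n = m \<cdot> y'"
    using h m' by (intro bexI[of _ "m \<cdot> ci"]) (simp_all add: Hom_iff)
qed

end

section \<open>Additive auto-equivalences\<close>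

text \<open>Common ground of the two directions. Additivity of the shift is an axiom on the
  triangulated side and a consequence of (ET1) on the other.\<close>

locale shifted_category = additive_category \<C>
  for \<C> :: "('o, 'm, 'x) addcat_scheme" (structure) and S :: "('o, 'm) endoftor" +
  assumes shift_equivalence: "auto_equivalence \<C> S"
    and shift_add_Hom: "\<lbrakk>f \<in> Hom A B; g \<in> Hom A B\<rbrakk> \<Longrightarrow> arrm S (f \<boxplus> g) = arrm S f \<boxplus> arrm S g"
begin

lemma shift_functor: "is_functor \<C> \<C> S"
  using shift_equivalence by (simp add: auto_equivalence_def)

lemma shift_Obj [simp]: "A \<in> Obj \<C> \<Longrightarrow> objm S A \<in> Obj \<C>"
  using shift_functor by (simp add: is_functor_def)

lemma shift_arr [simp]:
  assumes "f \<in> Arr \<C>"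
  shows "arrm S f \<in> Arr \<C>" "Dom \<C> (arrm S f) = objm S (Dom \<C> f)" "Cod \<C> (arrm S f) = objm S (Cod \<C> f)"
  using assms shift_functor Dom_Obj[of f] Cod_Obj[of f] unfolding is_functor_def by (auto simp: Hom_iff)

lemma shift_Id [simp]: "A \<in> Obj \<C> \<Longrightarrow> arrm S (Id \<C> A) = Id \<C> (objm S A)"
  using shift_functor by (simp add: is_functor_def)

lemma shift_comp [simp]:
  "\<lbrakk>f \<in> Arr \<C>; g \<in> Arr \<C>; Cod \<C> f = Dom \<C> g\<rbrakk> \<Longrightarrow> arrm S (g \<cdot> f) = arrm S g \<cdot> arrm S f"
  using shift_functor by (simp add: is_functor_def)

lemma shift_add [simp]:
  "\<lbrakk>f \<in> Arr \<C>; g \<in> Arr \<C>; Dom \<C> f = Dom \<C> g; Cod \<C> f = Cod \<C> g\<rbrakk>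
    \<Longrightarrow> arrm S (f \<boxplus> g) = arrm S f \<boxplus> arrm S g"
  by (rule shift_add_Hom) (auto simp: Hom_iff)

lemma shift_zero [simp]:
  assumes "A \<in> Obj \<C>" "B \<in> Obj \<C>"
  shows "arrm S (Zero \<C> A B) = Zero \<C> (objm S A) (objm S B)"
proof -
  have "arrm S (Zero \<C> A B) \<boxplus> arrm S (Zero \<C> A B) = arrm S (Zero \<C> A B \<boxplus> Zero \<C> A B)"
    using assms by (simp del: add_zero)
  also have "\<dots> = Zero \<C> (objm S A) (objm S B) \<boxplus> arrm S (Zero \<C> A B)" using assms by simp
  finally show ?thesis
    by (rule add_cancel[of _ _ "arrm S (Zero \<C> A B)", rotated -1]) (use assms in simp_all)
qed

lemma shift_neg [simp]:
  assumes "f \<in> Arr \<C>"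
  shows "arrm S (Neg \<C> f) = Neg \<C> (arrm S f)"
proof (rule neg_unique)
  have "arrm S (Neg \<C> f) \<boxplus> arrm S f = arrm S (Neg \<C> f \<boxplus> f)" using assms by (simp del: add_neg)
  then show "arrm S (Neg \<C> f) \<boxplus> arrm S f = Zero \<C> (Dom \<C> (arrm S f)) (Cod \<C> (arrm S f))"
    using assms Dom_Obj Cod_Obj by simp
qed (use assms in auto)

lemma shift_zero_object: "zero_object \<C> Z \<Longrightarrow> zero_object \<C> (objm S Z)"
  unfolding zero_object_iff by (metis shift_Id shift_Obj shift_zero)

lemma shift_faithful:
  assumes "f \<in> Hom A B" "g \<in> Hom A B" "arrm S f = arrm S g"
  shows "f = g"
  using shift_equivalence faithful_if_unit[OF _ assms]
  unfolding auto_equivalence_def by blast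

text \<open>The preimage is \<open>arrm G h\<close> conjugated by the unit, so naturality gives
  \<open>arrm G (arrm S f) = arrm G h\<close>. Unit and counit are not tied by triangle identities;
  faithfulness of \<open>G\<close> removes the outer \<open>G\<close> instead.\<close>

lemma shift_full:
  assumes AB: "A \<in> Obj \<C>" "B \<in> Obj \<C>" and h: "h \<in> Hom (objm S A) (objm S B)"
  obtains f where "f \<in> Hom A B" "arrm S f = h"
proof -
  obtain G \<eta> \<epsilon> where G: "is_functor \<C> \<C> G"
    and eta: "natural_iso \<C> \<C> id_ftor (comp_ftor G S) \<eta>"
    and eps: "natural_iso \<C> \<C> (comp_ftor S G) id_ftor \<epsilon>"
    using shift_equivalence unfolding auto_equivalence_def by blast
  have iso: "is_iso \<C> A (objm G (objm S A)) (\<eta> A)" "is_iso \<C> B (objm G (objm S B)) (\<eta> B)"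
    using eta AB by (auto simp: natural_iso_def id_ftor_def comp_ftor_def)
  obtain k where k: "\<eta> B \<in> Hom B (objm G (objm S B))" "k \<in> Hom (objm G (objm S B)) B"
      "\<eta> B \<cdot> k = Id \<C> (objm G (objm S B))"
    using iso(2) by (rule is_isoE)
  obtain l where l: "\<eta> A \<in> Hom A (objm G (objm S A))" "l \<in> Hom (objm G (objm S A)) A"
      "\<eta> A \<cdot> l = Id \<C> (objm G (objm S A))"
    using iso(1) by (rule is_isoE)
  define f where "f = k \<cdot> (arrm G h \<cdot> \<eta> A)"
  have Gh: "arrm G h \<in> Hom (objm G (objm S A)) (objm G (objm S B))"
    using G h AB by (simp add: is_functor_def)
  have f: "f \<in> Hom A B" using k l Gh by (simp add: f_def Hom_iff)
  have Sf: "arrm S f \<in> Hom (objm S A) (objm S B)" using f by (simp add: Hom_iff)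
  then have GSf: "arrm G (arrm S f) \<in> Hom (objm G (objm S A)) (objm G (objm S B))"
    using G AB by (simp add: is_functor_def)
  have "\<eta> B \<cdot> f = arrm G (arrm S f) \<cdot> \<eta> A"
    using eta f AB by (simp add: natural_iso_def id_ftor_def comp_ftor_def)
  moreover have "\<eta> B \<cdot> f = arrm G h \<cdot> \<eta> A"
    using comp_subst[OF k(3)] k l Gh by (simp add: f_def Hom_iff)
  ultimately have "(arrm G (arrm S f) \<cdot> \<eta> A) \<cdot> l = (arrm G h \<cdot> \<eta> A) \<cdot> l" by simp
  then have "arrm G (arrm S f) = arrm G h" using l GSf Gh by (simp add: Hom_iff)
  then have "arrm S f = h"
    using faithful_if_counit[OF eps Sf h] by blast
  with f show ?thesis by (rule that)
qed

lemma shift_surj: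
  assumes "X \<in> Obj \<C>"
  obtains B e where "B \<in> Obj \<C>" "is_iso \<C> X (objm S B) e"
proof -
  obtain G \<epsilon> where "is_functor \<C> \<C> G" "natural_iso \<C> \<C> (comp_ftor S G) id_ftor \<epsilon>"
    using shift_equivalence unfolding auto_equivalence_def by blast
  then have "objm G X \<in> Obj \<C>" "is_iso \<C> (objm S (objm G X)) X (\<epsilon> X)"
    using assms by (auto simp: natural_iso_def id_ftor_def comp_ftor_def is_functor_def)
  then show ?thesis using that by (metis is_isoE)
qed

end

section \<open>Triangles with fill-in properties\<close>

text \<open>\<open>T\<close> stands for the distinguished triangles as well as for the E-triangles.
  Rotation is not among the assumptions: for E-triangles it is a theorem whose proof uses the
  consequences derived here.\<close>

locale triangle_class = shifted_category \<C> S
  for \<C> :: "('o, 'm, 'x) addcat_scheme" (structure) and S :: "('o, 'm) endoftor" +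
  fixes T :: "'o \<Rightarrow> 'o \<Rightarrow> 'o \<Rightarrow> 'm \<Rightarrow> 'm \<Rightarrow> 'm \<Rightarrow> bool"
  assumes T_triangle: "T A B C x y \<delta> \<Longrightarrow> is_triangle \<C> S A B C x y \<delta>"
    and fill_right: "\<lbrakk>T A B C x y \<delta>; T A' B' C' x' y' \<delta>'; a \<in> Hom A A'; b \<in> Hom B B'; b \<cdot> x = x' \<cdot> a\<rbrakk>
      \<Longrightarrow> \<exists>c \<in> Hom C C'. c \<cdot> y = y' \<cdot> b \<and> arrm S a \<cdot> \<delta> = \<delta>' \<cdot> c"
    and fill_mid: "\<lbrakk>T A B C x y \<delta>; T A' B' C' x' y' \<delta>'; a \<in> Hom A A'; c \<in> Hom C C';
        arrm S a \<cdot> \<delta> = \<delta>' \<cdot> c\<rbrakk>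
      \<Longrightarrow> \<exists>b \<in> Hom B B'. b \<cdot> x = x' \<cdot> a \<and> c \<cdot> y = y' \<cdot> b"
    and fill_left: "\<lbrakk>T A B C x y \<delta>; T A' B' C' x' y' \<delta>'; b \<in> Hom B B'; c \<in> Hom C C'; c \<cdot> y = y' \<cdot> b\<rbrakk>
      \<Longrightarrow> \<exists>a \<in> Hom A A'. b \<cdot> x = x' \<cdot> a \<and> arrm S a \<cdot> \<delta> = \<delta>' \<cdot> c"
    and T_Id_left: "\<lbrakk>A \<in> Obj \<C>; zero_object \<C> Z\<rbrakk> \<Longrightarrow> T A A Z (Id \<C> A) (Zero \<C> A Z) (Zero \<C> Z (objm S A))"
    and T_Id_right: "\<lbrakk>A \<in> Obj \<C>; zero_object \<C> Z\<rbrakk> \<Longrightarrow> T Z A A (Zero \<C> Z A) (Id \<C> A) (Zero \<C> A (objm S Z))"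
begin

section \<open>Vanishing and factorization by comparison with trivial triangles\<close>

lemma triangle_arr:
  assumes "T A B C x y \<delta>"
  shows "A \<in> Obj \<C>" "B \<in> Obj \<C>" "C \<in> Obj \<C>" "x \<in> Arr \<C>" "y \<in> Arr \<C>" "\<delta> \<in> Arr \<C>"
    "Dom \<C> x = A" "Cod \<C> x = B" "Dom \<C> y = B" "Cod \<C> y = C" "Dom \<C> \<delta> = C" "Cod \<C> \<delta> = objm S A"
  using T_triangle[OF assms] by (auto simp: is_triangle_def Hom_iff)

text \<open>The pair \<open>(1, x)\<close> maps \<open>A = A \<rightarrow> 0\<close> to the given
  triangle, so \<open>y \<cdot> x\<close> factors through zero.\<close>

lemma triangle_yx:
  assumes "T A B C x y \<delta>"
  shows "y \<cdot> x = Zero \<C> A C"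
proof -
  note t = triangle_arr[OF assms]
  obtain Z where Z: "zero_object \<C> Z" using ex_zero_object by blast
  note ZO = zero_object_Obj[OF Z]
  show ?thesis
    using fill_right[OF T_Id_left[OF t(1) Z] assms, of "Id \<C> A" x] t ZO by (auto simp: Hom_iff)
qed

text \<open>The pair \<open>(1, y)\<close> maps \<open>0 \<rightarrow> B = B\<close> to the given
  triangle; the third map of the source is zero.\<close>

lemma triangle_delta_y:
  assumes "T A B C x y \<delta>"
  shows "\<delta> \<cdot> y = Zero \<C> B (objm S A)"
proof -
  note t = triangle_arr[OF assms]
  obtain Z where Z: "zero_object \<C> Z" using ex_zero_object by blast
  note ZO = zero_object_Obj[OF Z]
  show ?thesis
    using fill_left[OF T_Id_right[OF t(2) Z] assms, of "Id \<C> B" y] t ZO by (auto simp: Hom_iff)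
qed

text \<open>The pair \<open>(x, 1)\<close> maps the given triangle to
  \<open>B = B \<rightarrow> 0\<close>, whose third map is zero.\<close>

lemma triangle_Sx_delta:
  assumes "T A B C x y \<delta>"
  shows "arrm S x \<cdot> \<delta> = Zero \<C> C (objm S B)"
proof -
  note t = triangle_arr[OF assms]
  obtain Z where Z: "zero_object \<C> Z" using ex_zero_object by blast
  note ZO = zero_object_Obj[OF Z]
  show ?thesis
    using fill_right[OF assms T_Id_left[OF t(2) Z], of x "Id \<C> B"] t ZO by (auto simp: Hom_iff)
qed

text \<open>A map \<open>n\<close> with \<open>n \<cdot> x = 0\<close> is the middle part of a map
  to \<open>0 \<rightarrow> X = X\<close>; the fill-in on the right is the factor.\<close>

lemma triangle_cokernel_covering:
  assumes "T A B C x y \<delta>"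
  shows "cokernel_covering A B C x y"
  unfolding cokernel_covering_def
proof (intro conjI ballI impI)
  note t = triangle_arr[OF assms]
  show "x \<in> Hom A B" "y \<in> Hom B C" using t by (auto simp: Hom_iff)
  obtain Z where Z: "zero_object \<C> Z" using ex_zero_object by blast
  note ZO = zero_object_Obj[OF Z]
  fix X n assume "X \<in> Obj \<C>" "n \<in> Hom B X" "n \<cdot> x = Zero \<C> A X"
  then show "\<exists>m \<in> Hom C X. n = m \<cdot> y"
    using fill_right[OF assms T_Id_right[of X Z], of "Zero \<C> A Z" n] t Z ZO by (auto simp: Hom_iff)
qed

text \<open>The map \<open>n\<close> is the right part of a map from
  \<open>0 \<rightarrow> X = X\<close>; the middle fill-in is the factor.\<close>

lemma triangle_factor_through_y:
  assumes "T A B C x y \<delta>" and n: "n \<in> Hom X C" "\<delta> \<cdot> n = Zero \<C> X (objm S A)"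
  shows "\<exists>m \<in> Hom X B. n = y \<cdot> m"
proof -
  note t = triangle_arr[OF assms(1)]
  have X: "X \<in> Obj \<C>" using n Dom_Obj by (auto simp: Hom_iff)
  obtain Z where Z: "zero_object \<C> Z" using ex_zero_object by blast
  note ZO = zero_object_Obj[OF Z]
  show ?thesis
    using fill_mid[OF T_Id_right[OF X Z] assms(1), of "Zero \<C> Z A" n] t n X ZO by (auto simp: Hom_iff)
qed

text \<open>Identities on both ends form a morphism of extensions in either direction, so there are
  middle fill-ins both ways. This is what makes the induced realization independent of the
  triangle.\<close>

lemma triangle_seq_class_unique:
  assumes T: "T A B C x y \<delta>" "T A B' C x' y' \<delta>"
  shows "seq_class \<C> x y = seq_class \<C> x' y'"
proof -
  note t = triangle_arr[OF T(1)] and t' = triangle_arr[OF T(2)]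
  have "Id \<C> A \<in> Hom A A" "Id \<C> C \<in> Hom C C" "arrm S (Id \<C> A) \<cdot> \<delta> = \<delta> \<cdot> Id \<C> C"
    using t by (simp_all add: Hom_iff)
  note fill = fill_mid[OF T this] fill_mid[OF T(2) T(1) this]
  from fill(1) obtain b where "b \<in> Hom B B'" "b \<cdot> x = x'" "y' \<cdot> b = y"
    using t t' by (metis comp_id id_comp)
  moreover from fill(2) obtain b' where "b' \<in> Hom B' B" "b' \<cdot> x' = x" "y \<cdot> b' = y'"
    using t t' by (metis comp_id id_comp)
  ultimately show ?thesis
    by (rule cokernel_covering_seq_class[OF triangle_cokernel_covering[OF T(1)] triangle_cokernel_covering[OF T(2)]])
qed

text \<open>For a zero third map, comparison with the two trivial triangles gives a retraction
  \<open>r\<close> of \<open>x\<close> and a section \<open>s\<close> of \<open>y\<close>. They need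
  not satisfy \<open>r \<cdot> s = 0\<close>, so \<open>?b\<close> and \<open>?b'\<close> need not
  be inverse; the comparison of weak cokernels does not ask for that.\<close>

lemma split_triangle:
  assumes T: "T A B C x y (Zero \<C> C (objm S A))" and P: "is_biproduct \<C> A C P"
  shows "seq_class \<C> x y = seq_class \<C> (inl P) (prr P)"
proof -
  note t = triangle_arr[OF T]
  obtain Z where Z: "zero_object \<C> Z" using ex_zero_object by blast
  note ZO = zero_object_Obj[OF Z]
  have p: "vertex P \<in> Obj \<C>" "inl P \<in> Hom A (vertex P)" "inr P \<in> Hom C (vertex P)"
      "prl P \<in> Hom (vertex P) A" "prr P \<in> Hom (vertex P) C"
      "prl P \<cdot> inl P = Id \<C> A" "prr P \<cdot> inr P = Id \<C> C" "prr P \<cdot> inl P = Zero \<C> A C" "prl P \<cdot> inr P = Zero \<C> C A"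
      "(inl P \<cdot> prl P) \<boxplus> (inr P \<cdot> prr P) = Id \<C> (vertex P)"
    using P by (auto simp: is_biproduct_def)
  note p' = p(1-5)[unfolded Hom_iff]
  obtain r where r: "r \<in> Arr \<C>" "Dom \<C> r = B" "Cod \<C> r = A" "r \<cdot> x = Id \<C> A"
    using fill_mid[OF T T_Id_left[OF t(1) Z], of "Id \<C> A" "Zero \<C> C Z"] t ZO by (auto simp: Hom_iff)
  obtain s where s: "s \<in> Arr \<C>" "Dom \<C> s = C" "Cod \<C> s = B" "y \<cdot> s = Id \<C> C"
    using fill_mid[OF T_Id_right[OF t(3) Z] T, of "Zero \<C> Z A" "Id \<C> C"] t ZO by (auto simp: Hom_iff)
  \<comment> \<open>The biproduct sequence is not known to be a triangle, so its covering property
    is read off from the biproduct equations.\<close>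
  have cov: "cokernel_covering A (vertex P) C (inl P) (prr P)"
    unfolding cokernel_covering_def
  proof (intro conjI ballI impI p(2,5))
    fix X n assume n: "X \<in> Obj \<C>" "n \<in> Hom (vertex P) X" "n \<cdot> inl P = Zero \<C> A X"
    note n' = n[unfolded Hom_iff]
    have "n = n \<cdot> ((inl P \<cdot> prl P) \<boxplus> (inr P \<cdot> prr P))" unfolding p(10) using n' by simp
    also have "\<dots> = (n \<cdot> inr P) \<cdot> prr P"
      using n' p' comp_subst[OF n(3)] by simp
    finally show "\<exists>m \<in> Hom C X. n = m \<cdot> prr P"
      using n' p' by (intro bexI[of _ "n \<cdot> inr P"]) (simp_all add: Hom_iff)
  qed
  show ?thesis
  proof (rule cokernel_covering_seq_class[OF triangle_cokernel_covering[OF T] cov])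
    let ?b = "(inl P \<cdot> r) \<boxplus> (inr P \<cdot> y)" and ?b' = "(x \<cdot> prl P) \<boxplus> (s \<cdot> prr P)"
    show "?b \<in> Hom B (vertex P)" "?b' \<in> Hom (vertex P) B" using p' t r s by (simp_all add: Hom_iff)
    show "?b \<cdot> x = inl P" using p' t r triangle_yx[OF T] by simp
    show "prr P \<cdot> ?b = y" using p' t r p(7,8) comp_subst[OF p(7)] comp_subst[OF p(8)] by simp
    show "?b' \<cdot> inl P = x" using p' t s p(6,8) by simp
    show "y \<cdot> ?b' = prr P"
      using p' t s comp_subst[OF triangle_yx[OF T]] comp_subst[OF s(4)] by simp
  qed
qed

text \<open>The direct sum of two triangles is not known to lie in \<open>T\<close>. It inherits the
  covering property summand by summand, and it is compared with the triangle on
  \<open>\<theta>\<close> by fill-ins along the inclusions and projections.\<close>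

lemma dsum_triangle:
  assumes T: "T A B C x y \<delta>" "T A' B' C' x' y' \<delta>'" "T (vertex P) W (vertex R) u v \<theta>"
    and P: "is_biproduct \<C> A A' P" and Q: "is_biproduct \<C> B B' Q" and R: "is_biproduct \<C> C C' R"
    and th: "arrm S (prl P) \<cdot> \<theta> \<cdot> inl R = \<delta>" "arrm S (prr P) \<cdot> \<theta> \<cdot> inl R = Zero \<C> C (objm S A')"
      "arrm S (prl P) \<cdot> \<theta> \<cdot> inr R = Zero \<C> C' (objm S A)" "arrm S (prr P) \<cdot> \<theta> \<cdot> inr R = \<delta>'"
  shows "seq_class \<C> u v = seq_class \<C> (dsum \<C> P Q x x') (dsum \<C> Q R y y')"
proof -
  note t = triangle_arr[OF T(1)] and t' = triangle_arr[OF T(2)] and t'' = triangle_arr[OF T(3)]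
  have p: "inl P \<in> Hom A (vertex P)" "inr P \<in> Hom A' (vertex P)"
      "prl P \<in> Hom (vertex P) A" "prr P \<in> Hom (vertex P) A'"
    and p_eq: "prl P \<cdot> inl P = Id \<C> A" "prr P \<cdot> inr P = Id \<C> A'" "prr P \<cdot> inl P = Zero \<C> A A'" "prl P \<cdot> inr P = Zero \<C> A' A"
    and p_Id: "(inl P \<cdot> prl P) \<boxplus> (inr P \<cdot> prr P) = Id \<C> (vertex P)"
    using P by (auto simp: is_biproduct_def)
  have q: "vertex Q \<in> Obj \<C>" "inl Q \<in> Hom B (vertex Q)" "inr Q \<in> Hom B' (vertex Q)"
      "prl Q \<in> Hom (vertex Q) B" "prr Q \<in> Hom (vertex Q) B'"
    and q_eq: "prl Q \<cdot> inl Q = Id \<C> B" "prr Q \<cdot> inr Q = Id \<C> B'" "prr Q \<cdot> inl Q = Zero \<C> B B'" "prl Q \<cdot> inr Q = Zero \<C> B' B"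
    and q_Id: "(inl Q \<cdot> prl Q) \<boxplus> (inr Q \<cdot> prr Q) = Id \<C> (vertex Q)"
    using Q by (auto simp: is_biproduct_def)
  have r: "inl R \<in> Hom C (vertex R)" "inr R \<in> Hom C' (vertex R)"
      "prl R \<in> Hom (vertex R) C" "prr R \<in> Hom (vertex R) C'"
    and r_eq: "prl R \<cdot> inl R = Id \<C> C" "prr R \<cdot> inr R = Id \<C> C'" "prr R \<cdot> inl R = Zero \<C> C C'" "prl R \<cdot> inr R = Zero \<C> C' C"
    and r_Id: "(inl R \<cdot> prl R) \<boxplus> (inr R \<cdot> prr R) = Id \<C> (vertex R)"
    using R by (auto simp: is_biproduct_def)
  note p' = p[unfolded Hom_iff] and q' = q[unfolded Hom_iff] and r' = r[unfolded Hom_iff]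
  \<comment> \<open>The shift carries the decomposition of \<open>vertex P\<close> to one of its
    shift, so a map into the latter is determined by its two components.\<close>
  have Sp: "(arrm S (inl P) \<cdot> arrm S (prl P)) \<boxplus> (arrm S (inr P) \<cdot> arrm S (prr P)) = Id \<C> (objm S (vertex P))"
    using arg_cong[OF p_Id, of "arrm S"] p' t''(1) by simp
  have split_S: "k = (arrm S (inl P) \<cdot> (arrm S (prl P) \<cdot> k)) \<boxplus> (arrm S (inr P) \<cdot> (arrm S (prr P) \<cdot> k))"
    if "k \<in> Arr \<C>" "Cod \<C> k = objm S (vertex P)" for k
    using that p' id_comp[of k "objm S (vertex P)"] unfolding Sp[symmetric] by simp
  \<comment> \<open>Since \<open>\<theta>\<close> is diagonal, the inclusions are morphisms from
    \<open>\<delta>\<close> and \<open>\<delta>'\<close> to \<open>\<theta>\<close>, and the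
    projections are morphisms back. Each of the four gives a middle fill-in below.\<close>
  have th_inl: "arrm S (inl P) \<cdot> \<delta> = \<theta> \<cdot> inl R"
    using split_S[of "\<theta> \<cdot> inl R"] th(1,2) t t' t'' p' r' by simp
  have th_inr: "arrm S (inr P) \<cdot> \<delta>' = \<theta> \<cdot> inr R"
    using split_S[of "\<theta> \<cdot> inr R"] th(3,4) t t' t'' p' r' by simp
  have split_R: "k = ((k \<cdot> inl R) \<cdot> prl R) \<boxplus> ((k \<cdot> inr R) \<cdot> prr R)"
    if "k \<in> Arr \<C>" "Dom \<C> k = vertex R" for k
    using that r' comp_id[of k "vertex R"] unfolding r_Id[symmetric] by simp
  have th_prl: "arrm S (prl P) \<cdot> \<theta> = \<delta> \<cdot> prl R"
  proof -
    have "arrm S (prl P) \<cdot> \<theta> = (((arrm S (prl P) \<cdot> \<theta>) \<cdot> inl R) \<cdot> prl R) \<boxplus> (((arrm S (prl P) \<cdot> \<theta>) \<cdot> inr R) \<cdot> prr R)"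
      using t'' p' by (intro split_R) simp_all
    also have "(arrm S (prl P) \<cdot> \<theta>) \<cdot> inl R = \<delta>" using th(1) t'' p' r' by simp
    also have "(arrm S (prl P) \<cdot> \<theta>) \<cdot> inr R = Zero \<C> C' (objm S A)" using th(3) t'' p' r' by simp
    finally show ?thesis using r' t t' by simp
  qed
  have th_prr: "arrm S (prr P) \<cdot> \<theta> = \<delta>' \<cdot> prr R"
  proof -
    have "arrm S (prr P) \<cdot> \<theta> = (((arrm S (prr P) \<cdot> \<theta>) \<cdot> inl R) \<cdot> prl R) \<boxplus> (((arrm S (prr P) \<cdot> \<theta>) \<cdot> inr R) \<cdot> prr R)"
      using t'' p' by (intro split_R) simp_all
    also have "(arrm S (prr P) \<cdot> \<theta>) \<cdot> inl R = Zero \<C> C (objm S A')" using th(2) t'' p' r' by simp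
    also have "(arrm S (prr P) \<cdot> \<theta>) \<cdot> inr R = \<delta>'" using th(4) t'' p' r' by simp
    finally show ?thesis using r' t t' by simp
  qed
  obtain b1 where b1: "b1 \<in> Arr \<C>" "Dom \<C> b1 = B" "Cod \<C> b1 = W" "b1 \<cdot> x = u \<cdot> inl P" "v \<cdot> b1 = inl R \<cdot> y"
    using fill_mid[OF T(1) T(3) p(1) r(1) th_inl] by (auto simp: Hom_iff)
  obtain b2 where b2: "b2 \<in> Arr \<C>" "Dom \<C> b2 = B'" "Cod \<C> b2 = W" "b2 \<cdot> x' = u \<cdot> inr P" "v \<cdot> b2 = inr R \<cdot> y'"
    using fill_mid[OF T(2) T(3) p(2) r(2) th_inr] by (auto simp: Hom_iff)
  obtain q1 where q1: "q1 \<in> Arr \<C>" "Dom \<C> q1 = W" "Cod \<C> q1 = B" "q1 \<cdot> u = x \<cdot> prl P" "y \<cdot> q1 = prl R \<cdot> v"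
    using fill_mid[OF T(3) T(1) p(3) r(3) th_prl] by (auto simp: Hom_iff)
  obtain q2 where q2: "q2 \<in> Arr \<C>" "Dom \<C> q2 = W" "Cod \<C> q2 = B'" "q2 \<cdot> u = x' \<cdot> prr P" "y' \<cdot> q2 = prr R \<cdot> v"
    using fill_mid[OF T(3) T(2) p(4) r(4) th_prr] by (auto simp: Hom_iff)
  let ?X = "dsum \<C> P Q x x'" and ?Y = "dsum \<C> Q R y y'"
  have X: "?X \<in> Hom (vertex P) (vertex Q)" and Y: "?Y \<in> Hom (vertex Q) (vertex R)"
    using t t' p' q' r' by (simp_all add: dsum_def Hom_iff)
  note q_subst = q_eq comp_subst[OF q_eq(1)] comp_subst[OF q_eq(2)] comp_subst[OF q_eq(3)] comp_subst[OF q_eq(4)]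
  have cov: "cokernel_covering (vertex P) (vertex Q) (vertex R) ?X ?Y"
    unfolding cokernel_covering_def
  proof (intro conjI ballI impI X Y)
    fix D n assume D: "D \<in> Obj \<C>" and n: "n \<in> Hom (vertex Q) D" and n0: "n \<cdot> ?X = Zero \<C> (vertex P) D"
    note n' = n[unfolded Hom_iff]
    have "(n \<cdot> inl Q) \<cdot> x = (n \<cdot> ?X) \<cdot> inl P"
      using n' p' q' t t' p_eq comp_subst[OF p_eq(1)] by (simp add: dsum_def)
    also have "\<dots> = Zero \<C> A D" unfolding n0 using p' D t t' by simp
    finally have "(n \<cdot> inl Q) \<cdot> x = Zero \<C> A D" .
    moreover have "n \<cdot> inl Q \<in> Hom B D" using n' q' by (simp add: Hom_iff)
    ultimately obtain m1 where m1: "m1 \<in> Hom C D" "n \<cdot> inl Q = m1 \<cdot> y"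
      using cokernel_covering_factor[OF triangle_cokernel_covering[OF T(1)]] by blast
    have "(n \<cdot> inr Q) \<cdot> x' = (n \<cdot> ?X) \<cdot> inr P"
      using n' p' q' t t' p_eq by (simp add: dsum_def)
    also have "\<dots> = Zero \<C> A' D" unfolding n0 using p' D t t' by simp
    finally have "(n \<cdot> inr Q) \<cdot> x' = Zero \<C> A' D" .
    moreover have "n \<cdot> inr Q \<in> Hom B' D" using n' q' by (simp add: Hom_iff)
    ultimately obtain m2 where m2: "m2 \<in> Hom C' D" "n \<cdot> inr Q = m2 \<cdot> y'"
      using cokernel_covering_factor[OF triangle_cokernel_covering[OF T(2)]] by blast
    note m' = m1(1)[unfolded Hom_iff] m2(1)[unfolded Hom_iff]
    have "n = n \<cdot> ((inl Q \<cdot> prl Q) \<boxplus> (inr Q \<cdot> prr Q))" unfolding q_Id using n' by simp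
    also have "\<dots> = ((n \<cdot> inl Q) \<cdot> prl Q) \<boxplus> ((n \<cdot> inr Q) \<cdot> prr Q)" using n' q' by simp
    also have "\<dots> = (m1 \<cdot> (y \<cdot> prl Q)) \<boxplus> (m2 \<cdot> (y' \<cdot> prr Q))"
      unfolding m1(2) m2(2) using m' q' t t' by simp
    also have "\<dots> = ((m1 \<cdot> prl R) \<boxplus> (m2 \<cdot> prr R)) \<cdot> ?Y"
      using m' q' r' t t' D r_eq comp_subst[OF r_eq(1)] comp_subst[OF r_eq(2)] comp_subst[OF r_eq(3)] comp_subst[OF r_eq(4)]
      by (simp add: dsum_def)
    finally show "\<exists>m \<in> Hom (vertex R) D. n = m \<cdot> ?Y"
      using m' r' by (intro bexI[of _ "(m1 \<cdot> prl R) \<boxplus> (m2 \<cdot> prr R)"]) (simp_all add: Hom_iff)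
  qed
  show ?thesis
  proof (rule cokernel_covering_seq_class[OF triangle_cokernel_covering[OF T(3)] cov])
    let ?q = "(inl Q \<cdot> q1) \<boxplus> (inr Q \<cdot> q2)" and ?b = "(b1 \<cdot> prl Q) \<boxplus> (b2 \<cdot> prr Q)"
    show "?q \<in> Hom W (vertex Q)" "?b \<in> Hom (vertex Q) W" using q1 q2 b1 b2 q' by (simp_all add: Hom_iff)
    show "?q \<cdot> u = ?X" using q1 q2 q' t'' by (simp add: dsum_def)
    show "?Y \<cdot> ?q = v"
    proof -
      have "?Y \<cdot> ?q = (inl R \<cdot> (y \<cdot> q1)) \<boxplus> (inr R \<cdot> (y' \<cdot> q2))"
        using q1(1-3) q2(1-3) q' r' t t' t'' q_subst by (simp add: dsum_def)
      also have "\<dots> = ((inl R \<cdot> prl R) \<boxplus> (inr R \<cdot> prr R)) \<cdot> v"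
        unfolding q1(5) q2(5) using r' t'' by simp
      finally show ?thesis unfolding r_Id using t'' by simp
    qed
    show "?b \<cdot> ?X = u"
    proof -
      have "?b \<cdot> ?X = ((b1 \<cdot> x) \<cdot> prl P) \<boxplus> ((b2 \<cdot> x') \<cdot> prr P)"
        using b1(1-3) b2(1-3) q' p' t t' t'' q_subst by (simp add: dsum_def)
      also have "\<dots> = u \<cdot> ((inl P \<cdot> prl P) \<boxplus> (inr P \<cdot> prr P))"
        unfolding b1(4) b2(4) using p' t'' by simp
      finally show ?thesis unfolding p_Id using t'' by simp
    qed
    show "v \<cdot> ?b = ?Y"
    proof -
      have "v \<cdot> ?b = ((v \<cdot> b1) \<cdot> prl Q) \<boxplus> ((v \<cdot> b2) \<cdot> prr Q)"
        using b1(1-3) b2(1-3) q' t'' by simp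
      then show ?thesis unfolding b1(5) b2(5) dsum_def using q' r' t t' by simp
    qed
  qed
qed

end

section \<open>The bifunctor \<open>\<C>(-, -[1])\<close>\<close>

context shifted_category
begin

lemma Ext_E1 [simp]:
  "Ext (E1 \<C> S) C A = Hom C (objm S A)" "one (eobj (E1 \<C> S) C A) = Zero \<C> C (objm S A)"
  "mult (eobj (E1 \<C> S) C A) = (\<boxplus>)"
  by (simp_all add: E1_def)

lemma earr_E1: "earr (E1 \<C> S) c a \<delta> = arrm S a \<cdot> \<delta> \<cdot> c"
  by (simp add: E1_def)

lemma push_E1 [simp]: "\<delta> \<in> Arr \<C> \<Longrightarrow> Dom \<C> \<delta> = C \<Longrightarrow> push \<C> (E1 \<C> S) C a \<delta> = arrm S a \<cdot> \<delta>"
  by (simp add: push_def earr_E1)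

lemma pull_E1 [simp]:
  "\<lbrakk>\<delta> \<in> Arr \<C>; c \<in> Arr \<C>; Cod \<C> c = Dom \<C> \<delta>; Cod \<C> \<delta> = objm S A; A \<in> Obj \<C>\<rbrakk>
    \<Longrightarrow> pull \<C> (E1 \<C> S) A c \<delta> = \<delta> \<cdot> c"
  by (simp add: pull_def earr_E1)

lemma E_triangle_E1_iff:
  "E_triangle \<C> (E1 \<C> S) s A B C x y \<delta> \<longleftrightarrow>
    is_triangle \<C> S A B C x y \<delta> \<and> s C A \<delta> = seq_class \<C> x y"
  by (auto simp: E_triangle_def is_triangle_def)

lemma biadditive_E1: "biadditive \<C> (E1 \<C> S)"
  unfolding biadditive_def by (auto simp: earr_E1 Hom_iff)

end

section \<open>Triangulated categories are extriangulated\<close>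

context triangulated_category
begin

sublocale shifted_category \<C> S
proof
  show "auto_equivalence \<C> S" by (rule shift_auto_equivalence)
  fix f g A B assume "f \<in> Hom A B" "g \<in> Hom A B"
  then show "arrm S (f \<boxplus> g) = arrm S f \<boxplus> arrm S g"
    using shift_additive Dom_Obj[of f] Cod_Obj[of f] unfolding additive_functor_def
    by (auto simp: Hom_iff)
qed

lemma dist_rotate:
  "is_dist \<C> S \<Delta> A B C x y z \<Longrightarrow> is_dist \<C> S \<Delta> B C (objm S A) y z (Neg \<C> (arrm S x))"
  using TR2 by (auto simp: is_dist_def)

lemma dist_arr:
  assumes "is_dist \<C> S \<Delta> A B C x y \<delta>"
  shows "A \<in> Obj \<C>" "B \<in> Obj \<C>" "C \<in> Obj \<C>" "x \<in> Arr \<C>" "y \<in> Arr \<C>" "\<delta> \<in> Arr \<C>"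
    "Dom \<C> x = A" "Cod \<C> x = B" "Dom \<C> y = B" "Cod \<C> y = C" "Dom \<C> \<delta> = C" "Cod \<C> \<delta> = objm S A"
  using assms by (auto simp: is_dist_def is_triangle_def Hom_iff)

text \<open>The left fill-in is \<open>TR3\<close> after one rotation, the middle one
  \<open>TR3\<close> after two. The map found lives between shifted objects and descends by full
  faithfulness; the signs of the rotated maps occur on both sides and cancel.\<close>

sublocale dist: triangle_class \<C> S "is_dist \<C> S \<Delta>"
proof
  fix A B C x y \<delta> A' B' C' x' y' \<delta>'
  assume T: "is_dist \<C> S \<Delta> A B C x y \<delta>" and T': "is_dist \<C> S \<Delta> A' B' C' x' y' \<delta>'"
  note t = dist_arr[OF T] and t' = dist_arr[OF T']
  note R = dist_rotate[OF T] and R' = dist_rotate[OF T']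
  show "is_triangle \<C> S A B C x y \<delta>" using T by (simp add: is_dist_def)
  {
    fix a b assume "a \<in> Hom A A'" "b \<in> Hom B B'" "b \<cdot> x = x' \<cdot> a"
    then show "\<exists>c \<in> Hom C C'. c \<cdot> y = y' \<cdot> b \<and> arrm S a \<cdot> \<delta> = \<delta>' \<cdot> c" by (rule TR3[OF T T'])
  next
    fix a c assume a: "a \<in> Hom A A'" and c: "c \<in> Hom C C'" and eq: "arrm S a \<cdot> \<delta> = \<delta>' \<cdot> c"
    have "arrm S a \<in> Hom (objm S A) (objm S A')" using a by (simp add: Hom_iff)
    from TR3[OF dist_rotate[OF R] dist_rotate[OF R'] c this eq]
    obtain e where e: "e \<in> Hom (objm S B) (objm S B')"
      "e \<cdot> Neg \<C> (arrm S x) = Neg \<C> (arrm S x') \<cdot> arrm S a"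
      "arrm S c \<cdot> Neg \<C> (arrm S y) = Neg \<C> (arrm S y') \<cdot> e" by blast
    obtain b where b: "b \<in> Hom B B'" "arrm S b = e"
      by (rule shift_full[OF t(2) t'(2) e(1)])
    note h = a[unfolded Hom_iff] b(1)[unfolded Hom_iff] c[unfolded Hom_iff]
    have "arrm S (b \<cdot> x) = arrm S (x' \<cdot> a)"
      by (rule neg_inject) (use h t t' e(2) in \<open>simp_all add: b(2)[symmetric]\<close>)
    moreover have "arrm S (c \<cdot> y) = arrm S (y' \<cdot> b)"
      by (rule neg_inject) (use h t t' e(3) in \<open>simp_all add: b(2)[symmetric]\<close>)
    ultimately have "b \<cdot> x = x' \<cdot> a" "c \<cdot> y = y' \<cdot> b"
      using h t t' shift_faithful[of "b \<cdot> x" A B' "x' \<cdot> a"] shift_faithful[of "c \<cdot> y" B C' "y' \<cdot> b"]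
      by (simp_all add: Hom_iff)
    with b(1) show "\<exists>b \<in> Hom B B'. b \<cdot> x = x' \<cdot> a \<and> c \<cdot> y = y' \<cdot> b" by blast
  next
    fix b c assume b: "b \<in> Hom B B'" and c: "c \<in> Hom C C'" and eq: "c \<cdot> y = y' \<cdot> b"
    from TR3[OF R R' b c eq]
    obtain e where e: "e \<in> Hom (objm S A) (objm S A')" "e \<cdot> \<delta> = \<delta>' \<cdot> c"
      "arrm S b \<cdot> Neg \<C> (arrm S x) = Neg \<C> (arrm S x') \<cdot> e" by blast
    obtain a where a: "a \<in> Hom A A'" "arrm S a = e"
      by (rule shift_full[OF t(1) t'(1) e(1)])
    note h = a[unfolded Hom_iff] b[unfolded Hom_iff]
    have "arrm S (b \<cdot> x) = arrm S (x' \<cdot> a)"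
      by (rule neg_inject) (use h t t' e(3) in \<open>simp_all add: a(2)[symmetric]\<close>)
    then have "b \<cdot> x = x' \<cdot> a"
      using h t t' shift_faithful[of "b \<cdot> x" A B' "x' \<cdot> a"] by (simp add: Hom_iff)
    with a e(2) show "\<exists>a \<in> Hom A A'. b \<cdot> x = x' \<cdot> a \<and> arrm S a \<cdot> \<delta> = \<delta>' \<cdot> c" by blast
  }
next
  fix A Z assume A: "A \<in> Obj \<C>" and Z: "zero_object \<C> Z"
  show "is_dist \<C> S \<Delta> A A Z (Id \<C> A) (Zero \<C> A Z) (Zero \<C> Z (objm S A))"
    by (rule TR1_id[OF A Z])
  have tri: "is_triangle \<C> S Z A A (Zero \<C> Z A) (Id \<C> A) (Zero \<C> A (objm S Z))"
    using A zero_object_Obj[OF Z] by (simp add: is_triangle_def Hom_iff)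
  \<comment> \<open>Its rotation is the trivial triangle \<open>A = A \<rightarrow> Z[1]\<close>,
    because \<open>Z[1]\<close> is again a zero object.\<close>
  show "is_dist \<C> S \<Delta> Z A A (Zero \<C> Z A) (Id \<C> A) (Zero \<C> A (objm S Z))"
    using TR1_id[OF A shift_zero_object[OF Z]] A zero_object_Obj[OF Z] by (subst TR2[OF tri]) simp
qed

section \<open>Triangles with prescribed third map and the induced realization\<close>

lemma dist_iso_right:
  assumes T: "is_dist \<C> S \<Delta> A B C x y z" and c: "is_iso \<C> C C' c"
    and y': "y' \<in> Hom B C'" "c \<cdot> y = y'" and z': "z' \<in> Hom C' (objm S A)" "z' \<cdot> c = z"
  shows "is_dist \<C> S \<Delta> A B C' x y' z'"
proof -
  note t = dist_arr[OF T]
  have "C' \<in> Obj \<C>" using y' Cod_Obj by (auto simp: Hom_iff)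
  then have tri: "is_triangle \<C> S A B C' x y' z'" using t y' z' by (simp add: is_triangle_def Hom_iff)
  show ?thesis
    by (rule TR1_iso[OF T tri is_iso_Id is_iso_Id c]) (use t y' z' in \<open>simp_all add: Hom_iff\<close>)
qed

text \<open>\<open>TR1_cone\<close> prescribes the first map only. So \<open>\<delta>\<close> is
  completed as a first map, the cone is replaced by an isomorphic shifted object, and the result is
  recognized as a double rotation.\<close>

lemma dist_third:
  assumes A: "A \<in> Obj \<C>" and \<delta>: "\<delta> \<in> Hom C (objm S A)"
  shows "\<exists>B x y. is_dist \<C> S \<Delta> A B C x y \<delta>"
proof -
  have C: "C \<in> Obj \<C>" using \<delta> Dom_Obj by (auto simp: Hom_iff)
  obtain D u v where T: "is_dist \<C> S \<Delta> C (objm S A) D \<delta> u v" using TR1_cone[OF C _ \<delta>] A by auto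
  note t = dist_arr[OF T]
  obtain B e where B: "B \<in> Obj \<C>" and e: "is_iso \<C> D (objm S B) e" by (rule shift_surj[OF t(3)])
  obtain e' where e': "e \<in> Hom D (objm S B)" "e' \<in> Hom (objm S B) D" "e' \<cdot> e = Id \<C> D"
    using e by (rule is_isoE)
  \<comment> \<open>The signs are chosen to match the double rotation, whose maps are
    \<open>\<delta>\<close>, \<open>-x[1]\<close> and \<open>-y[1]\<close>.\<close>
  have "Neg \<C> (e \<cdot> u) \<in> Hom (objm S A) (objm S B)" using e' t by (simp add: Hom_iff)
  then obtain x where x: "x \<in> Hom A B" "arrm S x = Neg \<C> (e \<cdot> u)" by (rule shift_full[OF A B])
  have "Neg \<C> (v \<cdot> e') \<in> Hom (objm S B) (objm S C)" using e' t by (simp add: Hom_iff)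
  then obtain y where y: "y \<in> Hom B C" "arrm S y = Neg \<C> (v \<cdot> e')" by (rule shift_full[OF B C])
  have "is_dist \<C> S \<Delta> C (objm S A) (objm S B) \<delta> (e \<cdot> u) (v \<cdot> e')"
    using t e' by (intro dist_iso_right[OF T e]) (simp_all add: Hom_iff)
  moreover have "e \<cdot> u = Neg \<C> (arrm S x)" "v \<cdot> e' = Neg \<C> (arrm S y)"
    using x y e' t by (simp_all add: Hom_iff)
  ultimately have "is_dist \<C> S \<Delta> C (objm S A) (objm S B) \<delta> (Neg \<C> (arrm S x)) (Neg \<C> (arrm S y))" by simp
  moreover have "is_triangle \<C> S B C (objm S A) y \<delta> (Neg \<C> (arrm S x))" "is_triangle \<C> S A B C x y \<delta>"
    using x(1) y(1) A B C \<delta> by (simp_all add: is_triangle_def Hom_iff)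
  ultimately have "is_dist \<C> S \<Delta> A B C x y \<delta>" using TR2 by simp
  then show ?thesis by blast
qed

lemma dist_seq_class:
  assumes T: "is_dist \<C> S \<Delta> A B C x y \<delta>" and x': "x' \<in> Hom A B'" and y': "y' \<in> Hom B' C"
    and eq: "seq_class \<C> x y = seq_class \<C> x' y'"
  shows "is_dist \<C> S \<Delta> A B' C x' y' \<delta>"
proof -
  note t = dist_arr[OF T]
  have "x \<in> Hom A B" "y \<in> Hom B C" using t by (simp_all add: Hom_iff)
  then obtain b where b: "is_iso \<C> B B' b" "b \<cdot> x = x'" "y' \<cdot> b = y"
    using seq_class_eq_iff[of x A B y C x' B' y'] x' y' eq by blast
  have "is_triangle \<C> S A B' C x' y' \<delta>"
    using t x' y' Cod_Obj[of x'] by (auto simp: is_triangle_def Hom_iff)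
  then show ?thesis
    by (rule TR1_iso[OF T _ is_iso_Id b(1) is_iso_Id])
      (use t x' y' b in \<open>simp_all add: Hom_iff\<close>)
qed

lemma realization_of_eq:
  assumes "is_dist \<C> S \<Delta> A B C x y \<delta>"
  shows "realization_of \<C> S \<Delta> C A \<delta> = seq_class \<C> x y"
proof -
  obtain x' y' where xy: "(SOME (x, y). \<exists>B. is_dist \<C> S \<Delta> A B C x y \<delta>) = (x', y')" by fastforce
  have "case (x', y') of (x, y) \<Rightarrow> \<exists>B. is_dist \<C> S \<Delta> A B C x y \<delta>"
    unfolding xy[symmetric] by (rule someI[of _ "(x, y)"]) (use assms in blast)
  then obtain B' where "is_dist \<C> S \<Delta> A B' C x' y' \<delta>" by auto
  then have "seq_class \<C> x y = seq_class \<C> x' y'" by (rule dist.triangle_seq_class_unique[OF assms])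
  then show ?thesis unfolding realization_of_def xy by simp
qed

text \<open>An E-triangle is only equivalent to the triangle that was chosen to define its class;
  invariance of distinguished triangles under isomorphism closes the gap.\<close>

lemma E_triangle_realization_of_iff:
  "E_triangle \<C> (E1 \<C> S) (realization_of \<C> S \<Delta>) A B C x y \<delta> \<longleftrightarrow> is_dist \<C> S \<Delta> A B C x y \<delta>"
proof
  assume "is_dist \<C> S \<Delta> A B C x y \<delta>"
  then show "E_triangle \<C> (E1 \<C> S) (realization_of \<C> S \<Delta>) A B C x y \<delta>"
    using realization_of_eq by (simp add: E_triangle_E1_iff is_dist_def)
next
  assume E: "E_triangle \<C> (E1 \<C> S) (realization_of \<C> S \<Delta>) A B C x y \<delta>"
  then have tri: "A \<in> Obj \<C>" "x \<in> Hom A B" "y \<in> Hom B C" "\<delta> \<in> Hom C (objm S A)"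
    by (simp_all add: E_triangle_E1_iff is_triangle_def)
  obtain B' x' y' where T: "is_dist \<C> S \<Delta> A B' C x' y' \<delta>" using dist_third[OF tri(1,4)] by blast
  have "seq_class \<C> x' y' = seq_class \<C> x y"
    using E realization_of_eq[OF T] by (simp add: E_triangle_E1_iff)
  then show "is_dist \<C> S \<Delta> A B C x y \<delta>" by (rule dist_seq_class[OF T tri(2,3)])
qed

text \<open>Three rotations put a sign on each of the three maps. The isomorphism \<open>-1\<close>
  on the middle object accounts for two of them, so exactly one sign remains, here on the third
  map.\<close>

lemma dist_unshift:
  assumes T: "is_dist \<C> S \<Delta> (objm S A) (objm S B) (objm S C) (arrm S x) (arrm S y) (Neg \<C> (arrm S z))"
    and tri: "is_triangle \<C> S A B C x y z"
  shows "is_dist \<C> S \<Delta> A B C x y z"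
proof -
  have t: "A \<in> Obj \<C>" "B \<in> Obj \<C>" "C \<in> Obj \<C>" "x \<in> Hom A B" "y \<in> Hom B C" "z \<in> Hom C (objm S A)"
    using tri by (simp_all add: is_triangle_def)
  note t' = t[unfolded Hom_iff]
  have "is_triangle \<C> S (objm S A) (objm S B) (objm S C) (Neg \<C> (arrm S x)) (Neg \<C> (arrm S y)) (Neg \<C> (arrm S z))"
    using t' by (simp add: is_triangle_def Hom_iff)
  then have "is_dist \<C> S \<Delta> (objm S A) (objm S B) (objm S C) (Neg \<C> (arrm S x)) (Neg \<C> (arrm S y)) (Neg \<C> (arrm S z))"
    by (rule TR1_iso[OF T _ is_iso_Id is_iso_neg_Id is_iso_Id]) (use t' in simp_all)
  moreover have "is_triangle \<C> S B C (objm S A) y z (Neg \<C> (arrm S x))"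
    "is_triangle \<C> S C (objm S A) (objm S B) z (Neg \<C> (arrm S x)) (Neg \<C> (arrm S y))"
    using t' by (simp_all add: is_triangle_def Hom_iff)
  ultimately show ?thesis using TR2 tri by simp
qed

text \<open>The dual of \<open>TR4\<close> is \<open>TR4\<close> for the rotated triangles starting at \<open>f\<close>, \<open>g\<close> and \<open>g f\<close>.\<close>

lemma octahedral_dual:
  assumes T: "is_dist \<C> S \<Delta> D A B f' f \<delta>" and T': "is_dist \<C> S \<Delta> F B C g' g \<delta>'"
    and T'': "is_dist \<C> S \<Delta> G A C h' (g \<cdot> f) \<delta>''"
  shows "\<exists>d e. is_dist \<C> S \<Delta> D G F d e (\<delta> \<cdot> g') \<and> h' \<cdot> d = f' \<and> f \<cdot> h' = g' \<cdot> e \<and>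
    \<delta>' = arrm S e \<cdot> \<delta>'' \<and> arrm S d \<cdot> \<delta> = \<delta>'' \<cdot> g"
proof -
  note t = dist_arr[OF T] and t' = dist_arr[OF T'] and t'' = dist_arr[OF T'']
  obtain u v where uv: "is_dist \<C> S \<Delta> (objm S D) (objm S G) (objm S F) u v (arrm S \<delta> \<cdot> Neg \<C> (arrm S g'))"
    "u \<cdot> \<delta> = \<delta>'' \<cdot> g" "v \<cdot> \<delta>'' = \<delta>'" "Neg \<C> (arrm S h') \<cdot> u = Neg \<C> (arrm S f')"
    "Neg \<C> (arrm S g') \<cdot> v = arrm S f \<cdot> Neg \<C> (arrm S h')"
    using TR4[OF dist_rotate[OF T] dist_rotate[OF T'] dist_rotate[OF T'']] by blast
  have uv': "u \<in> Hom (objm S D) (objm S G)" "v \<in> Hom (objm S G) (objm S F)"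
    using dist_arr[OF uv(1)] by (simp_all add: Hom_iff)
  obtain d where d: "d \<in> Hom D G" "arrm S d = u"
    by (rule shift_full[OF t(1) t''(1) uv'(1)])
  obtain e where e: "e \<in> Hom G F" "arrm S e = v"
    by (rule shift_full[OF t''(1) t'(1) uv'(2)])
  note h = d(1)[unfolded Hom_iff] e(1)[unfolded Hom_iff]
  have tri: "is_triangle \<C> S D G F d e (\<delta> \<cdot> g')" using t t' t'' h by (simp add: is_triangle_def Hom_iff)
  \<comment> \<open>The sign of the third map \<open>-g'[1]\<close> of the rotated triangle is
    precisely the one that \<open>dist_unshift\<close> expects.\<close>
  have "arrm S \<delta> \<cdot> Neg \<C> (arrm S g') = Neg \<C> (arrm S (\<delta> \<cdot> g'))" using t t' by simp
  then have "is_dist \<C> S \<Delta> D G F d e (\<delta> \<cdot> g')"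
    using uv(1) unfolding d(2)[symmetric] e(2)[symmetric] by (metis dist_unshift[OF _ tri])
  moreover have "arrm S (h' \<cdot> d) = arrm S f'"
    by (rule neg_inject) (use uv(4) h t t'' in \<open>simp_all add: d(2)[symmetric]\<close>)
  then have "h' \<cdot> d = f'" using h t t'' shift_faithful[of "h' \<cdot> d" D A f'] by (simp add: Hom_iff)
  moreover have "arrm S (f \<cdot> h') = arrm S (g' \<cdot> e)"
    by (rule neg_inject) (use uv(5) h t t' t'' in \<open>simp_all add: e(2)[symmetric]\<close>)
  then have "f \<cdot> h' = g' \<cdot> e"
    using h t t' t'' shift_faithful[of "f \<cdot> h'" G B "g' \<cdot> e"] by (simp add: Hom_iff)
  ultimately show ?thesis using uv(2,3) d(2) e(2) by blast
qed

lemma additive_realization_of: "additive_realization \<C> (E1 \<C> S) (realization_of \<C> S \<Delta>)"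
  unfolding additive_realization_def is_realization_def E_triangle_realization_of_iff
proof (intro conjI ballI allI impI)
  fix C A \<delta> assume "A \<in> Obj \<C>" "\<delta> \<in> Ext (E1 \<C> S) C A"
  then show "\<exists>B x y. is_dist \<C> S \<Delta> A B C x y \<delta>" by (simp add: dist_third)
next
  fix A B C x y \<delta> A' B' C' x' y' \<delta>' a c
  assume T: "is_dist \<C> S \<Delta> A B C x y \<delta>" "is_dist \<C> S \<Delta> A' B' C' x' y' \<delta>'"
    and a: "a \<in> Hom A A'" and c: "c \<in> Hom C C'"
    and eq: "push \<C> (E1 \<C> S) C a \<delta> = pull \<C> (E1 \<C> S) A' c \<delta>'"
  have "arrm S a \<cdot> \<delta> = \<delta>' \<cdot> c"
    using eq a c dist_arr[OF T(1)] dist_arr[OF T(2)] by (simp add: Hom_iff)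
  from dist.fill_mid[OF T a c this]
  show "\<exists>b \<in> Hom B B'. b \<cdot> x = x' \<cdot> a \<and> y' \<cdot> b = c \<cdot> y" by metis
next
  fix A C P assume P: "is_biproduct \<C> A C P"
  then have AC: "A \<in> Obj \<C>" "C \<in> Obj \<C>" by (simp_all add: is_biproduct_def)
  then obtain B x y where T: "is_dist \<C> S \<Delta> A B C x y (Zero \<C> C (objm S A))"
    using dist_third[of A "Zero \<C> C (objm S A)" C] by (auto simp: Hom_iff)
  show "realization_of \<C> S \<Delta> C A \<one>\<^bsub>eobj (E1 \<C> S) C A\<^esub> = seq_class \<C> (inl P) (prr P)"
    using realization_of_eq[OF T] dist.split_triangle[OF T P] by simp
next
  fix A B C x y \<delta> A' B' C' x' y' \<delta>' P Q R \<theta>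
  assume T: "is_dist \<C> S \<Delta> A B C x y \<delta>" "is_dist \<C> S \<Delta> A' B' C' x' y' \<delta>'"
    and P: "is_biproduct \<C> A A' P" and Q: "is_biproduct \<C> B B' Q" and R: "is_biproduct \<C> C C' R"
    and th: "is_ext_dsum (E1 \<C> S) C C' A A' R P \<delta> \<delta>' \<theta>"
  have "vertex P \<in> Obj \<C>" "\<theta> \<in> Hom (vertex R) (objm S (vertex P))"
    using P th by (simp_all add: is_biproduct_def is_ext_dsum_def)
  then obtain W u v where W: "is_dist \<C> S \<Delta> (vertex P) W (vertex R) u v \<theta>" using dist_third by blast
  have "seq_class \<C> u v = seq_class \<C> (dsum \<C> P Q x x') (dsum \<C> Q R y y')"
    by (rule dist.dsum_triangle[OF T W P Q R]) (use th in \<open>simp_all add: is_ext_dsum_def earr_E1\<close>)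
  then show "realization_of \<C> S \<Delta> (vertex R) (vertex P) \<theta>
      = seq_class \<C> (dsum \<C> P Q x x') (dsum \<C> Q R y y')"
    by (simp add: realization_of_eq[OF W])
qed

lemma extriangulated_realization_of: "extriangulated_category \<C> (E1 \<C> S) (realization_of \<C> S \<Delta>)"
proof (unfold_locales, unfold E_triangle_realization_of_iff)
  show "is_Ab_bifunctor \<C> (E1 \<C> S)"
    by (rule E1_bifunctor[OF preadditive_category_axioms shift_functor])
  show "biadditive \<C> (E1 \<C> S)" by (rule biadditive_E1)
  show "additive_realization \<C> (E1 \<C> S) (realization_of \<C> S \<Delta>)" by (rule additive_realization_of)
next
  fix A B C x y \<delta> A' B' C' x' y' \<delta>' a b
  assume T: "is_dist \<C> S \<Delta> A B C x y \<delta>" "is_dist \<C> S \<Delta> A' B' C' x' y' \<delta>'"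
    and a: "a \<in> Hom A A'" and b: "b \<in> Hom B B'" "b \<cdot> x = x' \<cdot> a"
  from dist.fill_right[OF T a b]
  show "\<exists>c \<in> Hom C C'. push \<C> (E1 \<C> S) C a \<delta> = pull \<C> (E1 \<C> S) A' c \<delta>' \<and> y' \<cdot> b = c \<cdot> y"
    using dist_arr[OF T(1)] dist_arr[OF T(2)] by (auto simp: Hom_iff)
next
  fix A B C x y \<delta> A' B' C' x' y' \<delta>' b c
  assume T: "is_dist \<C> S \<Delta> A B C x y \<delta>" "is_dist \<C> S \<Delta> A' B' C' x' y' \<delta>'"
    and b: "b \<in> Hom B B'" and c: "c \<in> Hom C C'" "y' \<cdot> b = c \<cdot> y"
  from dist.fill_left[OF T b c(1) c(2)[symmetric]]
  show "\<exists>a \<in> Hom A A'. push \<C> (E1 \<C> S) C a \<delta> = pull \<C> (E1 \<C> S) A' c \<delta>' \<and> b \<cdot> x = x' \<cdot> a"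
    using dist_arr[OF T(1)] dist_arr[OF T(2)] c by (auto simp: Hom_iff)
next
  fix A B D f f' \<delta> C F g g' \<delta>'
  assume T: "is_dist \<C> S \<Delta> A B D f f' \<delta>" and T': "is_dist \<C> S \<Delta> B C F g g' \<delta>'"
  note t = dist_arr[OF T] and t' = dist_arr[OF T']
  \<comment> \<open>Any completion of \<open>g \<cdot> f\<close> will do, since \<open>TR4\<close>
    applies to every choice of the third triangle.\<close>
  obtain G h' \<delta>'' where T'': "is_dist \<C> S \<Delta> A C G (g \<cdot> f) h' \<delta>''"
    using TR1_cone[of A C "g \<cdot> f"] t t' by (auto simp: Hom_iff)
  note t'' = dist_arr[OF T'']
  obtain d e where de: "is_dist \<C> S \<Delta> D G F d e (arrm S f' \<cdot> \<delta>')" "d \<cdot> f' = h' \<cdot> g" "e \<cdot> h' = g'"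
    "\<delta>'' \<cdot> d = \<delta>" "\<delta>' \<cdot> e = arrm S f \<cdot> \<delta>''"
    using TR4[OF T T' T''] by blast
  have "d \<in> Hom D G" "e \<in> Hom G F" using dist_arr[OF de(1)] by (simp_all add: Hom_iff)
  moreover have "push \<C> (E1 \<C> S) F f' \<delta>' = arrm S f' \<cdot> \<delta>'" "pull \<C> (E1 \<C> S) A d \<delta>'' = \<delta>"
    "push \<C> (E1 \<C> S) G f \<delta>'' = pull \<C> (E1 \<C> S) B e \<delta>'"
    using de(4,5) t t' t'' dist_arr[OF de(1)] by simp_all
  ultimately show "\<exists>G h h' \<delta>'' d e.
      is_dist \<C> S \<Delta> A C G h h' \<delta>'' \<and> h = g \<cdot> f \<and>
      d \<in> Hom D G \<and> e \<in> Hom G F \<and> d \<cdot> f' = h' \<cdot> g \<and> e \<cdot> h' = g' \<and>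
      is_dist \<C> S \<Delta> D G F d e (push \<C> (E1 \<C> S) F f' \<delta>') \<and>
      pull \<C> (E1 \<C> S) A d \<delta>'' = \<delta> \<and>
      push \<C> (E1 \<C> S) G f \<delta>'' = pull \<C> (E1 \<C> S) B e \<delta>'"
    using T'' de(1-3) by metis
next
  fix D A B f' f \<delta> F C g' g \<delta>'
  assume T: "is_dist \<C> S \<Delta> D A B f' f \<delta>" and T': "is_dist \<C> S \<Delta> F B C g' g \<delta>'"
  note t = dist_arr[OF T] and t' = dist_arr[OF T']
  \<comment> \<open>Here \<open>g \<cdot> f\<close> has to be the second map. A triangle with
    \<open>g \<cdot> f\<close> as first map is rotated back, once its third object has been replaced
    by a shift \<open>G[1]\<close> and its third map written as \<open>-h'[1]\<close>.\<close>
  obtain H u v where R: "is_dist \<C> S \<Delta> A C H (g \<cdot> f) u v"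
    using TR1_cone[of A C "g \<cdot> f"] t t' by (auto simp: Hom_iff)
  note r = dist_arr[OF R]
  obtain G i where G: "G \<in> Obj \<C>" and i: "is_iso \<C> H (objm S G) i" by (rule shift_surj[OF r(3)])
  obtain j where j: "i \<in> Hom H (objm S G)" "j \<in> Hom (objm S G) H" "j \<cdot> i = Id \<C> H"
    using i by (rule is_isoE)
  have R': "is_dist \<C> S \<Delta> A C (objm S G) (g \<cdot> f) (i \<cdot> u) (v \<cdot> j)"
    using r j by (intro dist_iso_right[OF R i]) (simp_all add: Hom_iff)
  have "Neg \<C> (v \<cdot> j) \<in> Hom (objm S G) (objm S A)" using r j by (simp add: Hom_iff)
  then obtain h' where h': "h' \<in> Hom G A" "arrm S h' = Neg \<C> (v \<cdot> j)" by (rule shift_full[OF G r(1)])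
  have vj: "v \<cdot> j = Neg \<C> (arrm S h')" using h' r j by (simp add: Hom_iff)
  have tri: "is_triangle \<C> S G A C h' (g \<cdot> f) (i \<cdot> u)"
    using h'(1) G r j by (simp add: is_triangle_def Hom_iff)
  have T'': "is_dist \<C> S \<Delta> G A C h' (g \<cdot> f) (i \<cdot> u)" using R' unfolding vj TR2[OF tri] .
  obtain d e where de: "is_dist \<C> S \<Delta> D G F d e (\<delta> \<cdot> g')" "h' \<cdot> d = f'" "f \<cdot> h' = g' \<cdot> e"
    "\<delta>' = arrm S e \<cdot> (i \<cdot> u)" "arrm S d \<cdot> \<delta> = (i \<cdot> u) \<cdot> g"
    using octahedral_dual[OF T T' T''] by blast
  have "d \<in> Hom D G" "e \<in> Hom G F" using dist_arr[OF de(1)] by (simp_all add: Hom_iff)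
  moreover have "push \<C> (E1 \<C> S) B d \<delta> = pull \<C> (E1 \<C> S) G g (i \<cdot> u)"
    "push \<C> (E1 \<C> S) C e (i \<cdot> u) = arrm S e \<cdot> (i \<cdot> u)" "pull \<C> (E1 \<C> S) D g' \<delta> = \<delta> \<cdot> g'"
    using de(5) t t' dist_arr[OF T''] by simp_all
  ultimately show "\<exists>G h h' \<delta>'' d e.
      is_dist \<C> S \<Delta> G A C h' h \<delta>'' \<and> h = g \<cdot> f \<and>
      d \<in> Hom D G \<and> e \<in> Hom G F \<and> h' \<cdot> d = f' \<and> f \<cdot> h' = g' \<cdot> e \<and>
      is_dist \<C> S \<Delta> D G F d e (pull \<C> (E1 \<C> S) D g' \<delta>) \<and>
      \<delta>' = push \<C> (E1 \<C> S) C e \<delta>'' \<and>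
      push \<C> (E1 \<C> S) B d \<delta> = pull \<C> (E1 \<C> S) G g \<delta>''"
    using T'' de(1-4) by metis
qed

text \<open>Equality as sets of triples holds because \<open>dist_triangle\<close> keeps ill-typed
  triples out of \<open>\<Delta>\<close>.\<close>

lemma triangles_of_realization_of: "triangles_of \<C> S (realization_of \<C> S \<Delta>) = \<Delta>"
proof -
  have "triangles_of \<C> S (realization_of \<C> S \<Delta>) = {(x, y, \<delta>). \<exists>A B C. is_dist \<C> S \<Delta> A B C x y \<delta>}"
    unfolding triangles_of_def E_triangle_realization_of_iff[symmetric] E_triangle_E1_iff by simp
  also have "\<dots> = \<Delta>" using dist_triangle by (auto simp: is_dist_def)
  finally show ?thesis .
qed

end

section \<open>Extriangulated categories with shift bifunctor are triangulated\<close>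

text \<open>A Yoneda argument: pushing the universal extension, the identity of \<open>A[1]\<close>,
  forward along \<open>f\<close> gives \<open>f[1]\<close>. Biadditivity at this one element is
  additivity of the shift.\<close>

lemma shifted_categoryI:
  fixes \<C> :: "('o, 'm, 'x) addcat_scheme" (structure)
  assumes "additive_category \<C>" and S: "auto_equivalence \<C> S" and E: "biadditive \<C> (E1 \<C> S)"
  shows "shifted_category \<C> S"
proof -
  interpret additive_category \<C> by fact
  show ?thesis
  proof
    show "auto_equivalence \<C> S" by fact
    fix f g A B assume f: "f \<in> Hom A B" and g: "g \<in> Hom A B"
    have AB: "A \<in> Obj \<C>" "B \<in> Obj \<C>" using f Dom_Obj[of f] Cod_Obj[of f] by (auto simp: Hom_iff)
    have F: "is_functor \<C> \<C> S" using S by (simp add: auto_equivalence_def)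
    then have SO: "objm S A \<in> Obj \<C>" using AB by (simp add: is_functor_def)
    have SH: "arrm S k \<in> Hom (objm S A) (objm S B)" if "k \<in> Hom A B" for k
      using F that AB by (simp add: is_functor_def)
    have fg: "f \<boxplus> g \<in> Hom A B" using f g by (simp add: Hom_iff)
    have "Id \<C> (objm S A) \<in> Ext (E1 \<C> S) (objm S A) A"
      using SO by (simp add: E1_def Hom_iff)
    then have "earr (E1 \<C> S) (Id \<C> (objm S A)) (f \<boxplus> g) (Id \<C> (objm S A))
      = earr (E1 \<C> S) (Id \<C> (objm S A)) f (Id \<C> (objm S A))
        \<otimes>\<^bsub>eobj (E1 \<C> S) (objm S A) B\<^esub> earr (E1 \<C> S) (Id \<C> (objm S A)) g (Id \<C> (objm S A))"
      using E AB SO f g unfolding biadditive_def by blast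
    then show "arrm S (f \<boxplus> g) = arrm S f \<boxplus> arrm S g"
      using SH[OF f] SH[OF g] SH[OF fg] SO by (simp add: E1_def Hom_iff)
  qed
qed

locale shift_extriangulated_category =
  shifted_category \<C> S + extriangulated_category \<C> "E1 \<C> S" s
  for \<C> :: "('o, 'm, 'x) addcat_scheme" (structure) and S :: "('o, 'm) endoftor"
    and s :: "('o, 'm, 'm) rlz"
begin

abbreviation "ETri \<equiv> E_triangle \<C> (E1 \<C> S) s"

lemma ETri_arr:
  assumes "ETri A B C x y \<delta>"
  shows "A \<in> Obj \<C>" "B \<in> Obj \<C>" "C \<in> Obj \<C>" "x \<in> Arr \<C>" "y \<in> Arr \<C>" "\<delta> \<in> Arr \<C>"
    "Dom \<C> x = A" "Cod \<C> x = B" "Dom \<C> y = B" "Cod \<C> y = C" "Dom \<C> \<delta> = C" "Cod \<C> \<delta> = objm S A"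
  using assms by (auto simp: E_triangle_E1_iff is_triangle_def Hom_iff)

lemma ETri_third:
  assumes "A \<in> Obj \<C>" "\<delta> \<in> Hom C (objm S A)"
  shows "\<exists>B x y. ETri A B C x y \<delta>"
proof -
  have "C \<in> Obj \<C>" using assms Dom_Obj by (auto simp: Hom_iff)
  then show ?thesis using ET2 assms unfolding additive_realization_def is_realization_def by simp
qed

lemma ETri_split:
  assumes P: "is_biproduct \<C> A C P"
  shows "ETri A (vertex P) C (inl P) (prr P) (Zero \<C> C (objm S A))"
proof -
  have "s C A (Zero \<C> C (objm S A)) = seq_class \<C> (inl P) (prr P)"
    using ET2 P unfolding additive_realization_def by simp
  then show ?thesis using P by (simp add: E_triangle_E1_iff is_triangle_def is_biproduct_def Hom_iff)
qed

sublocale ETri: triangle_class \<C> S ETri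
proof
  fix A B C x y \<delta> A' B' C' x' y' \<delta>'
  assume T: "ETri A B C x y \<delta>" and T': "ETri A' B' C' x' y' \<delta>'"
  note t = ETri_arr[OF T] and t' = ETri_arr[OF T']
  show "is_triangle \<C> S A B C x y \<delta>" using T by (simp add: E_triangle_E1_iff)
  have push: "push \<C> (E1 \<C> S) C a \<delta> = arrm S a \<cdot> \<delta>" for a using t by simp
  have pull: "pull \<C> (E1 \<C> S) A' c \<delta>' = \<delta>' \<cdot> c" if "c \<in> Hom C C'" for c
    using that t' by (simp add: Hom_iff)
  {
    fix a b assume "a \<in> Hom A A'" "b \<in> Hom B B'" "b \<cdot> x = x' \<cdot> a"
    from ET3[OF T T' this] push pull
    show "\<exists>c \<in> Hom C C'. c \<cdot> y = y' \<cdot> b \<and> arrm S a \<cdot> \<delta> = \<delta>' \<cdot> c" by metis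
  next
    fix a c assume a: "a \<in> Hom A A'" and c: "c \<in> Hom C C'" and eq: "arrm S a \<cdot> \<delta> = \<delta>' \<cdot> c"
    have "is_realization \<C> (E1 \<C> S) s" using ET2 by (simp add: additive_realization_def)
    moreover have "push \<C> (E1 \<C> S) C a \<delta> = pull \<C> (E1 \<C> S) A' c \<delta>'" using push pull[OF c] eq by simp
    ultimately show "\<exists>b \<in> Hom B B'. b \<cdot> x = x' \<cdot> a \<and> c \<cdot> y = y' \<cdot> b"
      using T T' a c unfolding is_realization_def by metis
  next
    fix b c assume "b \<in> Hom B B'" "c \<in> Hom C C'" "c \<cdot> y = y' \<cdot> b"
    from ET3op[OF T T' this(1,2) this(3)[symmetric]] push pull[OF this(2)]
    show "\<exists>a \<in> Hom A A'. b \<cdot> x = x' \<cdot> a \<and> arrm S a \<cdot> \<delta> = \<delta>' \<cdot> c" by metis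
  }
next
  fix A Z assume A: "A \<in> Obj \<C>" and Z: "zero_object \<C> Z"
  have ZO: "Z \<in> Obj \<C>" "Zero \<C> Z Z = Id \<C> Z" using Z by (simp_all add: zero_object_iff)
  \<comment> \<open>\<open>A\<close> itself serves as vertex of \<open>A \<oplus> 0\<close> and,
    further down, of \<open>0 \<oplus> A\<close>; the split conflations of these biproducts are the
    trivial triangles.\<close>
  have "is_biproduct \<C> A Z \<lparr>vertex = A, inl = Id \<C> A, inr = Zero \<C> Z A, prl = Id \<C> A, prr = Zero \<C> A Z\<rparr>"
    using A ZO by (simp add: is_biproduct_def Hom_iff)
  from ETri_split[OF this]
  show "ETri A A Z (Id \<C> A) (Zero \<C> A Z) (Zero \<C> Z (objm S A))" by simp
  have "is_biproduct \<C> Z A \<lparr>vertex = A, inl = Zero \<C> Z A, inr = Id \<C> A, prl = Zero \<C> A Z, prr = Id \<C> A\<rparr>"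
    using A ZO by (simp add: is_biproduct_def Hom_iff)
  from ETri_split[OF this]
  show "ETri Z A A (Zero \<C> Z A) (Id \<C> A) (Zero \<C> A (objm S Z))" by simp
qed

section \<open>Invariance under isomorphism and rotation of E-triangles\<close>

lemma ETri_seq_class:
  assumes T: "ETri A B C x y \<delta>" and x': "x' \<in> Hom A B'" and y': "y' \<in> Hom B' C"
    and eq: "seq_class \<C> x y = seq_class \<C> x' y'"
  shows "ETri A B' C x' y' \<delta>"
  using T x' y' eq Cod_Obj[of x'] by (auto simp: E_triangle_E1_iff is_triangle_def Hom_iff)

text \<open>The axioms give no direct transport along isomorphisms of the end terms. So
  \<open>\<delta>'\<close> is realized afresh, fill-ins \<open>k\<close> and \<open>l\<close> relate
  this realization to the old triangle, and \<open>b\<close> carries the comparison over to the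
  candidate.\<close>

lemma ETri_iso:
  assumes T: "ETri A B C x y \<delta>" and tri: "is_triangle \<C> S A' B' C' x' y' \<delta>'"
    and a: "is_iso \<C> A A' a" and b: "is_iso \<C> B B' b" and c: "is_iso \<C> C C' c"
    and eq: "b \<cdot> x = x' \<cdot> a" "c \<cdot> y = y' \<cdot> b" "arrm S a \<cdot> \<delta> = \<delta>' \<cdot> c"
  shows "ETri A' B' C' x' y' \<delta>'"
proof -
  note t = ETri_arr[OF T]
  have tri': "A' \<in> Obj \<C>" "B' \<in> Obj \<C>" "C' \<in> Obj \<C>" "x' \<in> Hom A' B'" "y' \<in> Hom B' C'"
    "\<delta>' \<in> Hom C' (objm S A')" using tri by (simp_all add: is_triangle_def)
  obtain B\<^sub>0 x\<^sub>0 y\<^sub>0 where T\<^sub>0: "ETri A' B\<^sub>0 C' x\<^sub>0 y\<^sub>0 \<delta>'" using ETri_third[OF tri'(1,6)] by blast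
  note t\<^sub>0 = ETri_arr[OF T\<^sub>0]
  obtain ai where ai: "a \<in> Hom A A'" "ai \<in> Hom A' A" "ai \<cdot> a = Id \<C> A" "a \<cdot> ai = Id \<C> A'"
    using a by (rule is_isoE)
  obtain bi where bi: "b \<in> Hom B B'" "bi \<in> Hom B' B" "bi \<cdot> b = Id \<C> B" "b \<cdot> bi = Id \<C> B'"
    using b by (rule is_isoE)
  obtain ci where ci: "c \<in> Hom C C'" "ci \<in> Hom C' C" "ci \<cdot> c = Id \<C> C" "c \<cdot> ci = Id \<C> C'"
    using c by (rule is_isoE)
  note h = tri'(4-6)[unfolded Hom_iff] ai(1,2)[unfolded Hom_iff] bi(1,2)[unfolded Hom_iff]
    ci(1,2)[unfolded Hom_iff] t t\<^sub>0
  have "arrm S ai \<cdot> \<delta>' = arrm S ai \<cdot> ((\<delta>' \<cdot> c) \<cdot> ci)" using h by (simp add: ci(4))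
  also have "\<dots> = (arrm S (ai \<cdot> a) \<cdot> \<delta>) \<cdot> ci" unfolding eq(3)[symmetric] using h by simp
  also have "\<dots> = \<delta> \<cdot> ci" unfolding ai(3) using h by simp
  finally have eq': "arrm S ai \<cdot> \<delta>' = \<delta> \<cdot> ci" .
  obtain k where k: "k \<in> Hom B B\<^sub>0" "k \<cdot> x = x\<^sub>0 \<cdot> a" "c \<cdot> y = y\<^sub>0 \<cdot> k"
    using ETri.fill_mid[OF T T\<^sub>0 ai(1) ci(1) eq(3)] by metis
  obtain l where l: "l \<in> Hom B\<^sub>0 B" "l \<cdot> x\<^sub>0 = x \<cdot> ai" "ci \<cdot> y\<^sub>0 = y \<cdot> l"
    using ETri.fill_mid[OF T\<^sub>0 T ai(2) ci(2) eq'] by metis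
  note kl = k(1)[unfolded Hom_iff] l(1)[unfolded Hom_iff]
  have "seq_class \<C> x\<^sub>0 y\<^sub>0 = seq_class \<C> x' y'"
  proof (rule cokernel_covering_seq_class[OF ETri.triangle_cokernel_covering[OF T\<^sub>0]
        cokernel_covering_iso_transfer[OF ETri.triangle_cokernel_covering[OF T] tri'(4,5) ai(1) b c eq(1,2)]])
    show "b \<cdot> l \<in> Hom B\<^sub>0 B'" "k \<cdot> bi \<in> Hom B' B\<^sub>0" using h kl by (simp_all add: Hom_iff)
    have "(b \<cdot> l) \<cdot> x\<^sub>0 = (b \<cdot> x) \<cdot> ai" using h kl by (simp add: l(2))
    also have "\<dots> = x'" unfolding eq(1) using h by (simp add: ai(4))
    finally show "(b \<cdot> l) \<cdot> x\<^sub>0 = x'" .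
    have "y' \<cdot> (b \<cdot> l) = (c \<cdot> y) \<cdot> l" unfolding eq(2) using h kl by simp
    also have "\<dots> = c \<cdot> (ci \<cdot> y\<^sub>0)" unfolding l(3) using h kl by simp
    also have "\<dots> = y\<^sub>0" using h comp_subst[OF ci(4), of y\<^sub>0] by simp
    finally show "y' \<cdot> (b \<cdot> l) = y\<^sub>0" .
    have "(k \<cdot> bi) \<cdot> x' = k \<cdot> (bi \<cdot> ((x' \<cdot> a) \<cdot> ai))" using h kl by (simp add: ai(4))
    also have "\<dots> = k \<cdot> (((bi \<cdot> b) \<cdot> x) \<cdot> ai)" unfolding eq(1)[symmetric] using h kl by simp
    also have "\<dots> = (k \<cdot> x) \<cdot> ai" unfolding bi(3) using h kl by simp
    also have "\<dots> = x\<^sub>0" unfolding k(2) using h by (simp add: ai(4))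
    finally show "(k \<cdot> bi) \<cdot> x' = x\<^sub>0" .
    have "y\<^sub>0 \<cdot> (k \<cdot> bi) = (c \<cdot> y) \<cdot> bi" unfolding k(3) using h kl by simp
    also have "\<dots> = y'" unfolding eq(2) using h by (simp add: bi(4))
    finally show "y\<^sub>0 \<cdot> (k \<cdot> bi) = y'" .
  qed
  then show ?thesis by (rule ETri_seq_class[OF T\<^sub>0 tri'(4,5)])
qed

text \<open>In any realization of \<open>(\<delta>, 1)\<close> the inflation vanishes and the
  deflation \<open>v\<close> is a split monomorphism with \<open>\<theta> \<cdot> v = 0\<close>. The
  map \<open>(1, -\<delta>)\<close> is another kernel of \<open>(\<delta>, 1)\<close>, and
  \<open>prl P \<cdot> v\<close> identifies the two.\<close>

lemma ETri_graph:
  assumes A: "A \<in> Obj \<C>" and \<delta>: "\<delta> \<in> Hom C (objm S A)" and P: "is_biproduct \<C> C (objm S A) P"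
  shows "ETri A C (vertex P) (Zero \<C> A C) (inl P \<boxplus> Neg \<C> (inr P \<cdot> \<delta>)) ((\<delta> \<cdot> prl P) \<boxplus> prr P)"
proof -
  have p: "vertex P \<in> Obj \<C>" "inl P \<in> Hom C (vertex P)" "inr P \<in> Hom (objm S A) (vertex P)"
      "prl P \<in> Hom (vertex P) C" "prr P \<in> Hom (vertex P) (objm S A)"
    and C: "C \<in> Obj \<C>"
    and p_eq: "prl P \<cdot> inl P = Id \<C> C" "prr P \<cdot> inr P = Id \<C> (objm S A)" "prr P \<cdot> inl P = Zero \<C> C (objm S A)"
      "prl P \<cdot> inr P = Zero \<C> (objm S A) C"
    and p_Id: "(inl P \<cdot> prl P) \<boxplus> (inr P \<cdot> prr P) = Id \<C> (vertex P)"
    using P by (simp_all add: is_biproduct_def)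
  let ?\<theta> = "(\<delta> \<cdot> prl P) \<boxplus> prr P" and ?k = "inl P \<boxplus> Neg \<C> (inr P \<cdot> \<delta>)"
  note h = p(2-5)[unfolded Hom_iff] p(1) C A \<delta>[unfolded Hom_iff]
  note p_subst = p_eq comp_subst[OF p_eq(1)] comp_subst[OF p_eq(2)] comp_subst[OF p_eq(3)] comp_subst[OF p_eq(4)]
  have th: "?\<theta> \<in> Hom (vertex P) (objm S A)" and k: "?k \<in> Hom C (vertex P)"
    using h by (simp_all add: Hom_iff)
  obtain N u v where T: "ETri A N (vertex P) u v ?\<theta>" using ETri_third[OF A th] by blast
  note t = ETri_arr[OF T]
  have th_inr: "?\<theta> \<cdot> inr P = Id \<C> (objm S A)" using h by (simp add: p_eq)
  \<comment> \<open>\<open>inr P\<close> is a section of \<open>(\<delta>, 1)\<close>, so the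
    relation \<open>u[1] \<cdot> \<theta> = 0\<close> already gives \<open>u[1] = 0\<close>.\<close>
  have "arrm S u = (arrm S u \<cdot> ?\<theta>) \<cdot> inr P"
    using h t th_inr comp_assoc[of "inr P" ?\<theta> "arrm S u"] by simp
  also have "\<dots> = arrm S (Zero \<C> A N)" unfolding ETri.triangle_Sx_delta[OF T] using h t by simp
  finally have u0: "u = Zero \<C> A N" using shift_faithful[of u A N "Zero \<C> A N"] t by (simp add: Hom_iff)
  \<comment> \<open>As \<open>u\<close> is zero, even the identity of \<open>N\<close> kills it and
    hence factors through \<open>v\<close>.\<close>
  have "Id \<C> N \<in> Hom N N" "Id \<C> N \<cdot> u = Zero \<C> A N" using t u0 by (simp_all add: Hom_iff)
  then obtain m where m: "m \<in> Hom (vertex P) N" "Id \<C> N = m \<cdot> v"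
    by (rule cokernel_covering_factor[OF ETri.triangle_cokernel_covering[OF T]])
  have "?\<theta> \<cdot> ?k = Zero \<C> C (objm S A)" using h by (simp add: p_subst)
  then obtain t1 where t1: "t1 \<in> Hom C N" "?k = v \<cdot> t1"
    using ETri.triangle_factor_through_y[OF T k] by blast
  let ?t2 = "prl P \<cdot> v"
  note h' = h t m(1)[unfolded Hom_iff] t1(1)[unfolded Hom_iff]
  have "?t2 \<cdot> t1 = prl P \<cdot> ?k" unfolding t1(2) using h' by simp
  also have "\<dots> = Id \<C> C" using h by (simp add: p_subst)
  finally have t21: "?t2 \<cdot> t1 = Id \<C> C" .
  \<comment> \<open>In components \<open>\<theta> \<cdot> v = 0\<close> says that the second
    coordinate of \<open>v\<close> is \<open>-\<delta>\<close> applied to the first, that is,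
    \<open>v\<close> factors through the graph \<open>?k\<close>.\<close>
  have "Neg \<C> (\<delta> \<cdot> ?t2) = prr P \<cdot> v"
  proof (rule neg_unique[symmetric])
    have "prr P \<cdot> v \<boxplus> \<delta> \<cdot> prl P \<cdot> v = ?\<theta> \<cdot> v" using h' by (simp add: add_comm)
    also have "\<dots> = Zero \<C> N (objm S A)" by (rule ETri.triangle_delta_y[OF T])
    finally show "prr P \<cdot> v \<boxplus> \<delta> \<cdot> prl P \<cdot> v = Zero \<C> (Dom \<C> (\<delta> \<cdot> ?t2)) (Cod \<C> (\<delta> \<cdot> ?t2))"
      using h' by simp
  qed (use h' in simp_all)
  then have d2: "prr P \<cdot> v = Neg \<C> (\<delta> \<cdot> ?t2)" by simp
  have "?k \<cdot> ?t2 = (inl P \<cdot> ?t2) \<boxplus> (inr P \<cdot> Neg \<C> (\<delta> \<cdot> ?t2))" using h' by simp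
  also have "\<dots> = ((inl P \<cdot> prl P) \<boxplus> (inr P \<cdot> prr P)) \<cdot> v" unfolding d2[symmetric] using h' by simp
  also have "\<dots> = v" unfolding p_Id using h' by simp
  finally have kt2: "?k \<cdot> ?t2 = v" .
  have "t1 \<cdot> ?t2 = (m \<cdot> v) \<cdot> (t1 \<cdot> ?t2)" unfolding m(2)[symmetric] using h' by simp
  also have "\<dots> = m \<cdot> ((v \<cdot> t1) \<cdot> ?t2)" using h' by simp
  also have "\<dots> = Id \<C> N" unfolding t1(2)[symmetric] kt2 m(2) ..
  finally have t12: "t1 \<cdot> ?t2 = Id \<C> N" .
  have iso: "is_iso \<C> N C ?t2" using t21 t12 h' by (intro is_isoI[where g = t1]) (simp_all add: Hom_iff)
  have "is_triangle \<C> S A C (vertex P) (Zero \<C> A C) ?k ?\<theta>"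
    using th k h by (simp add: is_triangle_def Hom_iff)
  then show ?thesis
  proof (rule ETri_iso[OF T _ is_iso_Id iso is_iso_Id])
    show "?t2 \<cdot> u = Zero \<C> A C \<cdot> Id \<C> A" using h' by (simp add: u0)
    show "Id \<C> (vertex P) \<cdot> v = ?k \<cdot> ?t2" unfolding kt2 using h' by simp
    show "arrm S (Id \<C> A) \<cdot> ?\<theta> = ?\<theta> \<cdot> Id \<C> (vertex P)" using h by simp
  qed (use h in simp_all)
qed

text \<open>Apply \<open>ET4op\<close> to the deflation \<open>(1, -\<delta>)\<close> followed by the projection to \<open>A[1]\<close>;
  the composite is \<open>-\<delta>\<close>.\<close>

lemma ETri_rotate:
  assumes T: "ETri A B C x y \<delta>"
  shows "ETri B C (objm S A) y \<delta> (Neg \<C> (arrm S x))"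
proof -
  note t = ETri_arr[OF T]
  obtain P where P: "is_biproduct \<C> C (objm S A) P" using ex_biproduct t by (meson shift_Obj)
  have p: "vertex P \<in> Obj \<C>" "inl P \<in> Hom C (vertex P)" "inr P \<in> Hom (objm S A) (vertex P)"
      "prl P \<in> Hom (vertex P) C" "prr P \<in> Hom (vertex P) (objm S A)"
    and p_eq: "prl P \<cdot> inl P = Id \<C> C" "prr P \<cdot> inr P = Id \<C> (objm S A)" "prr P \<cdot> inl P = Zero \<C> C (objm S A)"
      "prl P \<cdot> inr P = Zero \<C> (objm S A) C"
    using P by (simp_all add: is_biproduct_def)
  let ?\<theta> = "(\<delta> \<cdot> prl P) \<boxplus> prr P" and ?k = "inl P \<boxplus> Neg \<C> (inr P \<cdot> \<delta>)"
  note p_subst = p_eq comp_subst[OF p_eq(1)] comp_subst[OF p_eq(2)] comp_subst[OF p_eq(3)] comp_subst[OF p_eq(4)]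
  have \<delta>: "\<delta> \<in> Hom C (objm S A)" using t by (simp add: Hom_iff)
  note K = ETri_graph[OF t(1) \<delta> P] and Pr = ETri_split[OF P]
  obtain G g h' \<delta>'' d e where G: "ETri G C (objm S A) h' g \<delta>''" and g: "g = prr P \<cdot> ?k"
    and d: "d \<in> Hom A G" and e: "e \<in> Hom G C" and he: "?k \<cdot> h' = inl P \<cdot> e"
    and de: "ETri A G C d e (pull \<C> (E1 \<C> S) A (inl P) ?\<theta>)"
    and dth: "push \<C> (E1 \<C> S) (vertex P) d ?\<theta> = pull \<C> (E1 \<C> S) G (prr P) \<delta>''"
    using ET4op[OF K Pr] by blast
  note gt = ETri_arr[OF G]
  note h = p(2-5)[unfolded Hom_iff] p(1) t gt d[unfolded Hom_iff] e[unfolded Hom_iff]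
  \<comment> \<open>\<open>prl P\<close> is a retraction of both \<open>?k\<close> and
    \<open>inl P\<close>.\<close>
  have "h' = (prl P \<cdot> ?k) \<cdot> h'" using h by (simp add: p_subst)
  also have "\<dots> = prl P \<cdot> (inl P \<cdot> e)" unfolding he[symmetric] using h by (simp del: comp_add add_comp)
  also have "\<dots> = e" using h by (simp add: p_subst)
  finally have h'e: "h' = e" .
  have g_eq: "g = Neg \<C> \<delta>" unfolding g using h by (simp add: p_subst)
  \<comment> \<open>Restricted to the first summand, \<open>(\<delta>, 1)\<close> is
    \<open>\<delta>\<close>: thus \<open>d\<close> and \<open>e\<close> form a second realization of
    \<open>\<delta>\<close>, equivalent to the given one.\<close>
  have "pull \<C> (E1 \<C> S) A (inl P) ?\<theta> = ?\<theta> \<cdot> inl P" using h by (intro pull_E1) simp_all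
  also have "\<dots> = \<delta>" using h by (simp add: p_subst)
  finally have de': "ETri A G C d e \<delta>" using de by simp
  have dth': "arrm S d \<cdot> ?\<theta> = \<delta>'' \<cdot> prr P" using dth h by simp
  \<comment> \<open>On the second summand \<open>(\<delta>, 1)\<close> is the identity, so
    restricting \<open>dth'\<close> along \<open>inr P\<close> determines
    \<open>\<delta>''\<close>.\<close>
  have "arrm S d = arrm S d \<cdot> (?\<theta> \<cdot> inr P)" using h by (simp add: p_subst)
  also have "\<dots> = (arrm S d \<cdot> ?\<theta>) \<cdot> inr P" using h by (simp del: comp_add add_comp)
  also have "\<dots> = \<delta>''" unfolding dth' using h by (simp add: p_subst)
  finally have Sd: "\<delta>'' = arrm S d" ..
  have G': "ETri G C (objm S A) e (Neg \<C> \<delta>) (arrm S d)" using G unfolding h'e g_eq Sd .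
  have "x \<in> Hom A B" "y \<in> Hom B C" using t by (simp_all add: Hom_iff)
  then obtain b where b: "is_iso \<C> G B b" "b \<cdot> d = x" "y \<cdot> b = e"
    using ETri.triangle_seq_class_unique[OF de' T] seq_class_eq_iff[OF d e] by metis
  have b': "b \<in> Arr \<C>" "Dom \<C> b = G" "Cod \<C> b = B" using b(1) by (auto simp: is_iso_def Hom_iff)
  have "is_triangle \<C> S B C (objm S A) y \<delta> (Neg \<C> (arrm S x))"
    using t by (simp add: is_triangle_def Hom_iff)
  \<comment> \<open>The isomorphism \<open>-1\<close> on \<open>A[1]\<close> moves the sign from the
    second map \<open>-\<delta>\<close> to the third.\<close>
  then show ?thesis
  proof (rule ETri_iso[OF G' _ b(1) is_iso_Id is_iso_neg_Id])
    show "Id \<C> C \<cdot> e = y \<cdot> b" using h b(3) by simp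
    show "Neg \<C> (Id \<C> (objm S A)) \<cdot> Neg \<C> \<delta> = \<delta> \<cdot> Id \<C> C" using h by simp
    have "arrm S b \<cdot> arrm S d = arrm S x" unfolding b(2)[symmetric] using h b' by simp
    then show "arrm S b \<cdot> arrm S d = Neg \<C> (arrm S x) \<cdot> Neg \<C> (Id \<C> (objm S A))" using t by simp
  qed (use t in simp_all)
qed

text \<open>The unrotated sequences are not assumed to be E-triangles. One further rotation puts the
  identities of \<open>C\<close> and \<open>A[1]\<close> in the first two places; the right fill-in
  between \<open>B[1]\<close> and \<open>B'[1]\<close> then descends.\<close>

lemma ETri_fill_mid_rotated:
  assumes T: "ETri B C (objm S A) y \<delta> (Neg \<C> (arrm S x))" and T': "ETri B' C (objm S A) y' \<delta> (Neg \<C> (arrm S x'))"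
    and x: "x \<in> Hom A B" and x': "x' \<in> Hom A B'"
  obtains b where "b \<in> Hom B B'" "b \<cdot> x = x'" "y' \<cdot> b = y"
proof -
  note t = ETri_arr[OF T] ETri_arr[OF T'] x[unfolded Hom_iff] x'[unfolded Hom_iff]
  have A: "A \<in> Obj \<C>" using x Dom_Obj by (auto simp: Hom_iff)
  have "Id \<C> C \<in> Hom C C" "Id \<C> (objm S A) \<in> Hom (objm S A) (objm S A)" "Id \<C> (objm S A) \<cdot> \<delta> = \<delta> \<cdot> Id \<C> C"
    using t A by (simp_all add: Hom_iff)
  from ETri.fill_right[OF ETri_rotate[OF T] ETri_rotate[OF T'] this]
  obtain c where c: "c \<in> Hom (objm S B) (objm S B')"
    "c \<cdot> Neg \<C> (arrm S x) = Neg \<C> (arrm S x') \<cdot> Id \<C> (objm S A)"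
    "arrm S (Id \<C> C) \<cdot> Neg \<C> (arrm S y) = Neg \<C> (arrm S y') \<cdot> c" by blast
  obtain b where b: "b \<in> Hom B B'" "arrm S b = c" by (rule shift_full[OF _ _ c(1)]) (use t in simp_all)
  note h = t A b(1)[unfolded Hom_iff]
  have "arrm S (b \<cdot> x) = arrm S x'"
    by (rule neg_inject) (use h c(2) in \<open>simp_all add: b(2)[symmetric]\<close>)
  moreover have "arrm S (y' \<cdot> b) = arrm S y"
    by (rule neg_inject) (use h c(3) in \<open>simp_all add: b(2)[symmetric]\<close>)
  ultimately have "b \<cdot> x = x'" "y' \<cdot> b = y"
    using h shift_faithful[of "b \<cdot> x" A B' x'] shift_faithful[of "y' \<cdot> b" B C y] by (simp_all add: Hom_iff)
  with b(1) show ?thesis by (rule that)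
qed

text \<open>Since rotation cannot simply be inverted, the candidate is compared with a realization
  of the same \<open>\<delta>\<close>, whose rotation is already available.\<close>

lemma ETri_unrotate:
  assumes T: "ETri B C (objm S A) y \<delta> (Neg \<C> (arrm S x))" and tri: "is_triangle \<C> S A B C x y \<delta>"
  shows "ETri A B C x y \<delta>"
proof -
  have t: "A \<in> Obj \<C>" "B \<in> Obj \<C>" "C \<in> Obj \<C>" "x \<in> Hom A B" "y \<in> Hom B C" "\<delta> \<in> Hom C (objm S A)"
    using tri by (simp_all add: is_triangle_def)
  obtain B\<^sub>0 x\<^sub>0 y\<^sub>0 where T\<^sub>0: "ETri A B\<^sub>0 C x\<^sub>0 y\<^sub>0 \<delta>" using ETri_third[OF t(1,6)] by blast
  have x\<^sub>0: "x\<^sub>0 \<in> Hom A B\<^sub>0" using ETri_arr[OF T\<^sub>0] by (simp add: Hom_iff)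
  have cov: "cokernel_covering A B C x y"
    unfolding cokernel_covering_def
  proof (intro conjI ballI impI t)
    fix D n assume D: "D \<in> Obj \<C>" and n: "n \<in> Hom B D" and n0: "n \<cdot> x = Zero \<C> A D"
    note h = t(4-6)[unfolded Hom_iff] t(1-3) n[unfolded Hom_iff] D
    \<comment> \<open>Two more rotations give an E-triangle starting with \<open>-x[1]\<close> and
      \<open>-y[1]\<close>. Its covering property is the desired one after shifting, up to
      sign.\<close>
    have "arrm S n \<cdot> Neg \<C> (arrm S x) = Neg \<C> (arrm S (n \<cdot> x))" using h by simp
    also have "\<dots> = Zero \<C> (objm S A) (objm S D)" unfolding n0 using h by simp
    finally have "arrm S n \<cdot> Neg \<C> (arrm S x) = Zero \<C> (objm S A) (objm S D)" .
    moreover have "arrm S n \<in> Hom (objm S B) (objm S D)" using h by (simp add: Hom_iff)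
    ultimately obtain m where m: "m \<in> Hom (objm S C) (objm S D)" "arrm S n = m \<cdot> Neg \<C> (arrm S y)"
      using cokernel_covering_factor[OF ETri.triangle_cokernel_covering[OF ETri_rotate[OF ETri_rotate[OF T]]]]
      by metis
    obtain m' where m': "m' \<in> Hom C D" "arrm S m' = m" by (rule shift_full[OF t(3) D m(1)])
    note h' = h m'(1)[unfolded Hom_iff]
    \<comment> \<open>The sign of \<open>-y[1]\<close> is absorbed into the factor.\<close>
    have "arrm S n = arrm S (Neg \<C> m' \<cdot> y)" using h' m(2) by (simp add: m'(2)[symmetric])
    then have "n = Neg \<C> m' \<cdot> y"
      using h' shift_faithful[of n B D "Neg \<C> m' \<cdot> y"] by (simp add: Hom_iff)
    moreover have "Neg \<C> m' \<in> Hom C D" using h' by (simp add: Hom_iff)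
    ultimately show "\<exists>m \<in> Hom C D. n = m \<cdot> y" by blast
  qed
  obtain b where b: "b \<in> Hom B B\<^sub>0" "b \<cdot> x = x\<^sub>0" "y\<^sub>0 \<cdot> b = y"
    by (rule ETri_fill_mid_rotated[OF T ETri_rotate[OF T\<^sub>0] t(4) x\<^sub>0])
  obtain b' where b': "b' \<in> Hom B\<^sub>0 B" "b' \<cdot> x\<^sub>0 = x" "y \<cdot> b' = y\<^sub>0"
    by (rule ETri_fill_mid_rotated[OF ETri_rotate[OF T\<^sub>0] T x\<^sub>0 t(4)])
  have "seq_class \<C> x\<^sub>0 y\<^sub>0 = seq_class \<C> x y"
    by (rule cokernel_covering_seq_class[OF ETri.triangle_cokernel_covering[OF T\<^sub>0] cov b' b])
  then show ?thesis by (rule ETri_seq_class[OF T\<^sub>0 t(4,5)])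
qed

text \<open>This makes every morphism an inflation: \<open>-x[1]\<close> is an extension of
  \<open>A[1]\<close> by \<open>B\<close>, and realizing it produces the rotation of a triangle that
  starts with \<open>x\<close>.\<close>

lemma ETri_cone:
  assumes x: "x \<in> Hom A B"
  shows "\<exists>C y z. ETri A B C x y z"
proof -
  have AB: "A \<in> Obj \<C>" "B \<in> Obj \<C>" using x Dom_Obj[of x] Cod_Obj[of x] by (auto simp: Hom_iff)
  have "Neg \<C> (arrm S x) \<in> Hom (objm S A) (objm S B)" using x by (simp add: Hom_iff)
  then obtain C y z where T: "ETri B C (objm S A) y z (Neg \<C> (arrm S x))"
    using ETri_third[OF AB(2)] by blast
  have "is_triangle \<C> S A B C x y z"
    using AB x ETri_arr[OF T] by (simp add: is_triangle_def Hom_iff)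
  then show ?thesis using ETri_unrotate[OF T] by blast
qed

text \<open>(ET4) supplies one third triangle of its own choice, whereas \<open>TR4\<close>
  prescribes it. The two share the map \<open>g \<cdot> f\<close>, and the octahedron is transported
  along an isomorphism of their third objects.\<close>

lemma ETri_octahedral:
  assumes T: "ETri A B D f f' \<delta>" and T': "ETri B C F g g' \<delta>'" and T'': "ETri A C G (g \<cdot> f) h' \<delta>''"
  shows "\<exists>d e. ETri D G F d e (arrm S f' \<cdot> \<delta>') \<and> d \<cdot> f' = h' \<cdot> g \<and> e \<cdot> h' = g' \<and>
    \<delta>'' \<cdot> d = \<delta> \<and> \<delta>' \<cdot> e = arrm S f \<cdot> \<delta>''"
proof -
  note t = ETri_arr[OF T] and t' = ETri_arr[OF T'] and t'' = ETri_arr[OF T'']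
  obtain G\<^sub>0 h\<^sub>0 \<delta>\<^sub>0 d\<^sub>0 e\<^sub>0 where T\<^sub>0: "ETri A C G\<^sub>0 (g \<cdot> f) h\<^sub>0 \<delta>\<^sub>0"
    and d\<^sub>0: "d\<^sub>0 \<in> Hom D G\<^sub>0" and e\<^sub>0: "e\<^sub>0 \<in> Hom G\<^sub>0 F" and eq: "d\<^sub>0 \<cdot> f' = h\<^sub>0 \<cdot> g" "e\<^sub>0 \<cdot> h\<^sub>0 = g'"
    and de: "ETri D G\<^sub>0 F d\<^sub>0 e\<^sub>0 (push \<C> (E1 \<C> S) F f' \<delta>')"
    and pp: "pull \<C> (E1 \<C> S) A d\<^sub>0 \<delta>\<^sub>0 = \<delta>"
      "push \<C> (E1 \<C> S) G\<^sub>0 f \<delta>\<^sub>0 = pull \<C> (E1 \<C> S) B e\<^sub>0 \<delta>'"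
    using ET4[OF T T'] by metis
  note t\<^sub>0 = ETri_arr[OF T\<^sub>0] d\<^sub>0[unfolded Hom_iff] e\<^sub>0[unfolded Hom_iff]
  have pp': "\<delta>\<^sub>0 \<cdot> d\<^sub>0 = \<delta>" "\<delta>' \<cdot> e\<^sub>0 = arrm S f \<cdot> \<delta>\<^sub>0" using pp t t' t\<^sub>0 by simp_all
  have de': "ETri D G\<^sub>0 F d\<^sub>0 e\<^sub>0 (arrm S f' \<cdot> \<delta>')" using de t' by simp
  have "Id \<C> A \<in> Hom A A" "Id \<C> C \<in> Hom C C" "Id \<C> C \<cdot> (g \<cdot> f) = (g \<cdot> f) \<cdot> Id \<C> A"
    using t t' by (simp_all add: Hom_iff)
  note fill = ETri.fill_right[OF T'' T\<^sub>0 this] ETri.fill_right[OF T\<^sub>0 T'' this]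
  from fill(1) obtain c where c: "c \<in> Hom G G\<^sub>0" "c \<cdot> h' = h\<^sub>0" "\<delta>\<^sub>0 \<cdot> c = \<delta>''"
    using t'' t\<^sub>0 by (metis comp_id id_comp shift_Id)
  from fill(2) obtain c' where c': "c' \<in> Hom G\<^sub>0 G" "c' \<cdot> h\<^sub>0 = h'" "\<delta>'' \<cdot> c' = \<delta>\<^sub>0"
    using t'' t\<^sub>0 by (metis comp_id id_comp shift_Id)
  \<comment> \<open>After rotation the third objects become middle terms, so the comparison of
    middle terms applies.\<close>
  have "is_iso \<C> G G\<^sub>0 c"
    by (rule cokernel_covering_iso[OF ETri.triangle_cokernel_covering[OF ETri_rotate[OF T'']]
          ETri.triangle_cokernel_covering[OF ETri_rotate[OF T\<^sub>0]] c c'])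
  then obtain j where j: "j \<in> Hom G\<^sub>0 G" "j \<cdot> c = Id \<C> G" "c \<cdot> j = Id \<C> G\<^sub>0" "is_iso \<C> G\<^sub>0 G j"
    by (rule is_isoE)
  note h = t t' t'' t\<^sub>0 c(1)[unfolded Hom_iff] j(1)[unfolded Hom_iff]
  let ?d = "j \<cdot> d\<^sub>0" and ?e = "e\<^sub>0 \<cdot> c"
  have "is_triangle \<C> S D G F ?d ?e (arrm S f' \<cdot> \<delta>')" using h by (simp add: is_triangle_def Hom_iff)
  then have "ETri D G F ?d ?e (arrm S f' \<cdot> \<delta>')"
    by (rule ETri_iso[OF de' _ is_iso_Id j(4) is_iso_Id]) (use h in \<open>simp_all add: j(3)\<close>)
  moreover have "?d \<cdot> f' = h' \<cdot> g"
  proof -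
    have "?d \<cdot> f' = j \<cdot> (h\<^sub>0 \<cdot> g)" using h by (simp add: eq(1))
    also have "\<dots> = ((j \<cdot> c) \<cdot> h') \<cdot> g" unfolding c(2)[symmetric] using h by simp
    finally show ?thesis unfolding j(2) using h by simp
  qed
  moreover have "?e \<cdot> h' = g'" using h by (simp add: c(2) eq(2))
  moreover have "\<delta>'' \<cdot> ?d = \<delta>"
  proof -
    have "\<delta>'' \<cdot> ?d = \<delta>\<^sub>0 \<cdot> ((c \<cdot> j) \<cdot> d\<^sub>0)" unfolding c(3)[symmetric] using h by simp
    then show ?thesis unfolding j(3) using h by (simp add: pp'(1))
  qed
  moreover have "\<delta>' \<cdot> ?e = arrm S f \<cdot> \<delta>''"
  proof -
    have "\<delta>' \<cdot> ?e = (\<delta>' \<cdot> e\<^sub>0) \<cdot> c" using h by simp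
    also have "\<dots> = arrm S f \<cdot> (\<delta>\<^sub>0 \<cdot> c)" unfolding pp'(2) using h by simp
    finally show ?thesis unfolding c(3) .
  qed
  ultimately show ?thesis by blast
qed

text \<open>\<open>triangles_of\<close> hides the objects under a quantifier; they are recovered
  from \<open>x\<close> and \<open>y\<close>, so \<open>s\<close> is evaluated at the intended end
  terms.\<close>

lemma is_dist_triangles_of_iff:
  "is_dist \<C> S (triangles_of \<C> S s) A B C x y \<delta> \<longleftrightarrow> ETri A B C x y \<delta>"
proof -
  have "A' = A \<and> C' = C" if "is_triangle \<C> S A B C x y \<delta>" "is_triangle \<C> S A' B' C' x y \<delta>" for A' B' C'
    using that by (simp add: is_triangle_def Hom_iff)
  then show ?thesis
    unfolding is_dist_def E_triangle_E1_iff triangles_of_def by blast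
qed

lemma triangulated_triangles_of: "triangulated_category \<C> S (triangles_of \<C> S s)"
proof (unfold_locales, unfold is_dist_triangles_of_iff)
  show "auto_equivalence \<C> S" by (rule shift_equivalence)
  show "additive_functor \<C> \<C> S" using shift_functor shift_add_Hom by (simp add: additive_functor_def)
next
  fix x y z assume "(x, y, z) \<in> triangles_of \<C> S s"
  then show "\<exists>A B C. is_triangle \<C> S A B C x y z" by (auto simp: triangles_of_def)
next
  fix A B C x y z A' B' C' x' y' z' a b c
  assume "ETri A B C x y z" "is_triangle \<C> S A' B' C' x' y' z'" "is_iso \<C> A A' a" "is_iso \<C> B B' b"
    "is_iso \<C> C C' c" "b \<cdot> x = x' \<cdot> a" "c \<cdot> y = y' \<cdot> b" "arrm S a \<cdot> z = z' \<cdot> c"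
  then show "ETri A' B' C' x' y' z'" by (rule ETri_iso)
next
  fix A Z assume "A \<in> Obj \<C>" "zero_object \<C> Z"
  then show "ETri A A Z (Id \<C> A) (Zero \<C> A Z) (Zero \<C> Z (objm S A))" by (rule ETri.T_Id_left)
next
  fix A B x assume "x \<in> Hom A B"
  then show "\<exists>C y z. ETri A B C x y z" by (rule ETri_cone)
next
  fix A B C x y z assume "is_triangle \<C> S A B C x y z"
  then show "ETri A B C x y z \<longleftrightarrow> ETri B C (objm S A) y z (Neg \<C> (arrm S x))"
    using ETri_rotate ETri_unrotate by blast
next
  fix A B C x y z A' B' C' x' y' z' a b
  assume "ETri A B C x y z" "ETri A' B' C' x' y' z'" "a \<in> Hom A A'" "b \<in> Hom B B'" "b \<cdot> x = x' \<cdot> a"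
  then show "\<exists>c \<in> Hom C C'. c \<cdot> y = y' \<cdot> b \<and> arrm S a \<cdot> z = z' \<cdot> c" by (rule ETri.fill_right)
next
  fix A B D f f' \<delta> C F g g' \<delta>' G h' \<delta>''
  assume "ETri A B D f f' \<delta>" "ETri B C F g g' \<delta>'" "ETri A C G (g \<cdot> f) h' \<delta>''"
  then show "\<exists>d e. ETri D G F d e (arrm S f' \<cdot> \<delta>') \<and> d \<cdot> f' = h' \<cdot> g \<and> e \<cdot> h' = g' \<and>
    \<delta>'' \<cdot> d = \<delta> \<and> \<delta>' \<cdot> e = arrm S f \<cdot> \<delta>''" by (rule ETri_octahedral)
qed

lemma realization_of_triangles_of:
  assumes "A \<in> Obj \<C>" "\<delta> \<in> Hom C (objm S A)"
  shows "realization_of \<C> S (triangles_of \<C> S s) C A \<delta> = s C A \<delta>"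
proof -
  obtain B x y where T: "ETri A B C x y \<delta>" using ETri_third[OF assms] by blast
  interpret tri: triangulated_category \<C> S "triangles_of \<C> S s" by (rule triangulated_triangles_of)
  have "realization_of \<C> S (triangles_of \<C> S s) C A \<delta> = seq_class \<C> x y"
    using T by (intro tri.realization_of_eq) (simp add: is_dist_triangles_of_iff)
  also have "\<dots> = s C A \<delta>" using T by (simp add: E_triangle_E1_iff)
  finally show ?thesis .
qed

end

text \<open>The first conjunct includes independence of the chosen triangle. The last two express
  the correspondence by making the constructions mutually inverse, on the \<open>s\<close> side at
  genuine extensions.\<close>

theorem proposition3p22:
  fixes \<C> :: "('o, 'm, 'x) addcat_scheme" and S :: "('o, 'm) endoftor"
  assumes "additive_category \<C>" and "auto_equivalence \<C> S"
  shows
    "(\<forall>\<Delta>. triangulated_category \<C> S \<Delta> \<longrightarrow>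
        (\<forall>C \<in> Obj \<C>. \<forall>A \<in> Obj \<C>. \<forall>\<delta> \<in> Ext (E1 \<C> S) C A.
           (\<exists>B x y. is_dist \<C> S \<Delta> A B C x y \<delta>) \<and>
           (\<forall>B x y. is_dist \<C> S \<Delta> A B C x y \<delta> \<longrightarrow>
              realization_of \<C> S \<Delta> C A \<delta> = seq_class \<C> x y)) \<and>
        extriangulated_category \<C> (E1 \<C> S) (realization_of \<C> S \<Delta>)) \<and>
     (\<forall>s. extriangulated_category \<C> (E1 \<C> S) s \<longrightarrow>
        triangulated_category \<C> S (triangles_of \<C> S s)) \<and>
     (\<forall>\<Delta>. triangulated_category \<C> S \<Delta> \<longrightarrow>
        (\<forall>A B C x y \<delta>. is_dist \<C> S \<Delta> A B C x y \<delta> \<longleftrightarrow>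
           E_triangle \<C> (E1 \<C> S) (realization_of \<C> S \<Delta>) A B C x y \<delta>) \<and>
        triangles_of \<C> S (realization_of \<C> S \<Delta>) = \<Delta>) \<and>
     (\<forall>s. extriangulated_category \<C> (E1 \<C> S) s \<longrightarrow>
        (\<forall>A B C x y \<delta>. E_triangle \<C> (E1 \<C> S) s A B C x y \<delta> \<longleftrightarrow>
           is_dist \<C> S (triangles_of \<C> S s) A B C x y \<delta>) \<and>
        (\<forall>C \<in> Obj \<C>. \<forall>A \<in> Obj \<C>. \<forall>\<delta> \<in> Ext (E1 \<C> S) C A.
           realization_of \<C> S (triangles_of \<C> S s) C A \<delta> = s C A \<delta>))"
proof -
  have tr: "extriangulated_category \<C> (E1 \<C> S) (realization_of \<C> S \<Delta>)"
    "C \<in> Obj \<C> \<Longrightarrow> A \<in> Obj \<C> \<Longrightarrow> \<delta> \<in> Ext (E1 \<C> S) C A \<Longrightarrow> \<exists>B x y. is_dist \<C> S \<Delta> A B C x y \<delta>"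
    "is_dist \<C> S \<Delta> A B C x y \<delta> \<Longrightarrow> realization_of \<C> S \<Delta> C A \<delta> = seq_class \<C> x y"
    "is_dist \<C> S \<Delta> A B C x y \<delta> \<longleftrightarrow> E_triangle \<C> (E1 \<C> S) (realization_of \<C> S \<Delta>) A B C x y \<delta>"
    "triangles_of \<C> S (realization_of \<C> S \<Delta>) = \<Delta>"
    if "triangulated_category \<C> S \<Delta>" for \<Delta> A B C x y \<delta>
  proof -
    interpret triangulated_category \<C> S \<Delta> by fact
    show "extriangulated_category \<C> (E1 \<C> S) (realization_of \<C> S \<Delta>)"
      by (rule extriangulated_realization_of)
    show "C \<in> Obj \<C> \<Longrightarrow> A \<in> Obj \<C> \<Longrightarrow> \<delta> \<in> Ext (E1 \<C> S) C A \<Longrightarrow> \<exists>B x y. is_dist \<C> S \<Delta> A B C x y \<delta>"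
      by (simp add: dist_third)
    show "is_dist \<C> S \<Delta> A B C x y \<delta> \<Longrightarrow> realization_of \<C> S \<Delta> C A \<delta> = seq_class \<C> x y"
      by (rule realization_of_eq)
    show "is_dist \<C> S \<Delta> A B C x y \<delta> \<longleftrightarrow> E_triangle \<C> (E1 \<C> S) (realization_of \<C> S \<Delta>) A B C x y \<delta>"
      by (rule E_triangle_realization_of_iff[symmetric])
    show "triangles_of \<C> S (realization_of \<C> S \<Delta>) = \<Delta>" by (rule triangles_of_realization_of)
  qed
  have ex: "triangulated_category \<C> S (triangles_of \<C> S s)"
    "E_triangle \<C> (E1 \<C> S) s A B C x y \<delta> \<longleftrightarrow> is_dist \<C> S (triangles_of \<C> S s) A B C x y \<delta>"
    "A \<in> Obj \<C> \<Longrightarrow> \<delta> \<in> Ext (E1 \<C> S) C A \<Longrightarrow> realization_of \<C> S (triangles_of \<C> S s) C A \<delta> = s C A \<delta>"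
    if s: "extriangulated_category \<C> (E1 \<C> S) s" for s A B C x y \<delta>
  proof -
    interpret shift_extriangulated_category \<C> S s
      using assms s shifted_categoryI[OF assms extriangulated_category.ET1[OF s]]
      by (intro shift_extriangulated_category.intro)
    show "triangulated_category \<C> S (triangles_of \<C> S s)" by (rule triangulated_triangles_of)
    show "E_triangle \<C> (E1 \<C> S) s A B C x y \<delta> \<longleftrightarrow> is_dist \<C> S (triangles_of \<C> S s) A B C x y \<delta>"
      by (rule is_dist_triangles_of_iff[symmetric])
    show "A \<in> Obj \<C> \<Longrightarrow> \<delta> \<in> Ext (E1 \<C> S) C A \<Longrightarrow> realization_of \<C> S (triangles_of \<C> S s) C A \<delta> = s C A \<delta>"
      by (simp add: realization_of_triangles_of)
  qed
  show ?thesis by (intro conjI allI impI ballI) (rule tr ex; assumption)+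
qed

end
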